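(* For every $n\ge 2$: (a) there are $2^{\aleph_0}$ many pairwise non-homeomorphic graph-like continua which are $n$-ac but not $(n+1)$-ac; and (b) there are $2^{\aleph_0}$ many pairwise non-homeomorphic graph-like continua which are $n$-cc but not $(n+1)$-cc.
   Context: A graph-like continuum is a continuum (compact connected metric space) $X$ with a closed zero-dimensional subset $V$ such that $X\setminus V\cong E\times(0,1)$ for some discrete set $E$. A space is $n$-ac (resp. $n$-cc) if any at most $n$ of its points lie on a common arc (resp. simple closed curve) in it. *)

theory Defs
  imports "HOL-Analysis.Analysis"
begin

definition continuum :: "'a topology \<Rightarrow> bool" where
  "continuum X \<longleftrightarrow>
     topspace X \<noteq> {} \<and> compact_space X \<and> connected_space X \<and> metrizable_space X"

definition zero_dimensional_space :: "'a topology \<Rightarrow> bool" where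
  "zero_dimensional_space X \<longleftrightarrow>
     (\<forall>U x. openin X U \<and> x \<in> U \<longrightarrow>
        (\<exists>W. openin X W \<and> closedin X W \<and> x \<in> W \<and> W \<subseteq> U))"

text \<open>
  The index set \<open>E\<close> of the edges may be taken in the type of the points of \<open>X\<close> without loss of
  generality: a homeomorphism with \<open>E \<times> (0,1)\<close> sends the midpoints of the edges to
  distinct points of \<open>X\<close>.
\<close>

definition graph_like_continuum :: "'a topology \<Rightarrow> bool" where
  "graph_like_continuum X \<longleftrightarrow>
     continuum X \<and>
     (\<exists>V. closedin X V \<and> zero_dimensional_space (subtopology X V) \<and>
        (\<exists>E :: 'a set.
           subtopology X (topspace X - V) homeomorphic_space
             prod_topology (discrete_topology E) (top_of_set {0<..<1::real})))"

definition arc_in :: "'a topology \<Rightarrow> 'a set \<Rightarrow> bool" where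
  "arc_in X A \<longleftrightarrow>
     A \<subseteq> topspace X \<and> subtopology X A homeomorphic_space top_of_set {0..1::real}"

definition simple_closed_curve_in :: "'a topology \<Rightarrow> 'a set \<Rightarrow> bool" where
  "simple_closed_curve_in X C \<longleftrightarrow>
     C \<subseteq> topspace X \<and> subtopology X C homeomorphic_space top_of_set (sphere (0::complex) 1)"

definition n_ac :: "nat \<Rightarrow> 'a topology \<Rightarrow> bool" where
  "n_ac n X \<longleftrightarrow>
     (\<forall>S. S \<subseteq> topspace X \<and> finite S \<and> card S \<le> n \<longrightarrow> (\<exists>A. arc_in X A \<and> S \<subseteq> A))"

definition n_cc :: "nat \<Rightarrow> 'a topology \<Rightarrow> bool" where
  "n_cc n X \<longleftrightarrow>
     (\<forall>S. S \<subseteq> topspace X \<and> finite S \<and> card S \<le> n \<longrightarrow>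
        (\<exists>C. simple_closed_curve_in X C \<and> S \<subseteq> C))"

text \<open>
  There are continuum many pairwise non-homeomorphic spaces with property \<open>P\<close>.  The spaces are
  topologies carried by arbitrary subsets of the type \<^typ>\<open>nat \<Rightarrow> real\<close>.  Every metrizable
  continuum has at most \<open>2\<^sup>\<aleph>\<^sup>0\<close> points, so it is homeomorphic to such a space, and this choice of
  type is no restriction for properties of metrizable continua that are invariant under
  homeomorphism.
\<close>

definition continuum_many_nonhomeomorphic :: "((nat \<Rightarrow> real) topology \<Rightarrow> bool) \<Rightarrow> bool" where
  "continuum_many_nonhomeomorphic P \<longleftrightarrow>
     (\<exists>F :: (nat \<Rightarrow> real) topology set.
        F \<approx> (UNIV :: nat set set) \<and>
        (\<forall>X\<in>F. P X) \<and>
        pairwise (\<lambda>X Y. \<not> X homeomorphic_space Y) F)"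

end

theory Submission
  imports Defs
begin

text \<open>
  The building block is a fractal version of the Hanoi graph on a finite set of \<open>d\<close> corners: \<open>d\<close> copies of
  itself shrunk by the factor \<open>1/3\<close> towards the corners of a simplex, each two of them joined by the
  middle third of the corresponding edge of the simplex.  Its vertices form a Cantor set.  Two corners
  are joined by an arc through any \<open>n\<close> given points once \<open>d\<close> is large: the arc is routed through the
  complete graph on the \<open>d\<close> copies along a trail that uses the prescribed edges, and the passes of
  the trail through one copy are a linking problem of the same kind inside that copy.  After finitely many
  levels every copy contains at most one of the points, and this point is a vertex, which is joined to all the
  corners by rays that meet nowhere else.

  For the circle version, \<open>n\<close> corners of such a hub are joined cyclically by \<open>n\<close> additional arcs (slots).
  If one of the slots contains none of \<open>n\<close> given points, it is replaced by an arc in the hub; otherwise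
  the circle of the slots contains all the points.  Deleting the \<open>n\<close> corners leaves \<open>n + 1\<close> pieces, which
  no circle can visit all.  For the arc version the slots form a line with \<open>n - 1\<close> inner points on the hub.
  One slot is decorated by a null sequence of hubs with more corners.  A vertex of a hub
  that is not a corner at any level is the centre of a fan of exactly as many arcs as the hub has corners, and so the
  set of the numbers of corners of these hubs, which can be prescribed, is a topological invariant.
\<close>

section \<open>Arcs\<close>

text \<open>Linking a single pair of corners does not survive the recursion, since a trail may enter
  one copy many times; so the induction links a whole matching. Edge-disjoint trails suffice
  outside: each edge ends in its own corner of a copy, so the passes have disjoint ends inside. The
  number of pairs must not grow with the depth. All trails but one are single edges with disjoint
  ends and give at most one pass per copy; the remaining trail collects the at most \<open>N\<close>
  prescribed edges and copies and has at most \<open>4 * N + 4\<close> positions. So a budget of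
  \<open>4 * N + 5\<close> pairs reproduces itself. Ends and prescribed letters occupy at most
  \<open>10 * N + 10\<close> letters, and at most \<open>3 * N + 2\<close> fresh ones are needed,
  for which \<open>20 * N + 20\<close> corners leave ample room. As for the invariant, the ends of
  edges and the gluing points are countable, and elsewhere the order of a point can be computed;
  thus it is enough to ask whether the points of a given order are uncountably many.\<close>

definition arc_between :: "'a::topological_space set \<Rightarrow> 'a \<Rightarrow> 'a \<Rightarrow> bool" where
  "arc_between A a b \<longleftrightarrow> (\<exists>g. arc g \<and> path_image g = A \<and> pathstart g = a \<and> pathfinish g = b)"

lemma arc_between_mem: "arc_between A a b \<Longrightarrow> a \<in> A \<and> b \<in> A"
  unfolding arc_between_def by auto

lemma arc_between_sym: "arc_between A a b \<Longrightarrow> arc_between A b a"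
  unfolding arc_between_def by (metis arc_reversepath path_image_reversepath pathfinish_reversepath pathstart_reversepath)

lemma arc_between_connected: "arc_between A a b \<Longrightarrow> connected A"
  unfolding arc_between_def using arc_imp_path connected_path_image by blast

lemma arc_between_join:
  assumes "arc_between A a b" "arc_between B b c" "A \<inter> B \<subseteq> {b}"
  shows "arc_between (A \<union> B) a c"
proof -
  obtain g h where g: "arc g" "path_image g = A" "pathstart g = a" "pathfinish g = b"
    and h: "arc h" "path_image h = B" "pathstart h = b" "pathfinish h = c"
    using assms unfolding arc_between_def by blast
  then have "arc (g +++ h)"
    using assms(3) by (intro arc_join) auto
  then show ?thesis
    unfolding arc_between_def using g h
    by (intro exI[of _ "g +++ h"]) (simp add: path_image_join)
qed

lemma arc_between_chain:
  fixes C :: "nat \<Rightarrow> 'a::topological_space set"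
  assumes "\<And>i. i \<le> m \<Longrightarrow> arc_between (C i) (z i) (z (Suc i))"
    and "\<And>i. i < m \<Longrightarrow> C i \<inter> C (Suc i) \<subseteq> {z (Suc i)}"
    and "\<And>i j. i + 1 < j \<Longrightarrow> j \<le> m \<Longrightarrow> C i \<inter> C j = {}"
  shows "arc_between (\<Union>i\<le>m. C i) (z 0) (z (Suc m))"
  using assms
proof (induction m)
  case 0
  then show ?case by simp
next
  case (Suc m)
  have "arc_between (\<Union>i\<le>m. C i) (z 0) (z (Suc m))"
    by (rule Suc.IH) (use Suc.prems in auto)
  moreover have "arc_between (C (Suc m)) (z (Suc m)) (z (Suc (Suc m)))"
    using Suc.prems by auto
  moreover have "(\<Union>i\<le>m. C i) \<inter> C (Suc m) \<subseteq> {z (Suc m)}"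
  proof
    fix x assume "x \<in> (\<Union>i\<le>m. C i) \<inter> C (Suc m)"
    then obtain i where i: "i \<le> m" "x \<in> C i" "x \<in> C (Suc m)" by auto
    show "x \<in> {z (Suc m)}"
    proof (cases "i = m")
      case True
      then show ?thesis using Suc.prems(2)[of m] i by auto
    next
      case False
      then show ?thesis using Suc.prems(3)[of i "Suc m"] i by auto
    qed
  qed
  ultimately have "arc_between ((\<Union>i\<le>m. C i) \<union> C (Suc m)) (z 0) (z (Suc (Suc m)))"
    by (rule arc_between_join)
  then show ?case by (simp add: atMost_Suc Un_commute)
qed

text \<open>A parametrisation that stands still at times still traces an arc if a continuous real
  coordinate \<open>h\<close> is monotone along it and determines the point: \<open>h\<close> is
  then a homeomorphism of the compact image onto an interval. Rays are of this kind.\<close>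

lemma arc_between_of_coordinate:
  fixes \<gamma> :: "real \<Rightarrow> 'a::t2_space"
  assumes cont: "continuous_on {0..1} \<gamma>" and h: "continuous_on (\<gamma> ` {0..1}) h"
    and mono: "\<And>s t. 0 \<le> s \<Longrightarrow> s \<le> t \<Longrightarrow> t \<le> 1 \<Longrightarrow> h (\<gamma> s) \<le> (h (\<gamma> t) :: real)"
    and inj: "\<And>s t. 0 \<le> s \<Longrightarrow> s \<le> t \<Longrightarrow> t \<le> 1 \<Longrightarrow> h (\<gamma> s) = h (\<gamma> t) \<Longrightarrow> \<gamma> s = \<gamma> t"
    and ne: "\<gamma> 0 \<noteq> \<gamma> 1"
  shows "arc_between (\<gamma> ` {0..1}) (\<gamma> 0) (\<gamma> 1)"
proof -
  define A where "A = \<gamma> ` {0..1}"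
  have cA: "compact A" unfolding A_def using cont by (intro compact_continuous_image) auto
  have injA: "inj_on h A"
  proof (rule inj_onI)
    fix x y assume "x \<in> A" "y \<in> A" and eq: "h x = h y"
    then obtain s t where "s \<in> {0..1}" "t \<in> {0..1}" "x = \<gamma> s" "y = \<gamma> t" unfolding A_def by blast
    then show "x = y" using inj[of s t] inj[of t s] eq by (cases "s \<le> t") auto
  qed
  have lt: "h (\<gamma> 0) < h (\<gamma> 1)"
    using mono[of 0 1] inj[of 0 1] ne by force
  have "connected (h ` A)"
    unfolding A_def using cont h by (intro connected_continuous_image) (auto intro: connected_Icc)
  moreover have "h (\<gamma> 0) \<in> h ` A" "h (\<gamma> 1) \<in> h ` A" by (auto simp: A_def)
  ultimately have "{h (\<gamma> 0)..h (\<gamma> 1)} \<subseteq> h ` A"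
    by (simp add: connected_contains_Icc)
  moreover have "h ` A \<subseteq> {h (\<gamma> 0)..h (\<gamma> 1)}"
    unfolding A_def using mono by (auto simp: image_iff)
  ultimately have im: "h ` A = {h (\<gamma> 0)..h (\<gamma> 1)}" by blast
  have "\<exists>k. homeomorphism A (h ` A) h k"
    using homeomorphism_compact[of A h "h ` A"] cA h injA unfolding A_def by auto
  then obtain k where k: "homeomorphism A (h ` A) h k" by blast
  define g where "g = k \<circ> (\<lambda>t. h (\<gamma> 0) + t * (h (\<gamma> 1) - h (\<gamma> 0)))"
  have im2: "(\<lambda>t. h (\<gamma> 0) + t * (h (\<gamma> 1) - h (\<gamma> 0))) ` {0..1} = {h (\<gamma> 0)..h (\<gamma> 1)}"
    (is "?f ` _ = _")
  proof
    show "?f ` {0..1} \<subseteq> {h (\<gamma> 0)..h (\<gamma> 1)}"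
    proof
      fix y assume "y \<in> ?f ` {0..1}"
      then obtain t where t: "0 \<le> t" "t \<le> 1" "y = ?f t" by auto
      have "0 \<le> t * (h (\<gamma> 1) - h (\<gamma> 0))" "t * (h (\<gamma> 1) - h (\<gamma> 0)) \<le> 1 * (h (\<gamma> 1) - h (\<gamma> 0))"
        using t lt by (auto intro: mult_right_mono)
      then show "y \<in> {h (\<gamma> 0)..h (\<gamma> 1)}" using t by auto
    qed
    show "{h (\<gamma> 0)..h (\<gamma> 1)} \<subseteq> ?f ` {0..1}"
    proof
      fix y assume y: "y \<in> {h (\<gamma> 0)..h (\<gamma> 1)}"
      then have "y = ?f ((y - h (\<gamma> 0)) / (h (\<gamma> 1) - h (\<gamma> 0)))"
        using lt by auto
      moreover have "(y - h (\<gamma> 0)) / (h (\<gamma> 1) - h (\<gamma> 0)) \<in> {0..1}"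
        using y lt by auto
      ultimately show "y \<in> ?f ` {0..1}" by blast
    qed
  qed
  have kk: "continuous_on {h (\<gamma> 0)..h (\<gamma> 1)} k" "k ` {h (\<gamma> 0)..h (\<gamma> 1)} = A"
    and hk: "\<And>y. y \<in> {h (\<gamma> 0)..h (\<gamma> 1)} \<Longrightarrow> h (k y) = y"
    using k unfolding homeomorphism_def im by simp_all
  have kinj: "inj_on k {h (\<gamma> 0)..h (\<gamma> 1)}"
    using hk by (rule inj_on_inverseI)
  have "continuous_on {0..1} (\<lambda>t. h (\<gamma> 0) + t * (h (\<gamma> 1) - h (\<gamma> 0)))"
    by (intro continuous_intros)
  then have "path g"
    unfolding path_def g_def
    by (rule continuous_on_compose) (use kk im2 in simp)
  moreover have "inj_on g {0..1}"
    unfolding g_def using lt kinj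
    by (intro comp_inj_on) (simp_all add: im2 inj_on_def)
  moreover have "path_image g = A"
    unfolding path_image_def g_def image_comp[symmetric] im2 kk ..
  moreover have "pathstart g = \<gamma> 0" "pathfinish g = \<gamma> 1"
    using k unfolding pathstart_def pathfinish_def g_def homeomorphism_def A_def by simp_all
  ultimately show ?thesis
    unfolding arc_between_def arc_def A_def[symmetric] by (rule_tac x=g in exI) simp
qed

section \<open>Arcs and circles as subspaces\<close>

lemma homeomorphic_space_top_of_set:
  "top_of_set S homeomorphic_space top_of_set T \<longleftrightarrow> S homeomorphic T"
proof -
  have "homeomorphic_maps (top_of_set S) (top_of_set T) f g \<longleftrightarrow> homeomorphism S T f g" for f g
  proof
    assume "homeomorphic_maps (top_of_set S) (top_of_set T) f g"
    then have c: "continuous_on S f" "f \<in> S \<rightarrow> T" "continuous_on T g" "g \<in> T \<rightarrow> S"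
      and i: "\<And>x. x \<in> S \<Longrightarrow> g (f x) = x" "\<And>y. y \<in> T \<Longrightarrow> f (g y) = y"
      unfolding homeomorphic_maps_def by simp_all
    have "f ` S = T" "g ` T = S" using c(2,4) i by force+
    then show "homeomorphism S T f g" unfolding homeomorphism_def using c i by simp
  next
    assume "homeomorphism S T f g"
    then show "homeomorphic_maps (top_of_set S) (top_of_set T) f g"
      unfolding homeomorphic_maps_def homeomorphism_def by (simp add: Pi_iff) blast
  qed
  then show ?thesis unfolding homeomorphic_space_def homeomorphic_def by simp
qed

lemma arc_between_imp_arc_in:
  fixes A :: "'a::t2_space set"
  assumes "arc_between A a b" "A \<subseteq> X"
  shows "arc_in (top_of_set X) A"
proof -
  obtain g where "arc g" "path_image g = A" using assms unfolding arc_between_def by blast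
  then have "A homeomorphic {0..1::real}"
    using homeomorphic_arc_image_interval[of g 0 1] by simp
  then show ?thesis
    unfolding arc_in_def using assms(2)
    by (simp add: subtopology_subtopology inf.absorb2 homeomorphic_space_top_of_set)
qed

lemma arc_in_imp_arc_between:
  fixes A :: "'a::t2_space set"
  assumes "arc_in (top_of_set X) A"
  obtains a b where "arc_between A a b" "A \<subseteq> X"
proof -
  have "A \<subseteq> X" "A homeomorphic {0..1::real}"
    using assms unfolding arc_in_def
    by (simp_all add: subtopology_subtopology homeomorphic_space_top_of_set) (metis inf.absorb2)
  then obtain f g where fg: "homeomorphism A {0..1::real} f g"
    unfolding homeomorphic_def by blast
  then have "\<And>t. t \<in> {0..1} \<Longrightarrow> f (g t) = t" unfolding homeomorphism_def by simp
  then have "inj_on g {0..1}" by (rule inj_on_inverseI)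
  with fg have "arc g" "path_image g = A"
    unfolding arc_def path_def path_image_def homeomorphism_def by simp_all
  then show ?thesis using that \<open>A \<subseteq> X\<close> unfolding arc_between_def by blast
qed

lemma simple_closed_curve_inI:
  fixes A :: "'a::t2_space set"
  assumes "arc_between A a b" "arc_between B b a" "A \<inter> B \<subseteq> {a, b}" "A \<union> B \<subseteq> X"
  shows "simple_closed_curve_in (top_of_set X) (A \<union> B)"
proof -
  obtain g h where g: "arc g" "path_image g = A" "pathstart g = a" "pathfinish g = b"
    and h: "arc h" "path_image h = B" "pathstart h = b" "pathfinish h = a"
    using assms unfolding arc_between_def by blast
  have "simple_path (g +++ h)"
    using g h assms(3) by (intro simple_path_join_loop) auto
  then have "path_image (g +++ h) homeomorphic sphere (0::complex) 1"
    by (intro homeomorphic_simple_path_image_circle) (use g h in auto)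
  moreover have "path_image (g +++ h) = A \<union> B"
    using g h by (simp add: path_image_join)
  ultimately show ?thesis
    unfolding simple_closed_curve_in_def using assms(4)
    by (simp add: subtopology_subtopology inf.absorb2 homeomorphic_space_top_of_set)
qed

section \<open>Hubs and chains\<close>

definition corner :: "nat \<Rightarrow> nat \<Rightarrow> real" where
  "corner i = (\<lambda>k. if k = i then 1 else 0)"

definition shrink :: "nat \<Rightarrow> (nat \<Rightarrow> real) \<Rightarrow> nat \<Rightarrow> real" where
  "shrink i y = (\<lambda>k. (2 * corner i k + y k) / 3)"

definition segpt :: "nat \<Rightarrow> nat \<Rightarrow> real \<Rightarrow> nat \<Rightarrow> real" where
  "segpt i j s = (\<lambda>k. (1 - s) * corner i k + s * corner j k)"

text \<open>Contains the simplex spanned by the corners. Bounding only pairs of coordinates avoids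
  infinite sums and still makes \<open>shrink i\<close> a self-map with separated images: coordinate
  \<open>i\<close> is at least \<open>2/3\<close> on the image of \<open>shrink i\<close> and at
  most \<open>1/3\<close> on the others.\<close>

definition region :: "(nat \<Rightarrow> real) set" where
  "region = {y. (\<forall>k. 0 \<le> y k \<and> y k \<le> 1) \<and> (\<forall>i j. i \<noteq> j \<longrightarrow> y i + y j \<le> 1)}"

text \<open>
  \<open>Hub A\<close> has a subcell for each letter of \<open>A\<close>, again a hub.  \<open>Chain B\<close> is the decorated segment from corner
  \<open>0\<close> to corner \<open>1\<close>: at the corner \<open>0\<close> it continues as \<open>Chain (\<lambda>s. B (Suc s))\<close>, and at the corner \<open>1\<close> sits
  the hub on \<open>B 0\<close>.
\<close>

datatype label = Hub "nat set" | Chain "nat \<Rightarrow> nat set"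

primrec letters :: "label \<Rightarrow> nat set" where
  "letters (Hub A) = A"
| "letters (Chain B) = {0, 1}"

primrec child :: "label \<Rightarrow> nat \<Rightarrow> label" where
  "child (Hub A) i = Hub A"
| "child (Chain B) i = (if i = 0 then Chain (\<lambda>s. B (Suc s)) else Hub (B 0))"

primrec wf_label :: "label \<Rightarrow> bool" where
  "wf_label (Hub A) \<longleftrightarrow> finite A"
| "wf_label (Chain B) \<longleftrightarrow> (\<forall>s. finite (B s) \<and> {0, 1} \<subseteq> B s)"

text \<open>The only coordinates that can be nonzero in the cell. Supports decide how cells meet:
  one common letter allows at most a common corner.\<close>

primrec support :: "label \<Rightarrow> nat set" where
  "support (Hub A) = A"
| "support (Chain B) = {0, 1} \<union> (\<Union>s. B s)"

text \<open>Coinduction admits the points whose descent through the copies never ends; these are the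
  vertices. The premise \<open>y \<in> region\<close> keeps the descent bounded: as
  \<open>shrink i\<close> is onto, any point could otherwise descend for ever.\<close>

coinductive in_cell :: "label \<Rightarrow> (nat \<Rightarrow> real) \<Rightarrow> bool" where
  mid: "\<lbrakk>i \<in> letters l; j \<in> letters l; i \<noteq> j; 1/3 < s; s < 2/3\<rbrakk> \<Longrightarrow> in_cell l (segpt i j s)"
| sub: "\<lbrakk>i \<in> letters l; y \<in> region; in_cell (child l i) y\<rbrakk> \<Longrightarrow> in_cell l (shrink i y)"

coinductive in_vert :: "label \<Rightarrow> (nat \<Rightarrow> real) \<Rightarrow> bool" where
  sub: "\<lbrakk>i \<in> letters l; y \<in> region; in_vert (child l i) y\<rbrakk> \<Longrightarrow> in_vert l (shrink i y)"

definition cell :: "label \<Rightarrow> (nat \<Rightarrow> real) set" where "cell l = {y. in_cell l y}"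
definition vert :: "label \<Rightarrow> (nat \<Rightarrow> real) set" where "vert l = {y. in_vert l y}"
definition mid_open :: "nat \<Rightarrow> nat \<Rightarrow> (nat \<Rightarrow> real) set" where
  "mid_open i j = segpt i j ` {1/3<..<2/3}"
definition mid_closed :: "nat \<Rightarrow> nat \<Rightarrow> (nat \<Rightarrow> real) set" where
  "mid_closed i j = segpt i j ` {1/3..2/3}"

lemma finite_letters [simp]: "wf_label l \<Longrightarrow> finite (letters l)"
  by (cases l) auto

lemma wf_child [simp]: "wf_label l \<Longrightarrow> wf_label (child l i)"
  by (cases l) auto

text \<open>This lets segments and rays towards a corner continue into the copies. For chains it
  rests on the demand that each of their hubs has the letters 0 and 1.\<close>

lemma letters_child: "wf_label l \<Longrightarrow> i \<in> letters l \<Longrightarrow> letters l \<subseteq> letters (child l i)"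
  by (cases l) auto

lemma support_child: "support (child l i) \<subseteq> support l"
  by (cases l) auto

lemma letters_support: "letters l \<subseteq> support l"
  by (cases l) auto

lemma corner_simps [simp]: "corner i i = 1" "k \<noteq> i \<Longrightarrow> corner i k = 0"
  by (simp_all add: corner_def)

lemma corner_inject [simp]: "corner i = corner j \<longleftrightarrow> i = j"
  by (metis corner_simps zero_neq_one)

lemma corner_region [simp]: "corner i \<in> region"
  by (auto simp: region_def corner_def)

lemma shrink_inject [simp]: "shrink i y = shrink i z \<longleftrightarrow> y = z"
  by (auto simp: shrink_def fun_eq_iff)

lemma shrink_region: "y \<in> region \<Longrightarrow> shrink i y \<in> region"
proof -
  assume y: "y \<in> region"
  have le: "y k + y j \<le> 1" "0 \<le> y k" "y k \<le> 1" if "k \<noteq> j" for k j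
    using y that by (auto simp: region_def)
  have 1: "0 \<le> shrink i y k \<and> shrink i y k \<le> 1" for k
    using le[of k "Suc k"] by (auto simp: shrink_def corner_def)
  have 2: "shrink i y k + shrink i y j \<le> 1" if "k \<noteq> j" for k j
    using le[OF that] le[of j k] that by (auto simp: shrink_def corner_def field_simps)
  show ?thesis using 1 2 by (simp add: region_def)
qed

lemma regionD: "y \<in> region \<Longrightarrow> 0 \<le> y k" "y \<in> region \<Longrightarrow> y k \<le> 1" "y \<in> region \<Longrightarrow> i \<noteq> j \<Longrightarrow> y i + y j \<le> 1"
  by (auto simp: region_def)

lemma segpt_region: "0 \<le> s \<Longrightarrow> s \<le> 1 \<Longrightarrow> segpt i j s \<in> region"
  by (auto simp: region_def segpt_def corner_def)

lemma shrink_ge: "y \<in> region \<Longrightarrow> 2/3 \<le> shrink i y i"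
  using regionD(1)[of y i] by (simp add: shrink_def)

lemma shrink_le: "y \<in> region \<Longrightarrow> k \<noteq> i \<Longrightarrow> shrink i y k \<le> 1/3"
  using regionD(2)[of y k] by (simp add: shrink_def)

lemma shrink_eq_shrink:
  assumes "shrink i y = shrink j z" "y \<in> region" "z \<in> region"
  shows "i = j \<and> y = z"
proof -
  have "i = j"
  proof (rule ccontr)
    assume "i \<noteq> j"
    then have "shrink j z i \<le> 1/3" using assms by (intro shrink_le)
    moreover have "shrink i y i \<ge> 2/3" using assms by (intro shrink_ge)
    ultimately show False using assms(1) by simp
  qed
  then show ?thesis using assms by simp
qed

lemma corner_eq_shrink: "corner i = shrink i (corner i)"
  by (auto simp: shrink_def corner_def)

lemma corner_eq_shrinkD:
  assumes "corner c = shrink i y" "y \<in> region"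
  shows "i = c \<and> y = corner c"
  using shrink_eq_shrink[of c "corner c" i y] assms by (metis corner_eq_shrink corner_region)

lemma segpt_ends [simp]: "segpt i j 0 = corner i" "segpt i j 1 = corner j"
  by (auto simp: segpt_def)

lemma segpt_same [simp]: "segpt i i s = corner i"
  by (auto simp: segpt_def algebra_simps)

lemma segpt_third: "segpt i j (1/3) = shrink i (corner j)" "segpt i j (2/3) = shrink j (corner i)"
  by (auto simp: segpt_def shrink_def)

lemma segpt_low: "segpt i j s = shrink i (segpt i j (3 * s))"
  by (auto simp: segpt_def shrink_def field_simps)

lemma segpt_high: "segpt i j s = shrink j (segpt i j (3 * s - 2))"
  by (auto simp: segpt_def shrink_def field_simps)

lemma segpt_swap: "segpt i j s = segpt j i (1 - s)"
  by (auto simp: segpt_def)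

lemma segpt_eval: "i \<noteq> j \<Longrightarrow> segpt i j s i = 1 - s" "i \<noteq> j \<Longrightarrow> segpt i j s j = s"
  "k \<noteq> i \<Longrightarrow> k \<noteq> j \<Longrightarrow> segpt i j s k = 0"
  by (auto simp: segpt_def)

lemma continuous_shrink: "continuous_on S (shrink i)"
  unfolding shrink_def
  by (intro continuous_on_coordinatewise_then_product continuous_intros continuous_on_product_then_coordinatewise[OF continuous_on_id]) auto

lemma continuous_segpt: "continuous_on S (segpt i j)"
  unfolding segpt_def by (intro continuous_on_coordinatewise_then_product continuous_intros)

lemma closed_region: "closed region"
proof -
  have "closed {y :: nat \<Rightarrow> real. (\<forall>k. 0 \<le> y k \<and> y k \<le> 1) \<and> (\<forall>i j. i \<noteq> j \<longrightarrow> y i + y j \<le> 1)}"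
    by (intro closed_Collect_conj closed_Collect_all closed_Collect_imp open_Collect_const closed_Collect_le
        continuous_intros continuous_on_product_coordinates)
  then show ?thesis by (simp add: region_def)
qed

lemma compact_region: "compact region"
proof -
  have "compactin (product_topology (\<lambda>i::nat. euclidean :: real topology) UNIV) (Pi\<^sub>E UNIV (\<lambda>_. {0..1}))"
    unfolding compactin_PiE by simp
  then have "compact (Pi\<^sub>E UNIV (\<lambda>_::nat. {0..1::real}))"
    by (simp add: euclidean_product_topology)
  moreover have "region = region \<inter> Pi\<^sub>E UNIV (\<lambda>_::nat. {0..1::real})"
    by (auto simp: region_def)
  ultimately show ?thesis by (metis closed_region closed_Int_compact)
qed

lemma mid_subset: "mid_open i j \<subseteq> mid_closed i j"
  by (auto simp: mid_open_def mid_closed_def)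

lemma mid_closed_closed: "closed (mid_closed i j)"
  unfolding mid_closed_def by (intro compact_imp_closed compact_continuous_image continuous_segpt) auto

lemma mid_closed_region: "mid_closed i j \<subseteq> region"
  by (auto simp: mid_closed_def intro: segpt_region)

lemma cell_region: "cell l \<subseteq> region"
proof
  fix y assume "y \<in> cell l"
  then have "in_cell l y" by (simp add: cell_def)
  then show "y \<in> region"
    by cases (auto intro: shrink_region segpt_region)
qed

lemma vert_region: "vert l \<subseteq> region"
proof
  fix y assume "y \<in> vert l"
  then have "in_vert l y" by (simp add: vert_def)
  then show "y \<in> region"
    by cases (auto intro: shrink_region)
qed

lemma cell_unfold:
  "cell l = (\<Union>i\<in>letters l. shrink i ` cell (child l i)) \<union>
     (\<Union>i\<in>letters l. \<Union>j\<in>letters l - {i}. mid_open i j)" (is "_ = ?R")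
proof
  show "cell l \<subseteq> ?R"
  proof
    fix y assume "y \<in> cell l"
    then have "in_cell l y" by (simp add: cell_def)
    then show "y \<in> ?R"
      by cases (fastforce simp: cell_def mid_open_def)+
  qed
  show "?R \<subseteq> cell l"
  proof
    fix y assume "y \<in> ?R"
    then consider i z where "i \<in> letters l" "z \<in> cell (child l i)" "y = shrink i z"
      | i j s where "i \<in> letters l" "j \<in> letters l - {i}" "s \<in> {1/3<..<2/3}" "y = segpt i j s"
      unfolding mid_open_def by blast
    then show "y \<in> cell l"
    proof cases
      case 1
      then show ?thesis using cell_region[of "child l i"] in_cell.sub[of i l z] by (auto simp: cell_def)
    next
      case 2
      then show ?thesis using in_cell.mid[of i l j s] by (simp add: cell_def)
    qed
  qed
qed

lemma vert_unfold: "vert l = (\<Union>i\<in>letters l. shrink i ` vert (child l i))"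
proof
  show "vert l \<subseteq> (\<Union>i\<in>letters l. shrink i ` vert (child l i))"
  proof
    fix y assume "y \<in> vert l"
    then have "in_vert l y" by (simp add: vert_def)
    then show "y \<in> (\<Union>i\<in>letters l. shrink i ` vert (child l i))"
      by cases (auto simp: vert_def)
  qed
  show "(\<Union>i\<in>letters l. shrink i ` vert (child l i)) \<subseteq> vert l"
  proof
    fix y assume "y \<in> (\<Union>i\<in>letters l. shrink i ` vert (child l i))"
    then obtain i z where "i \<in> letters l" "z \<in> vert (child l i)" "y = shrink i z" by blast
    then show "y \<in> vert l" using vert_region[of "child l i"] in_vert.sub[of i l z] by (auto simp: vert_def)
  qed
qed

lemma shrink_cellI: "y \<in> cell (child l i) \<Longrightarrow> i \<in> letters l \<Longrightarrow> shrink i y \<in> cell l"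
  by (subst cell_unfold) auto

lemma shrink_vertI: "y \<in> vert (child l i) \<Longrightarrow> i \<in> letters l \<Longrightarrow> shrink i y \<in> vert l"
  by (subst vert_unfold) auto

lemma vert_subset_cell: "vert l \<subseteq> cell l"
proof
  fix y assume "y \<in> vert l"
  then have "in_vert l y" by (simp add: vert_def)
  then have "in_cell l y"
  proof (coinduction arbitrary: l y)
    case in_cell
    then show ?case by cases blast
  qed
  then show "y \<in> cell l" by (simp add: cell_def)
qed

text \<open>The outer thirds of a segment are the same segment shrunk towards its ends, so it is its
  own witness for the coinduction; the middle third is an edge. For \<open>i = j\<close> it
  degenerates to the fixed point of \<open>shrink i\<close>.\<close>

lemma segpt_cell:
  assumes "wf_label l" "i \<in> letters l" "j \<in> letters l" "0 \<le> s" "s \<le> 1"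
  shows "segpt i j s \<in> cell l"
proof -
  have "in_cell l (segpt i j s)"
    using assms
  proof (coinduction arbitrary: l s)
    case in_cell
    let ?X = "\<lambda>m y. (\<exists>l s. m = l \<and> y = segpt i j s \<and> wf_label l \<and> i \<in> letters l \<and> j \<in> letters l \<and> 0 \<le> s \<and> s \<le> 1) \<or> in_cell m y"
    have X: "?X (child l k) (segpt i j t)" if "k \<in> letters l" "0 \<le> t" "t \<le> 1" for k t
      using in_cell that letters_child[of l k] by (intro disjI1 exI[of _ "child l k"] exI[of _ t] conjI refl wf_child) blast+
    have Y: "?case" if "k \<in> letters l" "0 \<le> t" "t \<le> 1" "segpt i j s = shrink k (segpt i j t)" for k t
      by (rule disjI2, rule exI[of _ k], rule exI[of _ l], rule exI[of _ "segpt i j t"],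
          intro conjI refl that segpt_region X)
    consider "s \<le> 1/3" | "2/3 \<le> s" | "1/3 < s" "s < 2/3" "i \<noteq> j" | "i = j" by linarith
    then show ?case
    proof cases
      case 1
      then show ?thesis using in_cell by (intro Y[of i "3 * s"] segpt_low) auto
    next
      case 2
      then show ?thesis using in_cell by (intro Y[of j "3 * s - 2"] segpt_high) auto
    next
      case 3
      then show ?thesis using in_cell by blast
    next
      case 4
      then have "segpt i j s = shrink i (segpt i j s)" using corner_eq_shrink by simp
      then show ?thesis using in_cell by (intro Y[of i s])
    qed
  qed
  then show ?thesis by (simp add: cell_def)
qed

lemma corner_vert:
  assumes "wf_label l" "i \<in> letters l"
  shows "corner i \<in> vert l"
proof -
  have "in_vert l (corner i)"
    using assms
  proof (coinduction arbitrary: l)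
    case in_vert
    have "wf_label (child l i) \<and> i \<in> letters (child l i)"
      using in_vert letters_child[of l i] by auto
    then show ?case using in_vert
      by (intro exI[of _ i] exI[of _ l] exI[of _ "corner i"] conjI corner_eq_shrink corner_region) auto
  qed
  then show ?thesis by (simp add: vert_def)
qed

text \<open>The shrunken closures of the copies and the closed edges form a closed set around the
  cell, so points of the closure satisfy the coinductive rules. The ends of closed edges belong to
  the cell by \<open>segpt_cell\<close>.\<close>

lemma closed_cell:
  assumes "wf_label l" shows "closed (cell l)"
proof -
  have "in_cell l y" if "y \<in> closure (cell l)" for y
    using assms that
  proof (coinduction arbitrary: l y)
    case in_cell
    have comp: "compact (closure (cell m))" for m
      using compact_Int_closed[OF compact_region closed_closure[of "cell m"]]
        closure_minimal[OF cell_region closed_region] by (metis inf.absorb2)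
    let ?K = "(\<Union>i\<in>letters l. shrink i ` closure (cell (child l i))) \<union>
       (\<Union>i\<in>letters l. \<Union>j\<in>letters l - {i}. mid_closed i j)"
    have "closed ?K"
    proof -
      have "closed (shrink i ` closure (cell (child l i)))" for i
        by (rule compact_imp_closed[OF compact_continuous_image[OF continuous_shrink comp]])
      moreover have "closed (\<Union>j\<in>letters l - {i}. mid_closed i j)" for i
        using in_cell by (intro closed_UN) (simp_all add: mid_closed_closed)
      ultimately show ?thesis using in_cell by (intro closed_Un closed_UN) simp_all
    qed
    moreover have "cell l \<subseteq> ?K"
    proof -
      have "shrink i ` cell (child l i) \<subseteq> shrink i ` closure (cell (child l i))" for i
        by (intro image_mono closure_subset)
      then show ?thesis
        unfolding cell_unfold[of l] by (intro Un_mono UN_mono subset_refl mid_subset)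
    qed
    ultimately have "closure (cell l) \<subseteq> ?K" by (intro closure_minimal)
    moreover have "y \<in> closure (cell l)" using in_cell by simp
    ultimately have "y \<in> ?K" by (rule subsetD)
    then show ?case
    proof
      assume "y \<in> (\<Union>i\<in>letters l. shrink i ` closure (cell (child l i)))"
      then obtain i z where iz: "i \<in> letters l" "z \<in> closure (cell (child l i))" "y = shrink i z" by blast
      moreover have "z \<in> region"
        using closure_minimal[OF cell_region closed_region] iz(2) by (rule subsetD)
      moreover have "wf_label (child l i)" using in_cell by simp
      ultimately show ?thesis by blast
    next
      assume "y \<in> (\<Union>i\<in>letters l. \<Union>j\<in>letters l - {i}. mid_closed i j)"
      then obtain i j s where ij: "i \<in> letters l" "j \<in> letters l - {i}" "y = segpt i j s" "s \<in> {1/3..2/3}"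
        unfolding mid_closed_def by blast
      have "in_cell l y" using segpt_cell[of l i j s] ij in_cell by (simp add: cell_def)
      then show ?thesis by cases blast+
    qed
  qed
  then have "closure (cell l) \<subseteq> cell l" by (auto simp: cell_def)
  then show ?thesis by (simp add: closure_subset_eq)
qed

lemma compact_cell: "wf_label l \<Longrightarrow> compact (cell l)"
  using compact_Int_closed[OF compact_region closed_cell] cell_region by (metis inf.absorb2)

text \<open>Each step of the descent divides such a coordinate by 3, so it is at most
  \<open>(1/3)^m\<close> for all \<open>m\<close>.\<close>

lemma cell_support: "y \<in> cell l \<Longrightarrow> k \<notin> support l \<Longrightarrow> y k = 0"
proof -
  have "\<bar>y k\<bar> \<le> (1/3)^m" if "y \<in> cell l" "k \<notin> support l" for m l y
    using that
  proof (induction m arbitrary: l y)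
    case 0
    then show ?case using cell_region regionD[of y k] by (auto simp: subset_iff)
  next
    case (Suc m)
    have "in_cell l y" using Suc.prems by (simp add: cell_def)
    then show ?case
    proof cases
      case (mid i j s)
      then have "k \<noteq> i" "k \<noteq> j" using letters_support Suc.prems by auto
      then show ?thesis using mid by (simp add: segpt_def)
    next
      case (sub i z)
      then have "k \<noteq> i" "k \<notin> support (child l i)" using letters_support support_child Suc.prems by blast+
      then show ?thesis using Suc.IH[of z "child l i"] sub by (simp add: shrink_def cell_def)
    qed
  qed
  then have "y \<in> cell l \<Longrightarrow> k \<notin> support l \<Longrightarrow> \<bar>y k\<bar> \<le> 0"
    by (intro LIMSEQ_le_const[OF LIMSEQ_power_zero[of "1/3::real"]]) auto
  then show "y \<in> cell l \<Longrightarrow> k \<notin> support l \<Longrightarrow> y k = 0" by auto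
qed

text \<open>The coordinates of a point of a cell add up to 1, but \<open>region\<close> does not
  record this. Instead, the defect \<open>1 - y c\<close> shrinks by a factor 3 with every
  level.\<close>

lemma cell_single_coordinate:
  assumes "y \<in> cell l" "\<And>k. k \<noteq> c \<Longrightarrow> y k = 0"
  shows "y = corner c"
proof -
  have "1 - y c \<le> (1/3)^m" if "y \<in> cell l" "\<And>k. k \<noteq> c \<Longrightarrow> y k = 0" for m l y
    using that
  proof (induction m arbitrary: l y)
    case 0
    then show ?case using cell_region regionD[of y c] by (auto simp: subset_iff)
  next
    case (Suc m)
    have "in_cell l y" using Suc.prems by (simp add: cell_def)
    then show ?case
    proof cases
      case (mid i j s)
      then have "y i \<noteq> 0" "y j \<noteq> 0" by (auto simp: segpt_eval)
      then show ?thesis using Suc.prems(2) mid by metis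
    next
      case (sub i z)
      then have "y i \<noteq> 0" using shrink_ge[of z i] by auto
      then have "i = c" using Suc.prems(2) by metis
      have "z k = 0" if "k \<noteq> c" for k
        using Suc.prems(2)[OF that] that \<open>i = c\<close> sub by (simp add: shrink_def)
      then have "1 - z c \<le> (1/3)^m" using Suc.IH[of z "child l i"] sub by (simp add: cell_def)
      then show ?thesis using sub \<open>i = c\<close> by (simp add: shrink_def field_simps)
    qed
  qed
  then have "1 - y c \<le> 0" using assms
    by (intro LIMSEQ_le_const[OF LIMSEQ_power_zero[of "1/3::real"]]) auto
  then have "y c = 1" using regionD(2)[of y c] assms cell_region by fastforce
  then show ?thesis using assms by (auto simp: corner_def)
qed

lemma cell_inter:
  assumes "support l \<inter> support l' \<subseteq> {c}"
  shows "cell l \<inter> cell l' \<subseteq> {corner c}"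
proof
  fix y assume y: "y \<in> cell l \<inter> cell l'"
  have "y k = 0" if "k \<noteq> c" for k using cell_support y assms that by blast
  then show "y \<in> {corner c}" using cell_single_coordinate y by blast
qed

lemma cell_inter_empty:
  assumes "support l \<inter> support l' = {}"
  shows "cell l \<inter> cell l' = {}"
proof -
  \<comment> \<open>The empty set is contained in both \<open>{0}\<close> and \<open>{1}\<close>,
    and the two corners differ.\<close>
  have "cell l \<inter> cell l' \<subseteq> {corner 0} \<inter> {corner 1}"
    using cell_inter[of l l' 0] cell_inter[of l l' 1] assms by auto
  then show ?thesis by auto
qed

section \<open>Rays from a vertex to the corners\<close>

text \<open>The length of the part of the interval from \<open>(1/3)^(k+1)\<close> to
  \<open>(1/3)^k\<close> that lies above \<open>s\<close>. At \<open>s = 0\<close> it is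
  \<open>2 * (1/3)^(k+1)\<close>, the weight of the \<open>k\<close>-th letter in a vertex; with
  growing \<open>s\<close> the weights of the deep letters pass to the corner at the end of the
  ray.\<close>

definition wt :: "nat \<Rightarrow> real \<Rightarrow> real" where
  "wt k s = max s ((1/3)^k) - max s ((1/3)^Suc k)"

text \<open>
  For \<open>s = (1/3)^m\<close> this is the corner \<open>i\<close> of the cell with address \<open>c 0, \<dots>, c (m - 1)\<close>; in between, the ray runs
  straight.  Along the ray the \<open>i\<close>-th coordinate is monotone and determines the point, although the
  parametrisation is not injective when letters \<open>i\<close> occur in \<open>c\<close>.
\<close>

definition ray :: "nat \<Rightarrow> (nat \<Rightarrow> nat) \<Rightarrow> real \<Rightarrow> nat \<Rightarrow> real" where
  "ray i c s = (\<lambda>j. (\<Sum>k. if c k = j then wt k s else 0) + s * corner i j)"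

lemma wt_nonneg: "0 \<le> wt k s"
proof -
  have "(1/3::real)^Suc k \<le> (1/3)^k" by (intro power_decreasing) auto
  then show ?thesis unfolding wt_def by linarith
qed

lemma wt_le: "wt k s \<le> (1/3)^k"
proof -
  have "(1/3::real)^Suc k \<le> (1/3)^k" "0 \<le> (1/3::real)^Suc k" by (intro power_decreasing) auto
  then show ?thesis unfolding wt_def by linarith
qed

lemma wt_antimono: "s \<le> t \<Longrightarrow> wt k t \<le> wt k s"
proof -
  assume "s \<le> t"
  moreover have "(1/3::real)^Suc k \<le> (1/3)^k" by (intro power_decreasing) auto
  ultimately show ?thesis unfolding wt_def by linarith
qed

lemma wt_Suc: "wt (Suc k) s = wt k (3 * s) / 3"
  by (simp add: wt_def max_def)

lemma summable_wt: "summable (\<lambda>k. if P k then wt k s else 0)"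
  by (rule summable_comparison_test[of _ "\<lambda>k. (1/3)^k"])
    (use wt_nonneg wt_le in \<open>auto simp: abs_of_nonneg\<close>)

lemma wt_sums:
  assumes "0 \<le> s" "s \<le> 1"
  shows "(\<lambda>k. wt k s) sums (1 - s)"
proof -
  have "(\<lambda>k. max s ((1/3)^k)) \<longlonglongrightarrow> max s 0"
    by (intro tendsto_intros LIMSEQ_power_zero) auto
  from telescope_sums'[OF this] show ?thesis using assms by (simp add: wt_def)
qed

lemma ray_low:
  assumes "s \<le> 1/3"
  shows "ray i c s = shrink (c 0) (ray i (\<lambda>k. c (Suc k)) (3 * s))"
proof
  fix j
  have "(\<Sum>k. if c k = j then wt k s else 0) =
      (\<Sum>k. if c (Suc k) = j then wt (Suc k) s else 0) + (if c 0 = j then wt 0 s else 0)"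
    using suminf_split_head[OF summable_wt, of "\<lambda>k. c k = j" s] by simp
  also have "(\<Sum>k. if c (Suc k) = j then wt (Suc k) s else 0) =
      (\<Sum>k. (if c (Suc k) = j then wt k (3 * s) else 0) / 3)"
    by (intro suminf_cong) (simp add: wt_Suc)
  also have "\<dots> = (\<Sum>k. if c (Suc k) = j then wt k (3 * s) else 0) / 3"
    by (rule suminf_divide[OF summable_wt])
  finally show "ray i c s j = shrink (c 0) (ray i (\<lambda>k. c (Suc k)) (3 * s)) j"
    using assms by (auto simp: ray_def shrink_def corner_def wt_def)
qed

lemma ray_high:
  assumes "1/3 \<le> s" "s \<le> 1"
  shows "ray i c s = segpt (c 0) i s"
proof
  fix j
  have 0: "wt (Suc k) s = 0" for k
  proof -
    have "(1/3::real)^Suc k \<le> (1/3)^1" "(1/3::real)^Suc (Suc k) \<le> (1/3)^1" by (intro power_decreasing; simp)+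
    then show ?thesis using assms by (simp add: wt_def)
  qed
  have "(\<Sum>k. if c k = j then wt k s else 0) =
      (\<Sum>k. if c (Suc k) = j then wt (Suc k) s else 0) + (if c 0 = j then wt 0 s else 0)"
    using suminf_split_head[OF summable_wt, of "\<lambda>k. c k = j" s] by simp
  also have "\<dots> = (if c 0 = j then wt 0 s else 0)"
    unfolding 0 by simp
  finally show "ray i c s j = segpt (c 0) i s j"
    using assms by (auto simp: ray_def segpt_def corner_def wt_def)
qed

lemma ray_1: "ray i c 1 = corner i"
  using ray_high[of 1 i c] by simp

lemma ray_0: "ray i c 0 = ray j c 0"
  by (simp add: ray_def)

lemma continuous_ray: "continuous_on S (ray i c)"
  unfolding ray_def
proof (intro continuous_on_coordinatewise_then_product continuous_on_add)
  fix j
  have "uniform_limit S (\<lambda>n s. \<Sum>k<n. if c k = j then wt k s else 0)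
      (\<lambda>s. \<Sum>k. if c k = j then wt k s else 0) sequentially"
    by (rule Weierstrass_m_test[of _ _ "\<lambda>k. (1/3)^k"])
      (use wt_nonneg wt_le in \<open>auto simp: abs_of_nonneg\<close>)
  moreover have "continuous_on S (\<lambda>s. \<Sum>k<n. if c k = j then wt k s else 0)" for n
  proof (intro continuous_on_sum)
    fix k show "continuous_on S (\<lambda>s. if c k = j then wt k s else 0)"
      unfolding wt_def by (cases "c k = j") (auto intro!: continuous_intros)
  qed
  ultimately show "continuous_on S (\<lambda>s. \<Sum>k. if c k = j then wt k s else 0)"
    by (intro uniform_limit_theorem[where F = sequentially]) auto
  show "continuous_on S (\<lambda>s. s * corner i j)" by (intro continuous_intros)
qed

lemma ray_other: "j \<noteq> i \<Longrightarrow> s \<le> t \<Longrightarrow> ray i c t j \<le> ray i c s j"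
  unfolding ray_def by (simp, intro suminf_le summable_wt) (auto intro: wt_antimono)

lemma ray_self:
  assumes "0 \<le> s" "s \<le> 1"
  shows "ray i c s i = 1 - (\<Sum>k. if c k \<noteq> i then wt k s else 0)"
proof -
  have "(\<Sum>k. if c k = i then wt k s else 0) + (\<Sum>k. if c k \<noteq> i then wt k s else 0) =
      (\<Sum>k. (if c k = i then wt k s else 0) + (if c k \<noteq> i then wt k s else 0))"
    by (intro suminf_add summable_wt)
  also have "\<dots> = (\<Sum>k. wt k s)" by (intro suminf_cong) simp
  also have "\<dots> = 1 - s" using wt_sums[OF assms] by (simp add: sums_iff)
  finally show ?thesis by (simp add: ray_def)
qed

lemma ray_self_mono:
  assumes "0 \<le> s" "s \<le> t" "t \<le> 1"
  shows "ray i c s i \<le> ray i c t i"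
proof -
  have "(\<Sum>k. if c k \<noteq> i then wt k t else 0) \<le> (\<Sum>k. if c k \<noteq> i then wt k s else 0)"
    by (intro suminf_le summable_wt) (auto intro: wt_antimono assms)
  then show ?thesis using assms by (simp add: ray_self)
qed

text \<open>Coordinate \<open>i\<close> is 1 minus the sum of the weights with
  \<open>c k \<noteq> i\<close>. Each of these is antitone in the parameter, so equal sums force
  equal terms, and these terms make up the other coordinates.\<close>

lemma ray_self_inject:
  assumes "0 \<le> s" "s \<le> t" "t \<le> 1" "ray i c s i = ray i c t i"
  shows "ray i c s = ray i c t"
proof
  fix j
  define f where "f = (\<lambda>s k. if c k \<noteq> i then wt k s else 0)"
  have sm: "summable (f s)" "summable (f t)" unfolding f_def by (rule summable_wt)+
  have "suminf (f s) = suminf (f t)"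
    using assms ray_self[of s i c] ray_self[of t i c] unfolding f_def by simp
  then have "(\<Sum>k. f s k - f t k) = 0" using suminf_diff[OF sm] by simp
  moreover have "0 \<le> f s k - f t k" for k using wt_antimono[of s t k] assms by (simp add: f_def)
  ultimately have "f s k - f t k = 0" for k
    using suminf_eq_zero_iff[OF summable_diff[OF sm]] by blast
  then have eq: "c k \<noteq> i \<Longrightarrow> wt k s = wt k t" for k
    by (metis eq_iff_diff_eq_0 f_def)
  show "ray i c s j = ray i c t j"
  proof (cases "j = i")
    case False
    then show ?thesis unfolding ray_def using eq by (simp, intro suminf_cong) auto
  qed (use assms in simp)
qed

text \<open>Starting from the vertex, coordinate \<open>i\<close> does not decrease along the ray to
  \<open>i\<close> and does not increase along the ray to \<open>j\<close>. A common point thus has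
  the same coordinate \<open>i\<close> as the vertex, which identifies it on the first ray.\<close>

lemma ray_inter:
  assumes "i \<noteq> j" "0 \<le> s" "s \<le> 1" "0 \<le> t" "t \<le> 1" "ray i c s = ray j c t"
  shows "ray i c s = ray i c 0"
proof -
  have "ray i c s i \<le> ray i c 0 i"
    using ray_other[of i j 0 t c] assms ray_0[of i c j] by metis
  then have "ray i c 0 i = ray i c s i" using ray_self_mono[of 0 s i c] assms by simp
  then show ?thesis using ray_self_inject[of 0 s i c] assms by simp
qed

primrec lab :: "label \<Rightarrow> (nat \<Rightarrow> nat) \<Rightarrow> nat \<Rightarrow> label" where
  "lab l c 0 = l"
| "lab l c (Suc k) = child (lab l c k) (c k)"

definition address :: "label \<Rightarrow> (nat \<Rightarrow> nat) \<Rightarrow> bool" where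
  "address l c \<longleftrightarrow> (\<forall>k. c k \<in> letters (lab l c k))"

lemma lab_shift: "lab l c (Suc k) = lab (child l (c 0)) (\<lambda>k. c (Suc k)) k"
  by (induction k) auto

lemma address_unfold: "address l c \<longleftrightarrow> c 0 \<in> letters l \<and> address (child l (c 0)) (\<lambda>k. c (Suc k))"
proof
  assume a: "address l c"
  then have "c 0 \<in> letters l" unfolding address_def by (metis lab.simps(1))
  moreover have "address (child l (c 0)) (\<lambda>k. c (Suc k))"
    using a unfolding address_def by (metis lab_shift)
  ultimately show "c 0 \<in> letters l \<and> address (child l (c 0)) (\<lambda>k. c (Suc k))" ..
next
  assume a: "c 0 \<in> letters l \<and> address (child l (c 0)) (\<lambda>k. c (Suc k))"
  show "address l c"
    unfolding address_def
  proof
    fix k show "c k \<in> letters (lab l c k)"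
      using a by (cases k) (auto simp: address_def lab_shift simp del: lab.simps(2))
  qed
qed

text \<open>The start is treated first because two coordinates other than \<open>i\<close> inherit
  their bound from it along the whole ray.\<close>

lemma ray_0_region: "ray i c 0 \<in> region"
proof -
  have le: "ray i c 0 j + ray i c 0 k \<le> 1" if "j \<noteq> k" for j k
  proof -
    have "ray i c 0 j + ray i c 0 k = (\<Sum>m. (if c m = j then wt m 0 else 0) + (if c m = k then wt m 0 else 0))"
      unfolding ray_def by (simp add: suminf_add[OF summable_wt summable_wt])
    also have "\<dots> \<le> (\<Sum>m. wt m 0)"
      using that wt_nonneg
      by (intro suminf_le summable_add summable_wt sums_summable[OF wt_sums[of 0]]) auto
    also have "\<dots> = 1" using wt_sums[of 0] by (simp add: sums_iff)
    finally show ?thesis .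
  qed
  have nn: "0 \<le> ray i c 0 j" for j
    unfolding ray_def using wt_nonneg by (simp add: suminf_nonneg[OF summable_wt])
  have "ray i c 0 j \<le> 1" for j using le[of j "Suc j"] nn[of "Suc j"] by simp
  then show ?thesis using le nn by (simp add: region_def)
qed

lemma ray_region:
  assumes "0 \<le> s" "s \<le> 1" shows "ray i c s \<in> region"
proof -
  have nn: "0 \<le> ray i c s j" for j
    unfolding ray_def using wt_nonneg assms by (simp add: suminf_nonneg[OF summable_wt] corner_def)
  have 1: "ray i c s i + ray i c s j \<le> 1" if "j \<noteq> i" for j
  proof -
    have "ray i c s j \<le> (\<Sum>k. if c k \<noteq> i then wt k s else 0)"
      unfolding ray_def using that wt_nonneg by (simp, intro suminf_le summable_wt) auto
    then show ?thesis using ray_self[OF assms] by simp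
  qed
  have le: "ray i c s j + ray i c s k \<le> 1" if "j \<noteq> k" for j k
  proof (cases "j = i \<or> k = i")
    case True
    then show ?thesis using 1 that by (metis add.commute)
  next
    case False
    then show ?thesis
      using ray_other[of j i 0 s c] ray_other[of k i 0 s c] regionD(3)[OF ray_0_region that, of i c] assms by simp
  qed
  have "ray i c s j \<le> 1" for j using le[of j "Suc j"] nn[of "Suc j"] by simp
  then show ?thesis using le nn by (simp add: region_def)
qed

lemma ray_cell:
  assumes "wf_label l" "address l c" "i \<in> letters l" "0 \<le> s" "s \<le> 1"
  shows "ray i c s \<in> cell l"
proof -
  have "in_cell l (ray i c s)"
    using assms
  proof (coinduction arbitrary: l c s)
    case in_cell
    show ?case
    proof (cases "1/3 \<le> s")
      case True
      have "c 0 \<in> letters l" using in_cell address_unfold by blast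
      then have "ray i c s \<in> cell l" using segpt_cell in_cell True by (simp add: ray_high)
      then have "in_cell l (ray i c s)" by (simp add: cell_def)
      then show ?thesis by cases blast+
    next
      case False
      have ad: "c 0 \<in> letters l" "address (child l (c 0)) (\<lambda>k. c (Suc k))"
        using in_cell address_unfold by blast+
      moreover have "i \<in> letters (child l (c 0))" using letters_child in_cell ad by blast
      moreover have "wf_label (child l (c 0))" using in_cell by simp
      moreover have "ray i (\<lambda>k. c (Suc k)) (3 * s) \<in> region" using in_cell False by (intro ray_region) auto
      moreover have "ray i c s = shrink (c 0) (ray i (\<lambda>k. c (Suc k)) (3 * s))" using False by (intro ray_low) auto
      moreover have "0 \<le> 3 * s" "3 * s \<le> 1" using False in_cell by auto
      ultimately show ?thesis by blast
    qed
  qed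
  then show ?thesis by (simp add: cell_def)
qed

lemma ray_vert:
  assumes "address l c"
  shows "ray i c 0 \<in> vert l"
proof -
  have "in_vert l (ray i c 0)"
    using assms
  proof (coinduction arbitrary: l c)
    case in_vert
    have "ray i c 0 = shrink (c 0) (ray i (\<lambda>k. c (Suc k)) 0)" using ray_low[of 0 i c] by simp
    then show ?case using in_vert address_unfold ray_0_region by blast
  qed
  then show ?thesis by (simp add: vert_def)
qed

text \<open>The letters are chosen level by level. The given vertex and the start of the ray share
  them all, so their coordinates differ by at most \<open>(1/3)^m\<close> for every
  \<open>m\<close>. The target \<open>i\<close> is arbitrary since all rays of one address have the
  same start.\<close>

lemma vert_address:
  assumes "y \<in> vert l"
  obtains c where "address l c" "\<And>i. y = ray i c 0"
proof -
  define Q where "Q = (\<lambda>(l, y) (i, l', y'). i \<in> letters l \<and> y = shrink i y' \<and> y' \<in> vert l' \<and> l' = child l i)"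
  have "\<exists>z. Q (l, y) z" if "y \<in> vert l" for l y
  proof -
    have "in_vert l y" using that by (simp add: vert_def)
    then show ?thesis by cases (auto simp: Q_def vert_def)
  qed
  then have nx: "Q (l, y) (SOME z. Q (l, y) z)" if "y \<in> vert l" for l y
    using that by (metis someI_ex)
  define nx where "nx = (\<lambda>w. SOME z. Q w z)"
  have nx: "Q (l, y) (nx (l, y))" if "y \<in> vert l" for l y
    unfolding nx_def using nx[OF that] .
  \<comment> \<open>The state is the current label with the point pulled back to that level.\<close>
  define st where "st = rec_nat (l, y) (\<lambda>_ p. snd (nx p))"
  define c where "c = (\<lambda>k. fst (nx (st k)))"
  have st0: "st 0 = (l, y)" and stS: "st (Suc k) = snd (nx (st k))" for k by (simp_all add: st_def)
  have inv: "snd (st k) \<in> vert (fst (st k))" for k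
  proof (induction k)
    case 0 then show ?case using assms st0 by simp
  next
    case (Suc k)
    obtain a b where ab: "st k = (a, b)" by (cases "st k")
    then have "Q (a, b) (nx (a, b))" using nx Suc by simp
    then show ?case using ab unfolding stS by (auto simp: Q_def split: prod.splits)
  qed
  have step: "c k \<in> letters (fst (st k))" "snd (st k) = shrink (c k) (snd (st (Suc k)))"
    "fst (st (Suc k)) = child (fst (st k)) (c k)" for k
  proof -
    obtain a b where ab: "st k = (a, b)" by (cases "st k")
    then have "Q (a, b) (nx (a, b))" using nx inv[of k] by simp
    then show "c k \<in> letters (fst (st k))" "snd (st k) = shrink (c k) (snd (st (Suc k)))"
      "fst (st (Suc k)) = child (fst (st k)) (c k)"
      using ab unfolding stS c_def by (auto simp: Q_def split: prod.splits)
  qed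
  have labst: "lab l c k = fst (st k)" for k
    by (induction k) (simp_all add: st0 step)
  have "address l c" unfolding address_def labst using step by blast
  moreover have "y = ray i c 0" for i
  proof
    fix j
    have "\<bar>snd (st k) j - ray i (\<lambda>q. c (q + k)) 0 j\<bar> \<le> (1/3)^m" for m k
    proof (induction m arbitrary: k)
      case 0
      have "snd (st k) \<in> region" using inv vert_region by blast
      then show ?case using regionD(1,2)[of "snd (st k)" j] regionD(1,2)[OF ray_0_region, of i "\<lambda>q. c (q + k)" j]
        by (simp add: abs_if)
    next
      case (Suc m)
      have "ray i (\<lambda>q. c (q + k)) 0 = shrink (c k) (ray i (\<lambda>q. c (q + Suc k)) 0)"
        using ray_low[of 0 i "\<lambda>q. c (q + k)"] by simp
      moreover note step(2)[of k]
      ultimately have eq: "snd (st k) j - ray i (\<lambda>q. c (q + k)) 0 j =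
          (snd (st (Suc k)) j - ray i (\<lambda>q. c (q + Suc k)) 0 j) / 3"
        by (simp add: shrink_def field_simps)
      show ?case unfolding eq using Suc[of "Suc k"] by simp
    qed
    from this[of 0] have "\<bar>y j - ray i c 0 j\<bar> \<le> 0"
      by (intro LIMSEQ_le_const[OF LIMSEQ_power_zero[of "1/3::real"]]) (auto simp: st0)
    then show "y j = ray i c 0 j" by simp
  qed
  ultimately show ?thesis using that by blast
qed

lemma region_corner: "y \<in> region \<Longrightarrow> y k = 1 \<Longrightarrow> y = corner k"
  by (rule ext) (metis add.commute add_le_cancel_left add_0_right antisym corner_simps regionD(1) regionD(3))

text \<open>Coordinate \<open>k\<close> does not increase along the ray, so it is already 1 at the
  start. This yields the last clause of \<open>linked\<close> for arcs made of rays.\<close>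

lemma corner_on_ray:
  assumes "corner k = ray i c s" "k \<noteq> i" "0 \<le> s"
  shows "ray i c 0 = corner k"
proof -
  have "1 \<le> ray i c 0 k" using ray_other[of k i 0 s c] assms by (metis corner_simps(1))
  then show ?thesis using region_corner ray_0_region regionD(2)[OF ray_0_region, of i c k] by simp
qed

lemma arc_between_shrink:
  assumes "arc_between A a b"
  shows "arc_between (shrink i ` A) (shrink i a) (shrink i b)"
proof -
  obtain g where g: "arc g" "path_image g = A" "pathstart g = a" "pathfinish g = b"
    using assms unfolding arc_between_def by blast
  have "path (shrink i \<circ> g)" using g by (intro path_continuous_image continuous_shrink) (simp add: arc_def)
  moreover have "inj_on (shrink i \<circ> g) {0..1}"
    using g by (intro comp_inj_on) (auto simp: arc_def inj_on_def)
  ultimately show ?thesis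
    unfolding arc_between_def using g
    by (intro exI[of _ "shrink i \<circ> g"]) (simp add: arc_def path_image_compose pathstart_compose pathfinish_compose)
qed

lemma continuous_coordinate: "continuous_on S (\<lambda>y :: nat \<Rightarrow> real. y j)"
  by (rule continuous_on_subset[OF continuous_on_product_coordinates]) simp

lemma arc_between_segpt:
  assumes "i \<noteq> j" "a < b"
  shows "arc_between (segpt i j ` {a..b}) (segpt i j a) (segpt i j b)"
proof -
  define g where "g = (\<lambda>t. segpt i j (a + t * (b - a)))"
  have im: "(\<lambda>t. a + t * (b - a)) ` {0..1} = {a..b}"
  proof
    show "(\<lambda>t. a + t * (b - a)) ` {0..1} \<subseteq> {a..b}"
    proof
      fix y assume "y \<in> (\<lambda>t. a + t * (b - a)) ` {0..1}"
      then obtain t where t: "0 \<le> t" "t \<le> 1" "y = a + t * (b - a)" by auto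
      then have "0 \<le> t * (b - a)" "t * (b - a) \<le> 1 * (b - a)" using assms by (auto intro: mult_right_mono)
      then show "y \<in> {a..b}" using t by auto
    qed
    show "{a..b} \<subseteq> (\<lambda>t. a + t * (b - a)) ` {0..1}"
    proof
      fix y assume "y \<in> {a..b}"
      then have "y = a + (y - a) / (b - a) * (b - a)" "(y - a) / (b - a) \<in> {0..1}" using assms by auto
      then show "y \<in> (\<lambda>t. a + t * (b - a)) ` {0..1}" by blast
    qed
  qed
  have ev: "g t j = a + t * (b - a)" for t using assms by (simp add: g_def segpt_eval)
  have "arc_between (g ` {0..1}) (g 0) (g 1)"
  proof (rule arc_between_of_coordinate[where h = "\<lambda>y. y j"])
    show "continuous_on {0..1} g"
      unfolding g_def by (rule continuous_on_compose2[OF continuous_segpt]) (auto intro!: continuous_intros)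
    show "continuous_on (g ` {0..1}) (\<lambda>y. y j)" by (rule continuous_coordinate)
    show "g s j \<le> g t j" if "0 \<le> s" "s \<le> t" "t \<le> 1" for s t
      using that assms by (simp add: ev mult_right_mono)
    show "g s = g t" if "g s j = g t j" for s t
      using that assms by (simp add: ev)
    show "g 0 \<noteq> g 1" using ev[of 0] ev[of 1] assms by (metis add_0_right add_diff_cancel_left' diff_self mult_1 mult_zero_left not_less_iff_gr_or_eq diff_0_right eq_iff_diff_eq_0)
  qed
  moreover have "g ` {0..1} = segpt i j ` {a..b}" unfolding g_def im[symmetric] by (simp add: image_image)
  ultimately show ?thesis by (simp add: g_def)
qed

lemma arc_between_ray:
  assumes "ray i c 0 \<noteq> corner i"
  shows "arc_between (ray i c ` {0..1}) (ray i c 0) (corner i)"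
  using arc_between_of_coordinate[of "ray i c" "\<lambda>y. y i"] assms ray_self_mono[of _ _ i c] ray_self_inject[of _ _ i c]
  by (simp add: continuous_ray ray_1 continuous_coordinate)

section \<open>Linking corners through prescribed points\<close>

definition matching :: "('a \<times> 'a) set \<Rightarrow> bool" where
  "matching P \<longleftrightarrow> (\<forall>p\<in>P. fst p \<noteq> snd p) \<and>
     (\<forall>p\<in>P. \<forall>q\<in>P. p \<noteq> q \<longrightarrow> {fst p, snd p} \<inter> {fst q, snd q} = {})"

text \<open>
  The last clause keeps the arcs away from the other corners; without it, the arcs in a subcell could
  touch connecting edges that do not belong to their trail.
\<close>

definition linked :: "label \<Rightarrow> (nat \<times> nat) set \<Rightarrow> (nat \<Rightarrow> real) set \<Rightarrow> bool" where
  "linked l P S \<longleftrightarrow> (\<exists>A.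
     (\<forall>p\<in>P. arc_between (A p) (corner (fst p)) (corner (snd p)) \<and> A p \<subseteq> cell l) \<and>
     (\<forall>p\<in>P. \<forall>q\<in>P. p \<noteq> q \<longrightarrow> A p \<inter> A q = {}) \<and>
     S \<subseteq> (\<Union>p\<in>P. A p) \<and>
     (\<forall>k. corner k \<in> (\<Union>p\<in>P. A p) \<longrightarrow> k \<in> fst ` P \<union> snd ` P \<or> corner k \<in> S))"

text \<open>Straight segments serve: those of different pairs have no letter in common.\<close>

lemma linked_empty:
  assumes "wf_label l" "P \<subseteq> letters l \<times> letters l" "matching P"
  shows "linked l P {}"
proof -
  define A where "A = (\<lambda>p. segpt (fst p) (snd p) ` {0..1})"
  have ne: "fst p \<noteq> snd p" if "p \<in> P" for p using that assms unfolding matching_def by blast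
  have "arc_between (A p) (corner (fst p)) (corner (snd p)) \<and> A p \<subseteq> cell l" if "p \<in> P" for p
    using arc_between_segpt[OF ne[OF that], of 0 1] segpt_cell[OF assms(1)] assms(2) that
    by (fastforce simp: A_def subset_iff mem_Times_iff)
  moreover have "A p \<inter> A q = {}" if "p \<in> P" "q \<in> P" "p \<noteq> q" for p q
  proof -
    have d: "{fst p, snd p} \<inter> {fst q, snd q} = {}" using that assms unfolding matching_def by blast
    have False if "s \<in> {0..1}" "t \<in> {0..1}" "segpt (fst p) (snd p) s = segpt (fst q) (snd q) t" for s t
    proof -
      have "segpt (fst p) (snd p) s (fst p) = 0" "segpt (fst p) (snd p) s (snd p) = 0"
        unfolding that(3) using d by (auto intro!: segpt_eval(3))
      then show False using segpt_eval(1,2)[OF ne[OF \<open>p \<in> P\<close>], of s] by simp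
    qed
    then show ?thesis unfolding A_def by blast
  qed
  moreover have "k \<in> fst ` P \<union> snd ` P" if "corner k \<in> A p" "p \<in> P" for k p
  proof (rule ccontr)
    assume "k \<notin> fst ` P \<union> snd ` P"
    then have "k \<noteq> fst p" "k \<noteq> snd p" using that by auto
    then have "y k = 0" if "y \<in> A p" for y using that unfolding A_def by (auto simp: segpt_eval(3))
    then show False using that(1) by fastforce
  qed
  ultimately show ?thesis unfolding linked_def by (intro exI[of _ A]) blast
qed

text \<open>The rays from \<open>x\<close> to the two corners form the arc. If \<open>x\<close> is
  one of these corners, one ray degenerates and a straight segment is used.\<close>

lemma linked_vert:
  assumes "wf_label l" "a \<in> letters l" "b \<in> letters l" "a \<noteq> b" "x \<in> vert l"
  shows "linked l {(a, b)} {x}"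
proof (cases "x = corner a \<or> x = corner b")
  case True
  have "linked l {(a, b)} {}" using assms by (intro linked_empty) (auto simp: matching_def)
  then obtain A where A: "arc_between (A (a, b)) (corner a) (corner b)" "A (a, b) \<subseteq> cell l"
    "\<And>k. corner k \<in> A (a, b) \<Longrightarrow> k = a \<or> k = b" unfolding linked_def by auto
  have "x \<in> A (a, b)" using True arc_between_mem[OF A(1)] by auto
  then show ?thesis unfolding linked_def using A by (intro exI[of _ A]) auto
next
  case False
  obtain c where c: "address l c" "\<And>i. x = ray i c 0" using vert_address[OF assms(5)] by blast
  define A where "A = ray a c ` {0..1} \<union> ray b c ` {0..1}"
  have "arc_between (ray a c ` {0..1}) (corner a) x"
    using arc_between_sym[OF arc_between_ray[of a c]] False c by metis
  moreover have "arc_between (ray b c ` {0..1}) x (corner b)"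
    using arc_between_ray[of b c] False c by metis
  moreover have "ray a c ` {0..1} \<inter> ray b c ` {0..1} \<subseteq> {x}"
  proof
    fix y assume "y \<in> ray a c ` {0..1} \<inter> ray b c ` {0..1}"
    then obtain s t where "s \<in> {0..1}" "t \<in> {0..1}" "y = ray a c s" "y = ray b c t" by auto
    then show "y \<in> {x}" using ray_inter[of a b s t c] assms(4) c(2)[of a] by auto
  qed
  ultimately have "arc_between A (corner a) (corner b)" unfolding A_def by (rule arc_between_join)
  moreover have "A \<subseteq> cell l" unfolding A_def using ray_cell assms c(1) by auto
  moreover have "x \<in> A" unfolding A_def using c(2)[of a] by auto
  moreover have "k = a \<or> k = b \<or> corner k = x" if "corner k \<in> A" for k
    using that corner_on_ray[of k a c] corner_on_ray[of k b c] c(2)[of a] c(2)[of b]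
    unfolding A_def by (metis UnE atLeastAtMost_iff imageE)
  ultimately show ?thesis unfolding linked_def by (intro exI[of _ "\<lambda>_. A"]) auto
qed

section \<open>Gluing the passes of trails through the copies\<close>

lemma arc_between_mid_closed:
  "i \<noteq> j \<Longrightarrow> arc_between (mid_closed i j) (shrink i (corner j)) (shrink j (corner i))"
  using arc_between_segpt[of i j "1/3" "2/3"] by (simp add: mid_closed_def segpt_third)

lemma mid_closed_swap: "mid_closed i j = mid_closed j i"
proof -
  have "mid_closed i j \<subseteq> mid_closed j i" for i j
  proof
    fix y assume "y \<in> mid_closed i j"
    then obtain s where "1/3 \<le> s" "s \<le> 2/3" "y = segpt i j s" by (auto simp: mid_closed_def)
    then have "y = segpt j i (1 - s)" "1 - s \<in> {1/3..2/3}" using segpt_swap[of i j s] by auto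
    then show "y \<in> mid_closed j i" by (auto simp: mid_closed_def)
  qed
  then show ?thesis by blast
qed

lemma mid_closed_disjoint:
  assumes "i \<noteq> j" "k \<noteq> m" "{i, j} \<noteq> {k, m}"
  shows "mid_closed i j \<inter> mid_closed k m = {}"
proof -
  have False if "s \<in> {1/3..2/3}" "t \<in> {1/3..2/3}" "segpt i j s = segpt k m t" for s t
  proof -
    have "i \<notin> {k, m} \<or> j \<notin> {k, m}" using assms by auto
    then show False
    proof
      assume "i \<notin> {k, m}"
      then have "segpt i j s i = 0" unfolding that(3) by (auto intro: segpt_eval(3))
      then have "1 - s = 0" using segpt_eval(1)[OF assms(1), of s] by simp
      then show False using that by simp
    next
      assume "j \<notin> {k, m}"
      then have "segpt i j s j = 0" unfolding that(3) by (auto intro: segpt_eval(3))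
      then have "s = 0" using segpt_eval(2)[OF assms(1), of s] by simp
      then show False using that by simp
    qed
  qed
  then show ?thesis unfolding mid_closed_def by blast
qed

text \<open>On the copy \<open>k\<close> coordinate \<open>k\<close> is at least \<open>2/3\<close>,
  a value that a closed edge attains only at its ends.\<close>

lemma mid_closed_shrink:
  assumes "shrink k z \<in> mid_closed i j" "i \<noteq> j" "z \<in> region"
  shows "(k = i \<and> z = corner j) \<or> (k = j \<and> z = corner i)"
proof -
  obtain s where s: "1/3 \<le> s" "s \<le> 2/3" "shrink k z = segpt i j s"
    using assms(1) by (auto simp: mid_closed_def)
  have "2/3 \<le> segpt i j s k" using shrink_ge[OF assms(3), of k] s by simp
  then consider "k = i" "s = 1/3" | "k = j" "s = 2/3"
    using s assms(2) segpt_eval(1,2)[of i j s] segpt_eval(3)[of k i j s] by (cases "k = i"; cases "k = j") auto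
  then show ?thesis
    using s segpt_third[of i j] shrink_inject by cases (metis, metis)
qed

text \<open>
  The letters \<open>v p 0, \<dots>, v p (r p)\<close> form the trail from \<open>fst p\<close> to \<open>snd p\<close>.  The pass at position \<open>q\<close> enters the subcell
  through the corner named after the previous letter; at the ends of the trail it uses the
  corner that the subcell shares with the whole cell.
\<close>

locale trails =
  fixes l :: label and P :: "(nat \<times> nat) set" and v :: "nat \<times> nat \<Rightarrow> nat \<Rightarrow> nat" and r :: "nat \<times> nat \<Rightarrow> nat"
  assumes wf: "wf_label l"
    and match: "matching P"
    and r_pos: "p \<in> P \<Longrightarrow> 0 < r p"
    and v_first: "p \<in> P \<Longrightarrow> v p 0 = fst p"
    and v_last: "p \<in> P \<Longrightarrow> v p (r p) = snd p"
    and v_letter: "p \<in> P \<Longrightarrow> q \<le> r p \<Longrightarrow> v p q \<in> letters l"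
    and v_step: "p \<in> P \<Longrightarrow> q < r p \<Longrightarrow> v p q \<noteq> v p (Suc q)"
    and v_edge: "\<lbrakk>p \<in> P; p' \<in> P; q < r p; q' < r p'; {v p q, v p (Suc q)} = {v p' q', v p' (Suc q')}\<rbrakk>
      \<Longrightarrow> p = p' \<and> q = q'"
begin

definition inn :: "nat \<times> nat \<Rightarrow> nat \<Rightarrow> nat" where
  "inn p q = (if q = 0 then fst p else v p (q - 1))"

definition out :: "nat \<times> nat \<Rightarrow> nat \<Rightarrow> nat" where
  "out p q = (if q = r p then snd p else v p (Suc q))"

definition pass :: "nat \<Rightarrow> (nat \<times> nat) set" where
  "pass k = {(inn p q, out p q) | p q. p \<in> P \<and> q \<le> r p \<and> v p q = k}"

lemma fst_eq: "p \<in> P \<Longrightarrow> p' \<in> P \<Longrightarrow> fst p = fst p' \<Longrightarrow> p = p'"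
  using match unfolding matching_def by blast

lemma snd_eq: "p \<in> P \<Longrightarrow> p' \<in> P \<Longrightarrow> snd p = snd p' \<Longrightarrow> p = p'"
  using match unfolding matching_def by blast

lemma fst_snd:
  assumes "p \<in> P" "p' \<in> P" shows "fst p \<noteq> snd p'"
proof (cases "p = p'")
  case True
  then show ?thesis using match assms unfolding matching_def by simp
next
  case False
  then have "{fst p, snd p} \<inter> {fst p', snd p'} = {}" using match assms unfolding matching_def by simp
  then show ?thesis by auto
qed

text \<open>\<open>out p q\<close> is the letter of the copy itself only where a trail stops;
  elsewhere it names the edge by which the trail leaves, and no edge is used twice.\<close>

lemma out_inject:
  assumes "p \<in> P" "p' \<in> P" "q \<le> r p" "q' \<le> r p'" "v p q = v p' q'" "out p q = out p' q'"
  shows "p = p' \<and> q = q'"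
proof (cases "q = r p")
  case True
  have "q' = r p'"
  proof (rule ccontr)
    assume "q' \<noteq> r p'"
    then have "out p' q' \<noteq> v p' q'" using v_step[of p' q'] assms by (simp add: out_def)
    moreover have "out p q = v p q" using True v_last assms by (simp add: out_def)
    ultimately show False using assms by simp
  qed
  then have "snd p = snd p'" using assms True by (simp add: out_def)
  then show ?thesis using snd_eq assms True \<open>q' = r p'\<close> by blast
next
  case False
  then have ne: "out p q \<noteq> v p q" using v_step[of p q] assms by (simp add: out_def)
  have "q' \<noteq> r p'" using ne v_last[OF assms(2)] assms(5,6) unfolding out_def[of p'] by auto
  then have "{v p q, v p (Suc q)} = {v p' q', v p' (Suc q')}" using assms False by (simp add: out_def)
  then show ?thesis using v_edge[of p p' q q'] assms False \<open>q' \<noteq> r p'\<close> by simp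
qed

lemma inn_inject:
  assumes "p \<in> P" "p' \<in> P" "q \<le> r p" "q' \<le> r p'" "v p q = v p' q'" "inn p q = inn p' q'"
  shows "p = p' \<and> q = q'"
proof (cases q)
  case 0
  have "q' = 0"
  proof (rule ccontr)
    assume "q' \<noteq> 0"
    then have "inn p' q' \<noteq> v p' q'" using v_step[of p' "q' - 1"] assms by (simp add: inn_def)
    moreover have "inn p q = v p q" using 0 v_first assms by (simp add: inn_def)
    ultimately show False using assms by simp
  qed
  then have "fst p = fst p'" using assms 0 by (simp add: inn_def)
  then show ?thesis using fst_eq assms 0 \<open>q' = 0\<close> by blast
next
  case (Suc m)
  then have ne: "inn p q \<noteq> v p q" using v_step[of p m] assms by (simp add: inn_def)
  have "q' \<noteq> 0"
  proof
    assume "q' = 0"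
    then have "inn p' q' = v p' q'" using v_first[OF assms(2)] by (simp add: inn_def)
    then show False using ne assms by simp
  qed
  then obtain m' where m': "q' = Suc m'" using not0_implies_Suc by blast
  then have "{v p m, v p (Suc m)} = {v p' m', v p' (Suc m')}" using assms Suc by (simp add: inn_def)
  then show ?thesis using v_edge[of p p' m m'] assms Suc m' by simp
qed

lemma inn_out:
  assumes "p \<in> P" "p' \<in> P" "q \<le> r p" "q' \<le> r p'" "v p q = v p' q'"
  shows "inn p q \<noteq> out p' q'"
proof
  assume eq: "inn p q = out p' q'"
  show False
  proof (cases q)
    case 0
    then have k: "inn p q = v p q" "v p q = fst p" using v_first assms by (simp_all add: inn_def)
    then have "q' = r p'" using v_step[of p' q'] assms eq by (auto simp: out_def split: if_splits)
    then have "fst p = snd p'" using k eq by (simp add: out_def)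
    then show False using fst_snd assms by blast
  next
    case (Suc m)
    then have ne: "inn p q \<noteq> v p q" using v_step[of p m] assms by (simp add: inn_def)
    have "q' \<noteq> r p'" using ne v_last[OF assms(2)] assms(5) eq unfolding out_def[of p'] by auto
    then have "{v p m, v p (Suc m)} = {v p' q', v p' (Suc q')}" using assms Suc eq by (auto simp: inn_def out_def)
    then have "p = p' \<and> m = q'" using v_edge[of p p' m q'] assms Suc \<open>q' \<noteq> r p'\<close> by simp
    then show False using ne assms Suc by (simp add: inn_def)
  qed
qed

text \<open>In the copy \<open>k\<close> the edge to \<open>j\<close> arrives at corner
  \<open>j\<close>, so trails without common edges use different corners. Corner \<open>k\<close> of
  this copy is on no edge; it is used only by a trail that starts or stops in the copy, and as
  \<open>P\<close> is a matching this happens at most once.\<close>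

lemma matching_pass: "matching (pass k)"
  unfolding matching_def
proof (intro conjI ballI impI)
  fix x assume "x \<in> pass k"
  then show "fst x \<noteq> snd x" using inn_out unfolding pass_def by auto
next
  fix x y assume "x \<in> pass k" "y \<in> pass k" "x \<noteq> y"
  then obtain p q p' q' where a: "x = (inn p q, out p q)" "y = (inn p' q', out p' q')"
    "p \<in> P" "p' \<in> P" "q \<le> r p" "q' \<le> r p'" "v p q = k" "v p' q' = k"
    unfolding pass_def mem_Collect_eq by blast
  then have "\<not> (p = p' \<and> q = q')" using \<open>x \<noteq> y\<close> by auto
  moreover have vk: "v p q = v p' q'" using a by simp
  ultimately have "inn p q \<noteq> inn p' q'" "out p q \<noteq> out p' q'"
    using inn_inject[OF a(3-6) vk] out_inject[OF a(3-6) vk] by blast+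
  moreover note inn_out[OF a(3-6) vk] inn_out[OF a(4,3,6,5) vk[symmetric]]
  ultimately have "inn p q \<noteq> inn p' q'" "out p q \<noteq> out p' q'" "inn p q \<noteq> out p' q'" "inn p' q' \<noteq> out p q" .
  then show "{fst x, snd x} \<inter> {fst y, snd y} = {}" using a by auto
qed

lemma pass_letters: "pass k \<subseteq> letters l \<times> letters l"
proof -
  have "inn p q \<in> letters l" "out p q \<in> letters l" if "p \<in> P" "q \<le> r p" for p q
    using v_letter[OF that(1), of 0] v_letter[OF that(1), of "r p"] v_letter[OF that(1), of "q - 1"]
      v_letter[OF that(1), of "Suc q"] v_first[OF that(1)] v_last[OF that(1)] that
    by (auto simp: inn_def out_def)
  then show ?thesis unfolding pass_def by auto
qed

text \<open>A trail becomes an arc by alternating the arcs inside the copies, supplied by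
  \<open>lk\<close>, with the closed edges between them. The points of \<open>S\<close> inside
  copies are covered by \<open>lk\<close>, those on edges by \<open>mids\<close>.\<close>

lemma linked:
  assumes lk: "\<And>k. k \<in> letters l \<Longrightarrow> linked (child l k) (pass k) {y \<in> cell (child l k). shrink k y \<in> S}"
    and S: "S \<subseteq> cell l"
    and mids: "\<And>i j. \<lbrakk>i \<in> letters l; j \<in> letters l; i \<noteq> j; mid_open i j \<inter> S \<noteq> {}\<rbrakk> \<Longrightarrow>
       \<exists>p\<in>P. \<exists>q<r p. {v p q, v p (Suc q)} = {i, j}"
  shows "linked l P S"
proof -
  let ?S = "\<lambda>k. {y \<in> cell (child l k). shrink k y \<in> S}"
  define F where "F = (\<lambda>k A.
     (\<forall>p\<in>pass k. arc_between (A p) (corner (fst p)) (corner (snd p)) \<and> A p \<subseteq> cell (child l k)) \<and>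
     (\<forall>p\<in>pass k. \<forall>q\<in>pass k. p \<noteq> q \<longrightarrow> A p \<inter> A q = {}) \<and>
     ?S k \<subseteq> (\<Union>p\<in>pass k. A p) \<and>
     (\<forall>m. corner m \<in> (\<Union>p\<in>pass k. A p) \<longrightarrow> m \<in> fst ` pass k \<union> snd ` pass k \<or> corner m \<in> ?S k))"
  have "\<forall>k\<in>letters l. \<exists>A. F k A"
    using lk unfolding linked_def F_def by simp
  from bchoice[OF this] obtain A where F: "\<And>k. k \<in> letters l \<Longrightarrow> F k (A k)" by blast
  have A: "p \<in> pass k \<Longrightarrow> arc_between (A k p) (corner (fst p)) (corner (snd p))"
    "p \<in> pass k \<Longrightarrow> A k p \<subseteq> cell (child l k)"
    "p \<in> pass k \<Longrightarrow> q \<in> pass k \<Longrightarrow> p \<noteq> q \<Longrightarrow> A k p \<inter> A k q = {}"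
    "y \<in> ?S k \<Longrightarrow> \<exists>p\<in>pass k. y \<in> A k p"
    "p \<in> pass k \<Longrightarrow> corner m \<in> A k p \<Longrightarrow> m \<in> fst ` pass k \<union> snd ` pass k \<or> corner m \<in> ?S k"
    if "k \<in> letters l" for k p q y m
  proof -
    note f = F[OF that, unfolded F_def]
    note f1 = conjunct1[OF f] and f2 = conjunct1[OF conjunct2[OF f]]
      and f3 = conjunct1[OF conjunct2[OF conjunct2[OF f]]]
      and f4 = conjunct2[OF conjunct2[OF conjunct2[OF f]]]
    show "p \<in> pass k \<Longrightarrow> arc_between (A k p) (corner (fst p)) (corner (snd p))"
      "p \<in> pass k \<Longrightarrow> A k p \<subseteq> cell (child l k)"
      using f1 by simp_all
    show "p \<in> pass k \<Longrightarrow> q \<in> pass k \<Longrightarrow> p \<noteq> q \<Longrightarrow> A k p \<inter> A k q = {}"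
      using f2 by simp
    show "y \<in> ?S k \<Longrightarrow> \<exists>p\<in>pass k. y \<in> A k p"
      using subsetD[OF f3] by simp
    show "p \<in> pass k \<Longrightarrow> corner m \<in> A k p \<Longrightarrow> m \<in> fst ` pass k \<union> snd ` pass k \<or> corner m \<in> ?S k"
      using f4 by (meson UN_I)
  qed
  define pr where "pr = (\<lambda>p q. (inn p q, out p q))"
  define B where "B = (\<lambda>p q. shrink (v p q) ` A (v p q) (pr p q))"
  define M where "M = (\<lambda>p q. mid_closed (v p q) (v p (Suc q)))"
  \<comment> \<open>A pass is grouped with the edge that follows it, so that consecutive groups meet
    only in the far end of this edge; \<open>z\<close> lists these ends.\<close>
  define C where "C = (\<lambda>p q. B p q \<union> (if q < r p then M p q else {}))"
  define z where "z = (\<lambda>p q. if q \<le> r p then shrink (v p q) (corner (inn p q)) else corner (snd p))"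
  have prp: "pr p q \<in> pass (v p q)" "v p q \<in> letters l" if "p \<in> P" "q \<le> r p" for p q
    using that v_letter unfolding pr_def pass_def mem_Collect_eq by blast+
  have Areg: "A (v p q) (pr p q) \<subseteq> region" if "p \<in> P" "q \<le> r p" for p q
    using A(2)[OF prp(2,1)] that cell_region by blast
  have same_pass: "p = p' \<and> q = q'"
    if "p \<in> P" "p' \<in> P" "q \<le> r p" "q' \<le> r p'" "v p q = v p' q'"
      "y \<in> A (v p q) (pr p q)" "y \<in> A (v p' q') (pr p' q')" for p q p' q' y
  proof -
    have "pr p q = pr p' q'"
      using A(3)[of "v p q" "pr p q" "pr p' q'"] prp[of p q] prp[of p' q'] that by auto
    then show ?thesis using out_inject[of p p' q q'] that by (auto simp: pr_def)
  qed
  have BB: "B p q \<inter> B p' q' = {}"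
    if "p \<in> P" "p' \<in> P" "q \<le> r p" "q' \<le> r p'" "\<not> (p = p' \<and> q = q')" for p q p' q'
  proof (rule ccontr)
    assume "B p q \<inter> B p' q' \<noteq> {}"
    then obtain y y' where y: "y \<in> A (v p q) (pr p q)" "y' \<in> A (v p' q') (pr p' q')"
      "shrink (v p q) y = shrink (v p' q') y'" unfolding B_def by blast
    moreover have "y \<in> region" "y' \<in> region" using Areg that y by blast+
    ultimately have "v p q = v p' q'" "y = y'" using shrink_eq_shrink by blast+
    then show False using same_pass[of p p' q q' y] that y by auto
  qed
  have MM: "M p q \<inter> M p' q' = {}"
    if "p \<in> P" "p' \<in> P" "q < r p" "q' < r p'" "\<not> (p = p' \<and> q = q')" for p q p' q'
    unfolding M_def using v_edge[of p p' q q'] v_step that by (intro mid_closed_disjoint) auto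
  have end_out: "corner (v p (Suc q)) \<in> A (v p q) (pr p q)" if "p \<in> P" "q < r p" for p q
    using arc_between_mem[OF A(1)[OF prp(2,1)], of p q] that by (simp add: pr_def out_def)
  have end_in: "corner (v p q) \<in> A (v p (Suc q)) (pr p (Suc q))" if "p \<in> P" "q < r p" for p q
    using arc_between_mem[OF A(1)[OF prp(2,1)], of p "Suc q"] that by (simp add: pr_def inn_def)
  \<comment> \<open>An edge can meet a pass only in one of its own ends. That end is a corner of the
    copy through which its own trail passes, and disjointness of the arcs in the copy excludes every
    other pass.\<close>
  have MB: "p = p' \<and> (q' = q \<and> y = shrink (v p q) (corner (v p (Suc q))) \<or>
       q' = Suc q \<and> y = shrink (v p (Suc q)) (corner (v p q)))"
    if h: "p \<in> P" "p' \<in> P" "q < r p" "q' \<le> r p'" "y \<in> M p q" and yB: "y \<in> B p' q'" for p q p' q' y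
  proof -
    obtain x where x: "x \<in> A (v p' q') (pr p' q')" "y = shrink (v p' q') x" using yB unfolding B_def by blast
    moreover have "x \<in> region" using Areg x that by blast
    ultimately consider "v p' q' = v p q" "x = corner (v p (Suc q))" | "v p' q' = v p (Suc q)" "x = corner (v p q)"
      using mid_closed_shrink[of "v p' q'" x "v p q" "v p (Suc q)"] v_step[of p q] h unfolding M_def by auto
    then show ?thesis
    proof cases
      case 1
      have "x \<in> A (v p q) (pr p q)" using end_out[OF h(1,3)] 1(2) by simp
      then have "p = p' \<and> q = q'" using same_pass[OF h(1,2) _ h(4) 1(1)[symmetric] _ x(1)] h(3) by simp
      moreover have "y = shrink (v p q) (corner (v p (Suc q)))" unfolding x(2) 1 ..
      ultimately show ?thesis by blast
    next
      case 2
      have "x \<in> A (v p (Suc q)) (pr p (Suc q))" using end_in[OF h(1,3)] 2(2) by simp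
      then have "p = p' \<and> Suc q = q'" using same_pass[OF h(1,2) _ h(4) 2(1)[symmetric] _ x(1)] h(3) by simp
      moreover have "y = shrink (v p (Suc q)) (corner (v p q))" unfolding x(2) 2 ..
      ultimately show ?thesis by blast
    qed
  qed
  have CC: "C p q \<inter> C p' q' = {}"
    if h: "p \<in> P" "p' \<in> P" "q \<le> r p" "q' \<le> r p'" "\<not> (p = p' \<and> (q = q' \<or> q' = Suc q \<or> q = Suc q'))" for p q p' q'
  proof -
    have ne: "\<not> (p = p' \<and> q = q')" using h(5) by blast
    have "B p q \<inter> B p' q' = {}" by (rule BB[OF h(1-4) ne])
    moreover have "q < r p \<Longrightarrow> q' < r p' \<Longrightarrow> M p q \<inter> M p' q' = {}" using MM[OF h(1,2) _ _ ne] .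
    moreover have "M p q \<inter> B p' q' = {}" if "q < r p"
    proof -
      have "y \<notin> B p' q'" if "y \<in> M p q" for y
        using MB[OF h(1,2) \<open>q < r p\<close> h(4) that] h(5) by blast
      then show ?thesis by blast
    qed
    moreover have "B p q \<inter> M p' q' = {}" if "q' < r p'"
    proof -
      have "y \<notin> B p q" if "y \<in> M p' q'" for y
        using MB[OF h(2,1) \<open>q' < r p'\<close> h(3) that] h(5) by blast
      then show ?thesis by blast
    qed
    ultimately show ?thesis unfolding C_def by auto
  qed
  have C_next: "C p q \<inter> C p (Suc q) \<subseteq> {z p (Suc q)}" if "p \<in> P" "q < r p" for p q
  proof
    fix y assume y: "y \<in> C p q \<inter> C p (Suc q)"
    have "y \<notin> B p q \<or> y \<notin> B p (Suc q)" using BB[of p p q "Suc q"] that by auto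
    moreover have "y \<notin> M p q \<or> y \<notin> M p (Suc q) \<or> \<not> Suc q < r p" using MM[of p p q "Suc q"] that by auto
    moreover have "y \<in> M p (Suc q) \<Longrightarrow> y \<in> B p q \<Longrightarrow> Suc q < r p \<Longrightarrow> False"
      using MB[of p p "Suc q" q y] that by auto
    ultimately have "y \<in> M p q" "y \<in> B p (Suc q)" using y that by (auto simp: C_def split: if_splits)
    then have "y = shrink (v p (Suc q)) (corner (v p q))" using MB[of p p q "Suc q" y] that by auto
    then show "y \<in> {z p (Suc q)}" using that by (simp add: z_def inn_def)
  qed
  have C_arc: "arc_between (C p q) (z p q) (z p (Suc q))" if "p \<in> P" "q \<le> r p" for p q
  proof -
    have b: "arc_between (B p q) (shrink (v p q) (corner (inn p q))) (shrink (v p q) (corner (out p q)))"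
      unfolding B_def using arc_between_shrink[OF A(1)[OF prp(2,1)], of p q "v p q"] that by (simp add: pr_def)
    show ?thesis
    proof (cases "q < r p")
      case True
      have "arc_between (M p q) (shrink (v p q) (corner (v p (Suc q)))) (shrink (v p (Suc q)) (corner (v p q)))"
        unfolding M_def using v_step that True by (intro arc_between_mid_closed) auto
      moreover have "B p q \<inter> M p q \<subseteq> {shrink (v p q) (corner (v p (Suc q)))}"
        using MB[of p p q q] that True by auto
      ultimately show ?thesis using arc_between_join[of "B p q" _ "shrink (v p q) (corner (v p (Suc q)))" "M p q"] b that True
        by (simp add: C_def z_def out_def inn_def)
    next
      case False
      then have "q = r p" using that by simp
      then show ?thesis using b v_last[OF that(1)] that corner_eq_shrink[of "snd p"] by (simp add: C_def z_def out_def)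
    qed
  qed
  define D where "D = (\<lambda>p. \<Union>q\<le>r p. C p q)"
  have C_cell: "C p q \<subseteq> cell l" if "p \<in> P" "q \<le> r p" for p q
  proof -
    have "B p q \<subseteq> cell l"
      unfolding B_def using A(2)[OF prp(2,1)] shrink_cellI prp(2) that by blast
    moreover have "M p q \<subseteq> cell l" if "q < r p"
    proof -
      have "v p q \<in> letters l" "v p (Suc q) \<in> letters l" using v_letter \<open>p \<in> P\<close> that by simp_all
      then show ?thesis unfolding M_def mid_closed_def using segpt_cell[OF wf] by auto
    qed
    ultimately show ?thesis by (auto simp: C_def)
  qed
  have "arc_between (D p) (corner (fst p)) (corner (snd p)) \<and> D p \<subseteq> cell l" if "p \<in> P" for p
  proof -
    have "arc_between (D p) (z p 0) (z p (Suc (r p)))"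
      unfolding D_def
    proof (rule arc_between_chain)
      show "arc_between (C p i) (z p i) (z p (Suc i))" if "i \<le> r p" for i using C_arc that \<open>p \<in> P\<close> by blast
      show "C p i \<inter> C p (Suc i) \<subseteq> {z p (Suc i)}" if "i < r p" for i using C_next that \<open>p \<in> P\<close> by blast
      show "C p i \<inter> C p j = {}" if "i + 1 < j" "j \<le> r p" for i j
        using that \<open>p \<in> P\<close> by (intro CC) auto
    qed
    moreover have "z p 0 = corner (fst p)"
      using v_first[OF that] corner_eq_shrink[of "fst p"] by (simp add: z_def inn_def)
    moreover have "z p (Suc (r p)) = corner (snd p)" by (simp add: z_def)
    moreover have "D p \<subseteq> cell l" unfolding D_def using C_cell[OF that] by blast
    ultimately show ?thesis by simp
  qed
  moreover have "D p \<inter> D p' = {}" if "p \<in> P" "p' \<in> P" "p \<noteq> p'" for p p'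
  proof -
    have "C p q \<inter> C p' q' = {}" if "q \<le> r p" "q' \<le> r p'" for q q'
      using CC[OF \<open>p \<in> P\<close> \<open>p' \<in> P\<close> that] \<open>p \<noteq> p'\<close> by blast
    then show ?thesis unfolding D_def by fast
  qed
  moreover have "S \<subseteq> (\<Union>p\<in>P. D p)"
  proof
    fix y assume y: "y \<in> S"
    then have "in_cell l y" using S by (auto simp: cell_def)
    then show "y \<in> (\<Union>p\<in>P. D p)"
    proof cases
      case (mid i j s)
      then have "y \<in> mid_open i j" by (auto simp: mid_open_def)
      then obtain p q where pq: "p \<in> P" "q < r p" "{v p q, v p (Suc q)} = {i, j}" using mids[of i j] mid y by blast
      then have "M p q = mid_closed i j" unfolding M_def using mid_closed_swap by (metis doubleton_eq_iff)
      then have "y \<in> C p q" using mid_subset \<open>y \<in> mid_open i j\<close> pq by (auto simp: C_def)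
      then have "y \<in> D p" unfolding D_def using pq by (intro UN_I[of q]) simp_all
      then show ?thesis using pq by blast
    next
      case (sub k x)
      then have "x \<in> ?S k" using y by (simp add: cell_def)
      then obtain w where w: "w \<in> pass k" "x \<in> A k w" using A(4) sub by blast
      then obtain p q where pq: "w = pr p q" "p \<in> P" "q \<le> r p" "v p q = k" unfolding pass_def pr_def by blast
      then have "y \<in> C p q" using w sub by (auto simp: C_def B_def)
      then have "y \<in> D p" unfolding D_def using pq by (intro UN_I[of q]) simp_all
      then show ?thesis using pq by blast
    qed
  qed
  \<comment> \<open>Corner \<open>k\<close> of the cell is corner \<open>k\<close> of the copy
    \<open>k\<close> and on no edge. A pass through this copy that has it as an end belongs to the
    start or stop of a trail; otherwise it is a point of \<open>S\<close>.\<close>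
  moreover have "k \<in> fst ` P \<union> snd ` P \<or> corner k \<in> S" if kD: "corner k \<in> D p" and "p \<in> P" for k p
  proof -
    obtain q where q: "q \<le> r p" "corner k \<in> C p q" using kD unfolding D_def by blast
    have "corner k \<notin> M p q" if "q < r p"
    proof
      assume "corner k \<in> M p q"
      then obtain s where s: "1/3 \<le> s" "s \<le> 2/3" "corner k = segpt (v p q) (v p (Suc q)) s"
        by (auto simp: M_def mid_closed_def)
      have "corner k (v p (Suc q)) = s"
        unfolding s(3) using segpt_eval(2)[OF v_step[OF \<open>p \<in> P\<close> that], of s] .
      then show False using s(1,2) unfolding corner_def by (simp split: if_splits)
    qed
    then have "corner k \<in> B p q" using q by (auto simp: C_def split: if_splits)
    then obtain x where x: "x \<in> A (v p q) (pr p q)" "corner k = shrink (v p q) x" unfolding B_def by blast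
    moreover have "x \<in> region" using Areg x that q by blast
    ultimately have k: "v p q = k" "x = corner k" using corner_eq_shrinkD by blast+
    note prp' = prp[OF \<open>p \<in> P\<close> q(1)]
    have "corner k \<in> A (v p q) (pr p q)" using x(1) unfolding k(2) .
    then have "k \<in> fst ` pass k \<union> snd ` pass k \<or> corner k \<in> ?S k"
      using A(5)[OF prp'(2,1), of k] unfolding k(1) by blast
    then consider w where "w \<in> pass k" "k = fst w" | w where "w \<in> pass k" "k = snd w" | "corner k \<in> ?S k"
      by blast
    then show ?thesis
    proof cases
      case (1 w)
      then obtain p' q' where a: "p' \<in> P" "q' \<le> r p'" "v p' q' = k" "inn p' q' = k"
        unfolding pass_def mem_Collect_eq by (metis fst_conv)
      have "q' = 0"
      proof (rule ccontr)
        assume "q' \<noteq> 0"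
        then show False using v_step[OF a(1), of "q' - 1"] a by (simp add: inn_def)
      qed
      then have "k = fst p'" using v_first[OF a(1)] a by simp
      then show ?thesis using a(1) by blast
    next
      case (2 w)
      then obtain p' q' where a: "p' \<in> P" "q' \<le> r p'" "v p' q' = k" "out p' q' = k"
        unfolding pass_def mem_Collect_eq by (metis snd_conv)
      have "q' = r p'"
      proof (rule ccontr)
        assume "q' \<noteq> r p'"
        then show False using v_step[OF a(1), of q'] a by (simp add: out_def)
      qed
      then have "k = snd p'" using v_last[OF a(1)] a by simp
      then show ?thesis using a(1) by blast
    next
      case 3
      then show ?thesis using corner_eq_shrink[of k] by simp
    qed
  qed
  ultimately show ?thesis unfolding linked_def by (intro exI[of _ D]) blast
qed

end

section \<open>Separating finitely many points at a finite level\<close>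

definition preim :: "label \<Rightarrow> nat \<Rightarrow> (nat \<Rightarrow> real) set \<Rightarrow> (nat \<Rightarrow> real) set" where
  "preim l k S = {y \<in> cell (child l k). shrink k y \<in> S}"

text \<open>
  The points of \<open>S\<close> are separated at level \<open>m\<close>, and all edges containing one of them occur above that level.
\<close>

primrec good :: "nat \<Rightarrow> label \<Rightarrow> (nat \<Rightarrow> real) set \<Rightarrow> bool" where
  "good 0 l S \<longleftrightarrow> S \<subseteq> vert l \<and> (\<exists>x. S \<subseteq> {x})"
| "good (Suc m) l S \<longleftrightarrow> (\<forall>i\<in>letters l. good m (child l i) (preim l i S))"

lemma preim_cell: "preim l k S \<subseteq> cell (child l k)"
  by (auto simp: preim_def)

lemma preim_finite: "finite S \<Longrightarrow> finite (preim l k S)"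
  by (rule finite_imageD[of "shrink k", OF finite_subset[of _ S]]) (auto simp: preim_def inj_on_def)

lemma preim_card: "finite S \<Longrightarrow> card (preim l k S) \<le> card S"
  by (rule card_inj_on_le[of "shrink k"]) (auto simp: preim_def inj_on_def)

lemma shrink_vertD:
  assumes "shrink i y \<in> vert l" "y \<in> region"
  shows "i \<in> letters l \<and> y \<in> vert (child l i)"
proof -
  have "in_vert l (shrink i y)" using assms by (simp add: vert_def)
  then show ?thesis
  proof cases
    case (sub k z)
    then show ?thesis using shrink_eq_shrink[of i y k z] assms by (auto simp: vert_def)
  qed
qed

lemma good_preim_0:
  assumes "good 0 l S"
  shows "good 0 (child l i) (preim l i S)"
proof -
  obtain x where x: "S \<subseteq> vert l" "S \<subseteq> {x}" using assms by auto
  have reg: "y \<in> region" if "y \<in> preim l i S" for y using that preim_cell cell_region by blast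
  have "preim l i S \<subseteq> vert (child l i)"
    using shrink_vertD[of i _ l] reg x by (auto simp: preim_def)
  moreover have "y = z" if "y \<in> preim l i S" "z \<in> preim l i S" for y z
  proof -
    have "shrink i y \<in> S" "shrink i z \<in> S" using that by (simp_all add: preim_def)
    then have "shrink i y = shrink i z" using x(2) by blast
    then show ?thesis by simp
  qed
  ultimately show ?thesis by (metis good.simps(1) insertI1 singletonD subsetI)
qed

lemma good_Suc: "good m l S \<Longrightarrow> good (Suc m) l S"
proof (induction m arbitrary: l S)
  case 0
  then show ?case using good_preim_0 by (simp del: good.simps(1))
qed auto

lemma good_mono: "m \<le> k \<Longrightarrow> good m l S \<Longrightarrow> good k l S"
  by (induction k rule: dec_induct) (auto intro: good_Suc simp del: good.simps)

text \<open>If \<open>S\<close> is not good at any level, the same is true of its part in some copy,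
  and by the induction hypothesis this part is all of \<open>S\<close>. Repeating this for ever, the
  points of \<open>S\<close> share all letters of their addresses; hence there is only one, and it
  is a vertex, so \<open>S\<close> is good at level 0.\<close>

lemma ex_good:
  assumes "wf_label l" "finite S" "S \<subseteq> cell l"
  shows "\<exists>m. good m l S"
  using assms
proof (induction "card S" arbitrary: l S rule: less_induct)
  case less
  note IH = less.hyps
  \<comment> \<open>The size is kept fixed so that the induction hypothesis applies to smaller parts
    of \<open>T\<close> at every depth.\<close>
  define bad where "bad = (\<lambda>l T. wf_label l \<and> finite T \<and> T \<subseteq> cell l \<and> card T = card S \<and> \<not> (\<exists>m. good m l T))"
  have step: "\<exists>i\<in>letters l. \<exists>T'. bad (child l i) T' \<and> T = shrink i ` T'" if b: "bad l T" for l T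
  proof -
    have wf: "wf_label l" "finite T" "T \<subseteq> cell l" "card T = card S" "\<And>m. \<not> good m l T"
      using b unfolding bad_def by blast+
    have "\<exists>i\<in>letters l. \<forall>m. \<not> good m (child l i) (preim l i T)"
    proof (rule ccontr)
      assume "\<not> ?thesis"
      then obtain f where f: "\<And>i. i \<in> letters l \<Longrightarrow> good (f i) (child l i) (preim l i T)" by metis
      \<comment> \<open>A level that serves all of the finitely many copies, since goodness passes
        to later levels.\<close>
      define M where "M = (\<Sum>i\<in>letters l. f i)"
      have "f i \<le> M" if "i \<in> letters l" for i
        unfolding M_def using that wf(1) by (intro member_le_sum) auto
      then have "good (Suc M) l T" using f good_mono by (simp del: good.simps(1)) blast
      then show False using wf by blast
    qed
    then obtain i where i: "i \<in> letters l" "\<And>m. \<not> good m (child l i) (preim l i T)" by blast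
    have "card (preim l i T) = card S"
    proof (rule ccontr)
      assume "card (preim l i T) \<noteq> card S"
      then have "card (preim l i T) < card S" using preim_card[of T l i] wf by simp
      then have "\<exists>m. good m (child l i) (preim l i T)"
        using IH[of "preim l i T" "child l i"] wf preim_cell preim_finite by simp
      then show False using i by blast
    qed
    moreover have "card (shrink i ` preim l i T) = card (preim l i T)" by (intro card_image) (auto simp: inj_on_def)
    moreover have "shrink i ` preim l i T \<subseteq> T" by (auto simp: preim_def)
    ultimately have "T = shrink i ` preim l i T" using wf by (metis card_subset_eq)
    then show ?thesis
      using i wf preim_cell preim_finite \<open>card (preim l i T) = card S\<close> unfolding bad_def
      by (intro bexI[of _ i] exI[of _ "preim l i T"]) auto
  qed
  show ?case
  proof (rule ccontr)
    assume "\<not> ?case"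
    then have bad: "bad l S" unfolding bad_def using less.prems by blast
    have "in_vert l y" if "bad l T" "y \<in> T" for l T y
      using that
    proof (coinduction arbitrary: l T y)
      case in_vert
      obtain i T' where i: "i \<in> letters l" "bad (child l i) T'" "T = shrink i ` T'" using step in_vert by blast
      then obtain y' where y': "y = shrink i y'" "y' \<in> T'" using in_vert by blast
      then have "y' \<in> region" using i cell_region unfolding bad_def by blast
      then show ?case using i y' by blast
    qed
    then have "S \<subseteq> vert l" using bad by (auto simp: vert_def)
    moreover have "y = z" if "y \<in> S" "z \<in> S" for y z
    proof
      fix j
      have "\<bar>y j - z j\<bar> \<le> (1/3)^m" if "bad l T" "y \<in> T" "z \<in> T" for m l T y z
        using that
      proof (induction m arbitrary: l T y z)
        case 0
        then have "y \<in> region" "z \<in> region" using cell_region unfolding bad_def by blast+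
        then show ?case using regionD(1,2)[of y j] regionD(1,2)[of z j] by (simp add: abs_if)
      next
        case (Suc m)
        obtain i T' where i: "i \<in> letters l" "bad (child l i) T'" "T = shrink i ` T'" using step Suc.prems by blast
        then obtain y' z' where y': "y = shrink i y'" "y' \<in> T'" "z = shrink i z'" "z' \<in> T'" using Suc.prems by blast
        have eq: "y j - z j = (y' j - z' j) / 3" unfolding y' by (simp add: shrink_def field_simps)
        show ?case unfolding eq using Suc.IH[of "child l i" T' y' z'] i y' by simp
      qed
      then have "\<bar>y j - z j\<bar> \<le> 0" using bad that
        by (intro LIMSEQ_le_const[OF LIMSEQ_power_zero[of "1/3::real"]]) auto
      then show "y j = z j" by simp
    qed
    ultimately have "good 0 l S" by (metis good.simps(1) insertI1 singletonD subsetI)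
    then show False using bad unfolding bad_def by blast
  qed
qed

section \<open>Routing trails through a hub\<close>

lemma mid_open_not_shrink:
  assumes "y \<in> mid_open i j" "i \<noteq> j" "z \<in> region" shows "y \<noteq> shrink k z"
proof
  assume eq: "y = shrink k z"
  obtain s where s: "1/3 < s" "s < 2/3" "y = segpt i j s" using assms by (auto simp: mid_open_def)
  have "2/3 \<le> y k" using shrink_ge[OF assms(3)] eq by simp
  then show False
    using s segpt_eval(1,2)[OF assms(2), of s] segpt_eval(3)[of k i j s]
    by (cases "k = i"; cases "k = j") auto
qed

text \<open>A pair \<open>(i, j)\<close> with \<open>i < j\<close> stands for an edge and
  \<open>(i, i)\<close> for a copy. These sets are pairwise disjoint, and each of them contains a
  point of \<open>S\<close>.\<close>

lemma card_items:
  assumes "finite S" "I \<subseteq> A \<times> A"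
    and ne: "\<And>i j. (i, j) \<in> I \<Longrightarrow> i \<noteq> j \<Longrightarrow> i < j \<and> mid_open i j \<inter> S \<noteq> {}"
    and diag: "\<And>i. (i, i) \<in> I \<Longrightarrow> shrink i ` region \<inter> S \<noteq> {}"
  shows "card I \<le> card S \<and> finite I"
proof -
  define D where "D = (\<lambda>(i, j). if i = j then shrink i ` region else mid_open i j)"
  have "D x \<inter> S \<noteq> {}" if "x \<in> I" for x using that ne diag by (cases x) (auto simp: D_def)
  then have "\<forall>x\<in>I. \<exists>y. y \<in> D x \<and> y \<in> S" by blast
  from bchoice[OF this] obtain f where f: "\<And>x. x \<in> I \<Longrightarrow> f x \<in> D x \<and> f x \<in> S" by blast
  have disj: "x = y" if xy: "x \<in> I" "y \<in> I" "w \<in> D x" "w \<in> D y" for x y w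
  proof -
    obtain i j k m where ij: "x = (i, j)" "y = (k, m)" by (metis surj_pair)
    show ?thesis
    proof (cases "i = j"; cases "k = m")
      assume "i = j" "k = m"
      then show ?thesis using xy ij shrink_eq_shrink by (auto simp: D_def)
    next
      assume "i = j" "k \<noteq> m"
      then show ?thesis using xy ij mid_open_not_shrink[of w k m] by (auto simp: D_def)
    next
      assume "i \<noteq> j" "k = m"
      then show ?thesis using xy ij mid_open_not_shrink[of w i j] by (auto simp: D_def)
    next
      assume neq: "i \<noteq> j" "k \<noteq> m"
      then have "w \<in> mid_closed i j \<inter> mid_closed k m" using xy ij mid_subset by (auto simp: D_def)
      then have "{i, j} = {k, m}" using mid_closed_disjoint[OF neq] by blast
      then show ?thesis using ne[of i j] ne[of k m] xy ij neq by (auto simp: doubleton_eq_iff)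
    qed
  qed
  have "inj_on f I" using f disj by (intro inj_onI) metis
  moreover have "f ` I \<subseteq> S" using f by blast
  ultimately show ?thesis using assms(1) card_inj_on_le[of f I S] inj_on_finite[of f I S] by blast
qed

text \<open>The long trail has periods of four edges. If \<open>a\<close> and \<open>b\<close> are
  the two connecting letters of a period, then its edges contain \<open>a\<close>, both,
  \<open>b\<close>, and no connecting letter. This trace determines the place in the period and,
  except for the fourth kind, the period.\<close>

lemma code_inject:
  fixes c c' :: nat
  assumes "(if c = 0 then {a} else if c = 1 then {a, b} else if c = 2 then {b} else {}) =
      (if c' = 0 then {a'} else if c' = 1 then {a', b'} else if c' = 2 then {b'} else {})"
    and "c < 4" "c' < 4" "a \<noteq> b'" "b \<noteq> a'" "a \<noteq> b" "a' \<noteq> b'"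
  shows "c = c' \<and> (c \<noteq> 3 \<longrightarrow> a = a' \<or> b = b')"
proof -
  have "c \<in> {0, 1, 2, 3}" "c' \<in> {0, 1, 2, 3}" using assms by auto
  then show ?thesis using assms(1,4-) by (auto simp: doubleton_eq_iff)
qed

text \<open>
  All pairs but \<open>p0\<close> are joined directly.  The trail of \<open>p0\<close> visits the remaining prescribed edges \<open>X i, Y (Suc i)\<close>
  one after the other, with two fresh letters between consecutive ones; a single one would be entered and left
  through the same edge if \<open>Y i = X i\<close>.  A subcell that has to be visited for the sake of a point inside is treated as an
  edge to a fresh letter.
\<close>

lemma hub_routing:
  assumes A: "finite A" "20 * N + 20 \<le> card A" and P: "P \<subseteq> A \<times> A" "matching P" "P \<noteq> {}" "card P \<le> 4 * N + 5"
    and S: "finite S" "card S \<le> N" "S \<subseteq> cell (Hub A)"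
  shows "\<exists>v r. trails (Hub A) P v r \<and>
     (\<forall>i\<in>A. \<forall>j\<in>A. i \<noteq> j \<longrightarrow> mid_open i j \<inter> S \<noteq> {} \<longrightarrow> (\<exists>p\<in>P. \<exists>q<r p. {v p q, v p (Suc q)} = {i, j})) \<and>
     (\<forall>k\<in>A. card (trails.pass P v r k) \<le> 4 * N + 5 \<and>
        (preim (Hub A) k S \<noteq> {} \<longrightarrow> trails.pass P v r k \<noteq> {} \<and>
           ((\<forall>i j. i \<noteq> j \<longrightarrow> mid_open i j \<inter> S = {}) \<longrightarrow> (\<exists>x. trails.pass P v r k = {x}))))"
proof -
  obtain p0 where p0: "p0 \<in> P" using P by blast
  have fP: "finite P" using P A by (metis finite_SigmaI finite_subset)
  define ends where "ends = fst ` P \<union> snd ` P"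
  \<comment> \<open>Edges between the ends of another pair are left out: the direct trail of that
    pair uses them already, and an edge may be used only once.\<close>
  define Ed where "Ed = {(i, j). i \<in> A \<and> j \<in> A \<and> i < j \<and> mid_open i j \<inter> S \<noteq> {} \<and> (\<forall>p\<in>P - {p0}. {i, j} \<noteq> {fst p, snd p})}"
  \<comment> \<open>A copy named by an end of \<open>P\<close> is visited in any case.\<close>
  define K where "K = {k \<in> A. k \<notin> ends \<and> preim (Hub A) k S \<noteq> {}}"
  define I where "I = Ed \<union> (\<lambda>k. (k, k)) ` K"
  have IA: "I \<subseteq> A \<times> A" by (auto simp: I_def Ed_def K_def)
  have "card I \<le> card S \<and> finite I"
  proof (rule card_items[OF S(1) IA])
    show "i < j \<and> mid_open i j \<inter> S \<noteq> {}" if "(i, j) \<in> I" "i \<noteq> j" for i j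
      using that by (auto simp: I_def Ed_def)
    show "shrink i ` region \<inter> S \<noteq> {}" if i: "(i, i) \<in> I" for i
    proof -
      have "preim (Hub A) i S \<noteq> {}" using i by (auto simp: I_def Ed_def K_def)
      then obtain y where "y \<in> cell (child (Hub A) i)" "shrink i y \<in> S" unfolding preim_def by blast
      then show ?thesis using cell_region by blast
    qed
  qed
  then have fI: "finite I" and cI: "card I \<le> N" using S by auto
  obtain its where its: "set its = I" "distinct its" using finite_distinct_list[OF fI] by blast
  define q where "q = length its"
  have q: "q \<le> N" using its cI distinct_card[of its] by (simp add: q_def)
  \<comment> \<open>Fresh letters must avoid these: at most \<open>2 * (4 * N + 5)\<close> ends of
    pairs and \<open>2 * N\<close> letters of items.\<close>
  define W where "W = ends \<union> fst ` I \<union> snd ` I"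
  have "card W \<le> 10 * N + 10 \<and> finite W"
  proof -
    have "card W \<le> card (fst ` P) + card (snd ` P) + card (fst ` I) + card (snd ` I)"
      unfolding W_def ends_def by (meson card_Un_le add_le_mono order_trans order_refl)
    also have "\<dots> \<le> card P + card P + card I + card I"
      by (intro add_mono card_image_le fP fI)
    finally show ?thesis using P(4) cI fP fI by (auto simp: W_def ends_def)
  qed
  moreover have "card (A - W) \<ge> card A - card W" by (intro diff_card_le_card_Diff) (use calculation in blast)
  \<comment> \<open>Two connecting letters for each of the \<open>q + 1\<close> gaps, and one
    reserved for each item, used if the item is a copy.\<close>
  ultimately have "3 * q + 2 \<le> card (A - W)" using A q by linarith
  then obtain F where F: "F \<subseteq> A - W" "card F = 3 * q + 2" by (meson obtain_subset_with_card_n)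
  have "finite F" using F A finite_subset by blast
  then obtain fr where fr: "bij_betw fr {0..<3 * q + 2} F" using ex_bij_betw_nat_finite F(2) by metis
  have frF: "fr i \<in> A - W" if "i < 3 * q + 2" for i
  proof -
    have "fr i \<in> F" using bij_betwE[OF fr] that by simp
    then show ?thesis using F(1) by blast
  qed
  have fr_inj: "fr i = fr j \<longleftrightarrow> i = j" if "i < 3 * q + 2" "j < 3 * q + 2" for i j
    using fr that unfolding bij_betw_def inj_on_def by auto
  \<comment> \<open>Item \<open>i\<close> is traversed from \<open>X i\<close> to
    \<open>Y (Suc i)\<close>. With this shift the ends of \<open>p0\<close> become
    \<open>Y 0\<close> and \<open>X q\<close>, and the gap \<open>i\<close> leads from
    \<open>Y i\<close> to \<open>X i\<close>.\<close>
  define X where "X = (\<lambda>i. if i < q then fst (its ! i) else snd p0)"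
  define Y where "Y = (\<lambda>i. case i of 0 \<Rightarrow> fst p0 | Suc k \<Rightarrow>
     if fst (its ! k) = snd (its ! k) then fr (2 * q + 2 + k) else snd (its ! k))"
  define v where "v = (\<lambda>p m. if p \<noteq> p0 then (if m = 0 then fst p else snd p) else
     (if m mod 4 = 0 then Y (m div 4) else if m mod 4 = 1 then fr (2 * (m div 4))
      else if m mod 4 = 2 then fr (2 * (m div 4) + 1) else X (m div 4)))"
  \<comment> \<open>The last of the \<open>q + 1\<close> periods is not followed by an item, so one
    edge is missing from \<open>4 * (q + 1)\<close>.\<close>
  define r where "r = (\<lambda>p. if p = p0 then 4 * q + 3 else (1::nat))"
  have v0: "v p0 (4 * i) = Y i" "v p0 (4 * i + 1) = fr (2 * i)" "v p0 (4 * i + 2) = fr (2 * i + 1)" "v p0 (4 * i + 3) = X i" for i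
  proof -
    have "v p0 (4 * i + c) = (if c = 0 then Y i else if c = 1 then fr (2 * i) else if c = 2 then fr (2 * i + 1) else X i)"
      if "c < 4" for c
    proof -
      have dm: "(4 * i + c) div 4 = i" "(4 * i + c) mod 4 = c" using that by simp_all
      show ?thesis unfolding v_def dm using that by simp
    qed
    from this[of 0] this[of 1] this[of 2] this[of 3]
    show "v p0 (4 * i) = Y i" "v p0 (4 * i + 1) = fr (2 * i)" "v p0 (4 * i + 2) = fr (2 * i + 1)" "v p0 (4 * i + 3) = X i"
      by simp_all
  qed
  have v1: "v p 0 = fst p" "v p (Suc m) = snd p" if "p \<noteq> p0" for p m using that by (simp_all add: v_def)
  have itI: "its ! k \<in> I" if "k < q" for k using that its by (auto simp: q_def)
  have endsA: "fst p \<in> A" "snd p \<in> A" "fst p \<in> W" "snd p \<in> W" "fst p \<in> ends" "snd p \<in> ends" if "p \<in> P" for p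
    using that P by (auto simp: W_def ends_def)
  have XW: "X i \<in> W" "X i \<in> A" for i
    using itI[of i] IA endsA[OF p0] by (auto simp: X_def W_def)
  have Y_diag: "Y (Suc k) = fr (2 * q + 2 + k)" if "fst (its ! k) = snd (its ! k)" for k using that by (simp add: Y_def)
  have Y_off: "Y (Suc k) = snd (its ! k)" if "fst (its ! k) \<noteq> snd (its ! k)" for k using that by (simp add: Y_def)
  have YA: "Y i \<in> A \<and> (Y i \<in> W \<or> (\<exists>k<q. i = Suc k \<and> fst (its ! k) = snd (its ! k) \<and> Y i = fr (2 * q + 2 + k)))" if "i \<le> q" for i
  proof (cases i)
    case 0
    then show ?thesis using endsA[OF p0] by (simp add: Y_def)
  next
    case (Suc k)
    then have k: "k < q" using that by simp
    show ?thesis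
    proof (cases "fst (its ! k) = snd (its ! k)")
      case True
      then show ?thesis using Suc Y_diag frF[of "2 * q + 2 + k"] k by auto
    next
      case False
      then show ?thesis using Suc Y_off itI[OF k] IA by (auto simp: W_def)
    qed
  qed
  \<comment> \<open>The connecting letters only, without the fresh ends of items. As
    \<open>X\<close> and \<open>Y\<close> avoid \<open>U\<close>, the intersection with
    \<open>U\<close> reveals the place of an edge in the trail.\<close>
  define U where "U = fr ` {..<2 * q + 2}"
  have UF: "u \<in> A - W" if "u \<in> U" for u using that frF by (auto simp: U_def)
  have WU: "w \<notin> U" if "w \<in> W" for w using UF that by blast
  have frU: "fr i \<in> U \<longleftrightarrow> i < 2 * q + 2" if "i < 3 * q + 2" for i
    using fr_inj that by (auto simp: U_def image_iff)
  have XU: "X i \<notin> U" for i using WU XW by blast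
  have YU: "Y i \<notin> U" if "i \<le> q" for i using YA[OF that] WU frU by auto
  have pos: "\<exists>i c. m = 4 * i + c \<and> c < 4 \<and> i \<le> q \<and> (c = 3 \<longrightarrow> i < q)" if "m < 4 * q + 3" for m
    by (rule exI[of _ "m div 4"], rule exI[of _ "m mod 4"]) (use that in presburger)
  have XY: "X i \<noteq> Y (Suc i)" if "i < q" for i
    using YA[of "Suc i"] that XW[of i] frF[of "2 * q + 2 + i"] Y_off[of i]
    by (cases "fst (its ! i) = snd (its ! i)") (auto simp: X_def Y_diag)
  have nx: "v p0 (Suc (4 * i)) = fr (2 * i)" "v p0 (Suc (4 * i + 1)) = fr (2 * i + 1)" "v p0 (Suc (4 * i + 2)) = X i"
    "v p0 (Suc (4 * i + 3)) = Y (Suc i)" for i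
  proof -
    have e: "Suc (4 * i) = 4 * i + 1" "Suc (4 * i + 1) = 4 * i + 2" "Suc (4 * i + 2) = 4 * i + 3" "Suc (4 * i + 3) = 4 * Suc i"
      by simp_all
    show "v p0 (Suc (4 * i)) = fr (2 * i)" "v p0 (Suc (4 * i + 1)) = fr (2 * i + 1)" "v p0 (Suc (4 * i + 2)) = X i"
      "v p0 (Suc (4 * i + 3)) = Y (Suc i)"
      unfolding e v0 by (rule refl)+
  qed
  define ed where "ed = (\<lambda>p m. {v p m, v p (Suc m)})"
  have ed0: "ed p0 (4 * i) = {Y i, fr (2 * i)}" "ed p0 (4 * i + 1) = {fr (2 * i), fr (2 * i + 1)}"
    "ed p0 (4 * i + 2) = {fr (2 * i + 1), X i}" "ed p0 (4 * i + 3) = {X i, Y (Suc i)}" for i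
    unfolding ed_def v0 nx by (rule refl)+
  have edU: "ed p0 (4 * i) \<inter> U = {fr (2 * i)}" "ed p0 (4 * i + 1) \<inter> U = {fr (2 * i), fr (2 * i + 1)}"
    "ed p0 (4 * i + 2) \<inter> U = {fr (2 * i + 1)}" if "i \<le> q" for i
    unfolding ed0 using YU[OF that] XU[of i] frU[of "2 * i"] frU[of "2 * i + 1"] that by auto
  have edU3: "ed p0 (4 * i + 3) \<inter> U = {}" if "i < q" for i
    unfolding ed0 using YU[of "Suc i"] XU[of i] that by auto
  have ed1: "ed p 0 = {fst p, snd p}" if "p \<noteq> p0" for p unfolding ed_def using v1[OF that] by simp
  have item_ne: "{X i, Y (Suc i)} \<noteq> {fst p, snd p}" if "i < q" "p \<in> P" "p \<noteq> p0" for i p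
  proof (cases "fst (its ! i) = snd (its ! i)")
    case True
    then have "Y (Suc i) \<notin> {fst p, snd p}" using Y_diag frF[of "2 * q + 2 + i"] endsA[OF that(2)] that(1) by auto
    then show ?thesis by blast
  next
    case False
    then have "its ! i \<in> Ed" using itI[OF that(1)] by (auto simp: I_def)
    then have "{fst (its ! i), snd (its ! i)} \<noteq> {fst p, snd p}" using that by (auto simp: Ed_def split: prod.splits)
    then show ?thesis using False that(1) by (simp add: X_def Y_off)
  qed
  \<comment> \<open>An item that is a copy has a private fresh letter as its far end. Items that are
    edges differ as sets because \<open>Ed\<close> contains only one orientation.\<close>
  have item_inj: "i = j" if "i < q" "j < q" "{X i, Y (Suc i)} = {X j, Y (Suc j)}" for i j
  proof (cases "fst (its ! i) = snd (its ! i)")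
    case True
    then have "fr (2 * q + 2 + i) \<in> {X j, Y (Suc j)}" using that Y_diag[OF True] by auto
    moreover have "fr (2 * q + 2 + i) \<notin> W" using frF[of "2 * q + 2 + i"] that by auto
    ultimately have "fr (2 * q + 2 + i) = Y (Suc j)" using XW(1)[of j] by auto
    then have "\<exists>k<q. Suc j = Suc k \<and> fr (2 * q + 2 + i) = fr (2 * q + 2 + k)"
      using YA[of "Suc j"] \<open>fr (2 * q + 2 + i) \<notin> W\<close> that by auto
    then have "fr (2 * q + 2 + i) = fr (2 * q + 2 + j)" by simp
    then show ?thesis using fr_inj[of "2 * q + 2 + i" "2 * q + 2 + j"] that(1,2) by simp
  next
    case False
    have "\<not> fst (its ! j) = snd (its ! j)"
    proof
      assume t: "fst (its ! j) = snd (its ! j)"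
      have "fr (2 * q + 2 + j) \<in> {X i, Y (Suc i)}" using that Y_diag[OF t] by auto
      moreover have "X i \<in> W" "Y (Suc i) \<in> W" using XW itI[OF that(1)] Y_off[OF False] by (auto simp: W_def)
      ultimately have "fr (2 * q + 2 + j) \<in> W" by (metis insertE singletonD)
      then show False using frF[of "2 * q + 2 + j"] that(2) by simp
    qed
    then have "its ! i \<in> Ed" "its ! j \<in> Ed"
      using False itI[OF that(1)] itI[OF that(2)] by (auto simp: I_def)
    moreover have "{fst (its ! i), snd (its ! i)} = {fst (its ! j), snd (its ! j)}"
      using that False \<open>\<not> fst (its ! j) = snd (its ! j)\<close> by (simp add: X_def Y_off)
    ultimately have "its ! i = its ! j" by (auto simp: Ed_def doubleton_eq_iff split: prod.splits)
    then show ?thesis using its that by (simp add: q_def nth_eq_iff_index_eq)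
  qed
  have p0_inj: "m = m'" if m: "m < 4 * q + 3" "m' < 4 * q + 3" "ed p0 m = ed p0 m'" for m m'
  proof -
    obtain i c i' c' where ic: "m = 4 * i + c" "c < 4" "i \<le> q" "c = 3 \<longrightarrow> i < q"
      "m' = 4 * i' + c'" "c' < 4" "i' \<le> q" "c' = 3 \<longrightarrow> i' < q" using pos m by metis
    have D: "fr (2 * i) \<noteq> fr (2 * i' + 1)" "fr (2 * i + 1) \<noteq> fr (2 * i')" "fr (2 * i) \<noteq> fr (2 * i + 1)" "fr (2 * i') \<noteq> fr (2 * i' + 1)"
      "fr (2 * i) = fr (2 * i') \<longleftrightarrow> i = i'" "fr (2 * i + 1) = fr (2 * i' + 1) \<longleftrightarrow> i = i'"
    proof -
      have bnd: "2 * j < 3 * q + 2" "2 * j + 1 < 3 * q + 2" if "j \<le> q" for j using that by simp_all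
      have "fr (2 * j) \<noteq> fr (2 * k + 1)" if "j \<le> q" "k \<le> q" for j k
        using fr_inj[OF bnd(1)[OF that(1)] bnd(2)[OF that(2)]] by presburger
      then show "fr (2 * i) \<noteq> fr (2 * i' + 1)" "fr (2 * i + 1) \<noteq> fr (2 * i')" "fr (2 * i) \<noteq> fr (2 * i + 1)" "fr (2 * i') \<noteq> fr (2 * i' + 1)"
        using ic(3,7) by metis+
      show "fr (2 * i) = fr (2 * i') \<longleftrightarrow> i = i'" "fr (2 * i + 1) = fr (2 * i' + 1) \<longleftrightarrow> i = i'"
        using fr_inj[OF bnd(1)[OF ic(3)] bnd(1)[OF ic(7)]] fr_inj[OF bnd(2)[OF ic(3)] bnd(2)[OF ic(7)]] by simp_all
    qed
    have cc: "c = 0 \<or> c = 1 \<or> c = 2 \<or> c = 3" "c' = 0 \<or> c' = 1 \<or> c' = 2 \<or> c' = 3" using ic by auto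
    have eU: "ed p0 m \<inter> U = ed p0 m' \<inter> U" using m by simp
    have lv: "ed p0 m \<inter> U = (if c = 0 then {fr (2 * i)} else if c = 1 then {fr (2 * i), fr (2 * i + 1)} else if c = 2 then {fr (2 * i + 1)} else {})"
      using cc(1) ic edU[of i] edU3[of i] by auto
    have lv': "ed p0 m' \<inter> U = (if c' = 0 then {fr (2 * i')} else if c' = 1 then {fr (2 * i'), fr (2 * i' + 1)} else if c' = 2 then {fr (2 * i' + 1)} else {})"
      using cc(2) ic edU[of i'] edU3[of i'] by auto
    have "c = c' \<and> (c \<noteq> 3 \<longrightarrow> i = i')"
      using code_inject[OF eU[unfolded lv lv'] ic(2,6) D(1-4)] D(5,6) by blast
    moreover have "i = i'" if "c = 3" "c' = 3"
      using item_inj[of i i'] m(3) ic that by (simp add: ed0)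
    ultimately show ?thesis using ic by auto
  qed
  have p0_other: False if m: "m < 4 * q + 3" "p \<in> P" "p \<noteq> p0" "ed p0 m = {fst p, snd p}" for m p
  proof -
    obtain i c where ic: "m = 4 * i + c" "c < 4" "i \<le> q" "c = 3 \<longrightarrow> i < q" using pos m by metis
    have "ed p0 m \<inter> U = {}" using m endsA[OF m(2)] WU by auto
    then have "c = 3" using ic edU[of i] by (cases "c = 0"; cases "c = 1"; cases "c = 2") auto
    then show False using item_ne[of i p] ic m by (simp add: ed0)
  qed
  have T: "trails (Hub A) P v r"
  proof
    show "wf_label (Hub A)" "matching P" using A P by simp_all
    show "0 < r p" for p by (simp add: r_def)
    show "v p 0 = fst p" for p using v0(1)[of 0] by (cases "p = p0") (simp_all add: v1 Y_def)
    show "v p (r p) = snd p" for p using v0(4)[of q] by (cases "p = p0") (simp_all add: v1 r_def X_def)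
    show "v p m \<in> letters (Hub A)" if "p \<in> P" "m \<le> r p" for p m
    proof (cases "p = p0")
      case True
      have "m div 4 \<le> q" using that True by (simp add: r_def)
      moreover from this have "2 * (m div 4) + 1 < 3 * q + 2" by linarith
      ultimately have "m div 4 \<le> q" "2 * (m div 4) + 1 < 3 * q + 2" .
      then show ?thesis using True YA[of "m div 4"] XW(2) frF[of "2 * (m div 4)"] frF[of "2 * (m div 4) + 1"]
        by (simp add: v_def)
    next
      case False
      then show ?thesis using endsA that by (simp add: v_def)
    qed
    show "v p m \<noteq> v p (Suc m)" if "p \<in> P" "m < r p" for p m
    proof (cases "p = p0")
      case True
      then have "m < 4 * q + 3" using that by (simp add: r_def)
      then obtain i c where ic: "m = 4 * i + c" "c < 4" "i \<le> q" "c = 3 \<longrightarrow> i < q" using pos by metis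
      then have "c = 0 \<or> c = 1 \<or> c = 2 \<or> c = 3" by auto
      then show ?thesis
      proof (elim disjE)
        assume "c = 0"
        then show ?thesis using True ic v0(1)[of i] nx(1)[of i] YU[of i] frU[of "2 * i"] by auto
      next
        assume "c = 1"
        then show ?thesis using True ic v0(2)[of i] nx(2)[of i] fr_inj[of "2 * i" "2 * i + 1"] by auto
      next
        assume "c = 2"
        then show ?thesis using True ic v0(3)[of i] nx(3)[of i] XU[of i] frU[of "2 * i + 1"] by auto
      next
        assume "c = 3"
        then show ?thesis using True ic v0(4)[of i] nx(4)[of i] XY[of i] by auto
      qed
    next
      case False
      then have "m = 0" using that by (simp add: r_def)
      then show ?thesis using False v1[of p] that P(2) unfolding matching_def by auto
    qed
    show "p = p' \<and> m = m'"
      if e: "p \<in> P" "p' \<in> P" "m < r p" "m' < r p'" "{v p m, v p (Suc m)} = {v p' m', v p' (Suc m')}" for p p' m m'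
    proof -
      have eq: "ed p m = ed p' m'" using e by (simp add: ed_def)
      show ?thesis
      proof (cases "p = p0"; cases "p' = p0")
        assume "p = p0" "p' = p0"
        then show ?thesis using p0_inj[of m m'] e eq by (simp add: r_def)
      next
        assume a: "p = p0" "p' \<noteq> p0"
        then have "m' = 0" using e by (simp add: r_def)
        then show ?thesis using p0_other[of m p'] a e eq ed1[of p'] by (simp add: r_def)
      next
        assume a: "p \<noteq> p0" "p' = p0"
        then have "m = 0" using e by (simp add: r_def)
        then show ?thesis using p0_other[of m' p] a e eq ed1[of p] by (simp add: r_def)
      next
        assume a: "p \<noteq> p0" "p' \<noteq> p0"
        then have "m = 0" "m' = 0" using e by (simp_all add: r_def)
        moreover have "p = p'"
        proof (rule ccontr)
          assume "p \<noteq> p'"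
          then have "{fst p, snd p} \<inter> {fst p', snd p'} = {}" using P(2) e unfolding matching_def by blast
          then show False using eq ed1 a \<open>m = 0\<close> \<open>m' = 0\<close> by auto
        qed
        ultimately show ?thesis by simp
      qed
    qed
  qed
  interpret trails "Hub A" P v r by (rule T)
  have M: "\<exists>p\<in>P. \<exists>m<r p. {v p m, v p (Suc m)} = {i, j}" if ij: "i \<in> A" "j \<in> A" "i < j" "mid_open i j \<inter> S \<noteq> {}" for i j
  proof (cases "\<exists>p\<in>P - {p0}. {i, j} = {fst p, snd p}")
    case True
    then obtain p where p: "p \<in> P" "p \<noteq> p0" "{i, j} = {fst p, snd p}" by blast
    then show ?thesis using ed1[of p] by (intro bexI[of _ p] exI[of _ 0]) (auto simp: ed_def r_def)
  next
    case False
    then have "(i, j) \<in> I" using ij by (auto simp: I_def Ed_def)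
    then obtain k where k: "k < q" "its ! k = (i, j)" using its by (metis in_set_conv_nth q_def)
    then have "ed p0 (4 * k + 3) = {i, j}" using ij Y_off[of k] by (simp add: ed0 X_def)
    then show ?thesis using k p0 by (intro bexI[of _ p0] exI[of _ "4 * k + 3"]) (auto simp: ed_def r_def)
  qed
  have M': "\<exists>p\<in>P. \<exists>m<r p. {v p m, v p (Suc m)} = {i, j}" if ij: "i \<in> A" "j \<in> A" "i \<noteq> j" "mid_open i j \<inter> S \<noteq> {}" for i j
  proof (cases "i < j")
    case True
    then show ?thesis using M ij by blast
  next
    case False
    have "mid_open i j \<subseteq> mid_open j i"
    proof
      fix y assume "y \<in> mid_open i j"
      then obtain s where "1/3 < s" "s < 2/3" "y = segpt i j s" by (auto simp: mid_open_def)
      then have "y = segpt j i (1 - s)" "1 - s \<in> {1/3<..<2/3}" using segpt_swap[of i j s] by auto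
      then show "y \<in> mid_open j i" by (auto simp: mid_open_def)
    qed
    then show ?thesis using M[of j i] ij False by (auto simp: insert_commute)
  qed
  \<comment> \<open>The ends of the direct trails are disjoint, so all of them together pass a copy
    at most once.\<close>
  have uniq1: "p = p' \<and> m = m'" if "p \<in> P" "p' \<in> P" "p \<noteq> p0" "p' \<noteq> p0" "m \<le> r p" "m' \<le> r p'" "v p m = v p' m'" for p p' m m'
  proof -
    have vm: "v p m = (if m = 0 then fst p else snd p)" "v p' m' = (if m' = 0 then fst p' else snd p')" using that by (simp_all add: v_def)
    note eq = that(7)[unfolded vm]
    have "p = p'"
      using eq fst_eq[OF that(1,2)] snd_eq[OF that(1,2)] fst_snd[OF that(1,2)] fst_snd[OF that(2,1)]
      by (cases "m = 0"; cases "m' = 0") simp_all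
    moreover have "m \<le> 1" "m' \<le> 1" using that by (simp_all add: r_def)
    ultimately show ?thesis using eq fst_snd[OF that(1,1)] by (cases "m = 0"; cases "m' = 0") auto
  qed
  \<comment> \<open>The \<open>4 * q + 4\<close> positions of the long trail and one pass of a
    direct trail: this is again the budget that was granted to \<open>P\<close>.\<close>
  have card_pass: "card (pass k) \<le> 4 * N + 5" for k
  proof -
    define Z where "Z = {(inn p m, out p m) | p m. p \<in> P \<and> p \<noteq> p0 \<and> m \<le> r p \<and> v p m = k}"
    have "card Z \<le> 1 \<and> finite Z"
    proof (cases "Z = {}")
      case False
      then obtain p m where pm: "p \<in> P" "p \<noteq> p0" "m \<le> r p" "v p m = k" unfolding Z_def by blast
      then have "Z \<subseteq> {(inn p m, out p m)}" unfolding Z_def using uniq1 by blast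
      then show ?thesis using card_mono[of "{(inn p m, out p m)}" Z] finite_subset by auto
    qed auto
    moreover have sub: "pass k \<subseteq> (\<lambda>m. (inn p0 m, out p0 m)) ` {..4 * q + 3} \<union> Z"
    proof
      fix w assume "w \<in> pass k"
      then obtain p m where pm: "w = (inn p m, out p m)" "p \<in> P" "m \<le> r p" "v p m = k"
        unfolding pass_def by blast
      show "w \<in> (\<lambda>m. (inn p0 m, out p0 m)) ` {..4 * q + 3} \<union> Z"
      proof (cases "p = p0")
        case True
        then show ?thesis using pm by (simp add: r_def)
      next
        case False
        then show ?thesis using pm unfolding Z_def by blast
      qed
    qed
    moreover have "card ((\<lambda>m. (inn p0 m, out p0 m)) ` {..4 * q + 3}) \<le> 4 * q + 4"
      using card_image_le[of "{..4 * q + 3}" "\<lambda>m. (inn p0 m, out p0 m)"] by simp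
    ultimately have "card (pass k) \<le> 4 * q + 4 + 1"
      using card_mono[OF _ sub] card_Un_le[of "(\<lambda>m. (inn p0 m, out p0 m)) ` {..4 * q + 3}" Z] by fastforce
    then show ?thesis using q by simp
  qed
  have ex_pass: "\<exists>p\<in>P. \<exists>m\<le>r p. v p m = k" if k: "k \<in> A" "preim (Hub A) k S \<noteq> {}" for k
  proof (cases "k \<in> ends")
    case True
    then obtain p where "p \<in> P" "k = fst p \<or> k = snd p" by (auto simp: ends_def)
    then show ?thesis using v_first[of p] v_last[of p] by (metis le0 order_refl)
  next
    case False
    then have "(k, k) \<in> I" using k by (auto simp: I_def K_def)
    then obtain i where "i < q" "its ! i = (k, k)" using its by (metis in_set_conv_nth q_def)
    then show ?thesis using v0(4)[of i] p0 by (intro bexI[of _ p0] exI[of _ "4 * i + 3"]) (auto simp: X_def r_def)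
  qed
  \<comment> \<open>Without points on edges all items are copies that are not named by ends. So the
    long trail meets a copy containing a point only at its item or at its own end, and the copy is
    passed just once, as \<open>linked_vert\<close> requires.\<close>
  have uniq: "p = p' \<and> m = m'" if noe: "\<And>i j. i \<noteq> j \<Longrightarrow> mid_open i j \<inter> S = {}"
    and k: "preim (Hub A) k S \<noteq> {}" "k \<in> A" and pm: "p \<in> P" "p' \<in> P" "m \<le> r p" "m' \<le> r p'" "v p m = k" "v p' m' = k" for k p p' m m'
  proof -
    have "Ed = {}" using noe by (auto simp: Ed_def)
    then have diag: "fst (its ! i) = snd (its ! i) \<and> fst (its ! i) \<in> K" if "i < q" for i
      using itI[OF that] by (auto simp: I_def)
    have kW: "k \<in> W" using k by (cases "k \<in> ends") (force simp: W_def I_def K_def)+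
    have P0: "(m = 0 \<and> k = fst p0) \<or> (m = 4 * q + 3 \<and> k = snd p0) \<or> (\<exists>i<q. m = 4 * i + 3 \<and> k = fst (its ! i) \<and> k \<notin> ends)"
      if m: "m \<le> 4 * q + 3" "v p0 m = k" for m
    proof (cases "m = 4 * q + 3")
      case True
      then show ?thesis using m v0(4)[of q] by (simp add: X_def)
    next
      case False
      then have "m < 4 * q + 3" using m by simp
      then obtain i c where ic: "m = 4 * i + c" "c < 4" "i \<le> q" "c = 3 \<longrightarrow> i < q" using pos by metis
      then have "c = 0 \<or> c = 1 \<or> c = 2 \<or> c = 3" by auto
      then show ?thesis
      proof (elim disjE)
        assume "c = 0"
        then have Yk: "Y i = k" using ic m v0(1)[of i] by simp
        show ?thesis
        proof (cases i)
          case 0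
          then show ?thesis using Yk ic \<open>c = 0\<close> by (simp add: Y_def)
        next
          case (Suc a)
          then have "k = fr (2 * q + 2 + a)" using Yk Y_diag[of a] diag[of a] ic by simp
          then show ?thesis using kW frF[of "2 * q + 2 + a"] Suc ic by auto
        qed
      next
        assume "c = 1"
        then show ?thesis using ic m v0(2)[of i] kW frF[of "2 * i"] by auto
      next
        assume "c = 2"
        then show ?thesis using ic m v0(3)[of i] kW frF[of "2 * i + 1"] by auto
      next
        assume "c = 3"
        then have "i < q" "k = fst (its ! i)" using ic m v0(4)[of i] by (simp_all add: X_def)
        then show ?thesis using diag[of i] ic \<open>c = 3\<close> by (auto simp: K_def)
      qed
    qed
    have same: "m = m'" if m: "m \<le> 4 * q + 3" "v p0 m = k" "m' \<le> 4 * q + 3" "v p0 m' = k" for m m'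
    proof -
      have ne: "fst p0 \<noteq> snd p0" using fst_snd p0 by blast
      have idx: "i = j" if "i < q" "j < q" "fst (its ! i) = fst (its ! j)" for i j
      proof -
        have "its ! i = its ! j" using diag[of i] diag[of j] that by (intro prod_eqI) auto
        then show ?thesis using its that by (simp add: q_def nth_eq_iff_index_eq)
      qed
      from P0[OF m(1,2)] P0[OF m(3,4)] show ?thesis
        using ne endsA[OF p0] idx by (elim disjE exE conjE) auto
    qed
    have cross: False if a: "p \<in> P" "p \<noteq> p0" "m \<le> r p" "v p m = k" "m' \<le> 4 * q + 3" "v p0 m' = k" for p m m'
    proof -
      have "k = fst p \<or> k = snd p" using a by (auto simp: v_def split: if_splits)
      then show False using P0[OF a(5,6)] endsA[OF a(1)] fst_eq[OF a(1) p0] snd_eq[OF a(1) p0] fst_snd[OF a(1) p0] fst_snd[OF p0 a(1)] a(2)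
        by auto
    qed
    show ?thesis
      using same[of m m'] uniq1[of p p' m m'] cross[of p m m'] cross[of p' m' m] pm
      by (cases "p = p0"; cases "p' = p0") (auto simp: r_def)
  qed
  show ?thesis
  proof (intro exI[of _ v] exI[of _ r] conjI T ballI impI card_pass)
    show "\<exists>p\<in>P. \<exists>q<r p. {v p q, v p (Suc q)} = {i, j}" if "i \<in> A" "j \<in> A" "i \<noteq> j" "mid_open i j \<inter> S \<noteq> {}" for i j
      using M' that by blast
    fix k assume k: "k \<in> A" "preim (Hub A) k S \<noteq> {}"
    then obtain p m where pm: "p \<in> P" "m \<le> r p" "v p m = k" using ex_pass by blast
    then have mem: "(inn p m, out p m) \<in> pass k" unfolding pass_def mem_Collect_eq by blast
    then show "pass k \<noteq> {}" by blast
    assume "\<forall>i j. i \<noteq> j \<longrightarrow> mid_open i j \<inter> S = {}"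
    then have "pass k \<subseteq> {(inn p m, out p m)}"
      unfolding pass_def using uniq[of k _ p _ m] k pm by blast
    then show "\<exists>x. pass k = {x}" using mem by blast
  qed
qed

lemma vert_mid_open:
  assumes "y \<in> vert l" "i \<noteq> j" shows "y \<notin> mid_open i j"
proof -
  have "in_vert l y" using assms by (simp add: vert_def)
  then show ?thesis
  proof cases
    case (sub k z)
    then show ?thesis using mid_open_not_shrink[of y i j z k] assms by blast
  qed
qed

text \<open>In the induction the pairs of a copy are the passes through it. At level 0 many pairs
  may still compete for one vertex; routing once more leaves the copy that contains it with a single
  pass, and all other copies without a point.\<close>

lemma linked_hub_good:
  assumes A: "finite A" "20 * N + 20 \<le> card A"
  shows "\<lbrakk>good m (Hub A) S; finite S; card S \<le> N; S \<subseteq> cell (Hub A); P \<subseteq> A \<times> A; matching P; P \<noteq> {};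
     card P \<le> 4 * N + 5\<rbrakk> \<Longrightarrow> linked (Hub A) P S"
proof (induction m arbitrary: S P)
  case 0
  show ?case
  proof (cases "S = {}")
    case True
    then show ?thesis using linked_empty[of "Hub A" P] 0 A by simp
  next
    case False
    obtain x where "S \<subseteq> {x}" "S \<subseteq> vert (Hub A)" using 0(1) by auto
    then have x: "S = {x}" "x \<in> vert (Hub A)" using False by blast+
    have noe: "\<forall>i j. i \<noteq> j \<longrightarrow> mid_open i j \<inter> S = {}" using vert_mid_open x by auto
    obtain v r where vr: "trails (Hub A) P v r"
      "\<And>i j. i \<in> A \<Longrightarrow> j \<in> A \<Longrightarrow> i \<noteq> j \<Longrightarrow> mid_open i j \<inter> S \<noteq> {} \<Longrightarrow> \<exists>p\<in>P. \<exists>q<r p. {v p q, v p (Suc q)} = {i, j}"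
      "\<And>k. k \<in> A \<Longrightarrow> preim (Hub A) k S \<noteq> {} \<Longrightarrow> \<exists>x. trails.pass P v r k = {x}"
      using hub_routing[OF A 0(5-8) 0(2-4)] noe by metis
    interpret trails "Hub A" P v r by (rule vr)
    show ?thesis
    proof (rule linked)
      show "linked (child (Hub A) k) (pass k) {y \<in> cell (child (Hub A) k). shrink k y \<in> S}" if k: "k \<in> letters (Hub A)" for k
      proof (cases "preim (Hub A) k S = {}")
        case True
        then have "linked (Hub A) (pass k) (preim (Hub A) k S)"
          using linked_empty[of "Hub A" "pass k"] matching_pass pass_letters A by simp
        then show ?thesis by (simp add: preim_def)
      next
        case False
        then obtain ab' where "pass k = {ab'}" using vr(3)[of k] k by auto
        then obtain a b where ab: "pass k = {(a, b)}" by (metis surj_pair)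
        have "good 0 (Hub A) (preim (Hub A) k S)" using good_preim_0[OF 0(1), of k] by simp
        then obtain x' where "preim (Hub A) k S \<subseteq> {x'}" "preim (Hub A) k S \<subseteq> vert (Hub A)" by auto
        then have x': "preim (Hub A) k S = {x'}" "x' \<in> vert (Hub A)" using False by blast+
        have "linked (Hub A) {(a, b)} {x'}"
          using linked_vert[of "Hub A" a b x'] A x' pass_letters[of k] matching_pass[of k] ab by (simp add: matching_def)
        then have "linked (Hub A) (pass k) (preim (Hub A) k S)" unfolding ab x'(1) .
        then show ?thesis by (simp add: preim_def)
      qed
    qed (use vr(2) 0 in auto)
  qed
next
  case (Suc m)
  obtain v r where vr: "trails (Hub A) P v r"
    "\<And>i j. i \<in> A \<Longrightarrow> j \<in> A \<Longrightarrow> i \<noteq> j \<Longrightarrow> mid_open i j \<inter> S \<noteq> {} \<Longrightarrow> \<exists>p\<in>P. \<exists>q<r p. {v p q, v p (Suc q)} = {i, j}"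
    "\<And>k. k \<in> A \<Longrightarrow> card (trails.pass P v r k) \<le> 4 * N + 5"
    "\<And>k. k \<in> A \<Longrightarrow> preim (Hub A) k S \<noteq> {} \<Longrightarrow> trails.pass P v r k \<noteq> {}"
    using hub_routing[OF A Suc.prems(5-8) Suc.prems(2-4)] by metis
  interpret trails "Hub A" P v r by (rule vr)
  show ?case
  proof (rule linked)
    show "linked (child (Hub A) k) (pass k) {y \<in> cell (child (Hub A) k). shrink k y \<in> S}" if k: "k \<in> letters (Hub A)" for k
    proof (cases "preim (Hub A) k S = {}")
      case True
      then have "linked (Hub A) (pass k) (preim (Hub A) k S)"
        using linked_empty[of "Hub A" "pass k"] matching_pass pass_letters A by simp
      then show ?thesis by (simp add: preim_def)
    next
      case False
      have "linked (Hub A) (pass k) (preim (Hub A) k S)"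
      proof (rule Suc.IH)
        show "good m (Hub A) (preim (Hub A) k S)" using Suc.prems(1) k by auto
        show "finite (preim (Hub A) k S)" using preim_finite Suc.prems by blast
        show "card (preim (Hub A) k S) \<le> N" using preim_card[of S "Hub A" k] Suc.prems by simp
        show "preim (Hub A) k S \<subseteq> cell (Hub A)" using preim_cell[of "Hub A" k S] by simp
      qed (use vr k False matching_pass pass_letters in auto)
      then show ?thesis by (simp add: preim_def)
    qed
  qed (use vr(2) Suc.prems in auto)
qed

theorem linked_hub:
  assumes "finite A" "20 * N + 20 \<le> card A" "finite S" "card S \<le> N" "S \<subseteq> cell (Hub A)"
    "P \<subseteq> A \<times> A" "matching P" "P \<noteq> {}" "card P \<le> 4 * N + 5"
  shows "linked (Hub A) P S"
  using ex_good[of "Hub A" S] linked_hub_good[OF assms(1,2)] assms by (metis wf_label.simps(1))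

text \<open>Labels with two letters, whose corners form the only pair to be linked.
  \<open>Hub {a, b}\<close> is a straight segment. A chain is traversed from corner 1 to corner 0,
  at which its hubs accumulate.\<close>

definition linear :: "nat \<Rightarrow> label \<Rightarrow> nat \<Rightarrow> nat \<Rightarrow> bool" where
  "linear N l a b \<longleftrightarrow> a \<noteq> b \<and> (l = Hub {a, b} \<or>
     (\<exists>B. l = Chain B \<and> a = 1 \<and> b = 0 \<and> wf_label l \<and> (\<forall>s. 20 * N + 20 \<le> card (B s))))"

text \<open>With two letters the trail is a single edge, and each copy is again passed from its
  corner \<open>a\<close> to its corner \<open>b\<close>. The copies are linear themselves, except
  for the copy 1 of a chain: it is a hub, to which \<open>linked_hub\<close> applies with one
  pair.\<close>

lemma linked_linear_good:
  "\<lbrakk>good m l S; linear N l a b; finite S; card S \<le> N; S \<subseteq> cell l\<rbrakk> \<Longrightarrow> linked l {(a, b)} S"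
proof (induction m arbitrary: l S)
  case 0
  have l: "wf_label l" "letters l = {a, b}" "a \<noteq> b" using 0(2) by (auto simp: linear_def)
  then show ?case
  proof (cases "S = {}")
    case True
    then show ?thesis using l by (auto simp: matching_def intro!: linked_empty)
  next
    case False
    obtain x where "S \<subseteq> {x}" "S \<subseteq> vert l" using 0(1) by auto
    then have "S = {x}" "x \<in> vert l" using False by blast+
    then show ?thesis using l by (auto intro!: linked_vert)
  qed
next
  case (Suc m)
  have l: "wf_label l" "letters l = {a, b}" "a \<noteq> b" using Suc(3) by (auto simp: linear_def)
  define v where "v = (\<lambda>(p :: nat \<times> nat) (m :: nat). if m = 0 then a else b)"
  define r where "r = (\<lambda>p :: nat \<times> nat. 1 :: nat)"
  interpret trails l "{(a, b)}" v r
    by unfold_locales (use l in \<open>auto simp: v_def r_def matching_def\<close>)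
  have pass: "pass k = {(a, b)}" if "k \<in> {a, b}" for k
  proof -
    have io: "inn (a, b) m = a" "out (a, b) m = b" if "m \<le> 1" for m
      unfolding inn_def out_def using that by (auto simp: v_def r_def)
    have "pass k \<subseteq> {(a, b)}"
    proof
      fix w assume "w \<in> pass k"
      then obtain m where "m \<le> r (a, b)" "w = (inn (a, b) m, out (a, b) m)"
        unfolding pass_def by blast
      then show "w \<in> {(a, b)}" using io[of m] by (simp add: r_def)
    qed
    moreover have "\<exists>m\<le>1. v (a, b) m = k"
      using that by (intro exI[of _ "if k = a then 0 else 1"]) (auto simp: v_def)
    then obtain m where m: "m \<le> 1" "v (a, b) m = k" by blast
    then have "(inn (a, b) m, out (a, b) m) \<in> pass k"
      unfolding pass_def mem_Collect_eq by (intro exI[of _ "(a, b)"] exI[of _ m]) (simp add: r_def)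
    then have "(a, b) \<in> pass k" using io[OF m(1)] by simp
    ultimately show ?thesis by blast
  qed
  show ?case
  proof (rule linked)
    show "linked (child l k) (pass k) {y \<in> cell (child l k). shrink k y \<in> S}" if k: "k \<in> letters l" for k
    proof -
      have props: "good m (child l k) (preim l k S)" "finite (preim l k S)" "card (preim l k S) \<le> N" "preim l k S \<subseteq> cell (child l k)"
        using Suc.prems k preim_finite preim_card[of S l k] preim_cell[of l k S] by auto
      have "linked (child l k) {(a, b)} (preim l k S)"
      proof (cases "linear N (child l k) a b")
        case True
        then show ?thesis using Suc.IH props by blast
      next
        case False
        then obtain B where B: "l = Chain B" "a = 1" "b = 0" "wf_label l" "\<forall>s. 20 * N + 20 \<le> card (B s)" "k = 1"
          using Suc.prems(2) k by (auto simp: linear_def)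
        then show ?thesis using linked_hub[of "B 0" N "preim l k S" "{(1, 0)}"] props
          by (auto simp: matching_def)
      qed
      then show ?thesis using pass k l by (simp add: preim_def)
    qed
    show "S \<subseteq> cell l" by (rule Suc.prems)
    show "\<exists>p\<in>{(a, b)}. \<exists>q<r p. {v p q, v p (Suc q)} = {i, j}" if "i \<in> letters l" "j \<in> letters l" "i \<noteq> j" for i j
      using that l by (auto simp: v_def r_def)
  qed
qed

theorem linked_linear:
  assumes "linear N l a b" "finite S" "card S \<le> N" "S \<subseteq> cell l"
  shows "linked l {(a, b)} S"
proof -
  have "wf_label l" using assms(1) by (auto simp: linear_def)
  then show ?thesis using ex_good[of l S] linked_linear_good assms by blast
qed

section \<open>Edges and the graph-like structure\<close>

text \<open>Inductive, in contrast to the cells, because every edge appears at a finite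
  depth.\<close>

inductive edge :: "label \<Rightarrow> (nat \<Rightarrow> real) set \<Rightarrow> bool" where
  mid: "\<lbrakk>i \<in> letters l; j \<in> letters l; i \<noteq> j\<rbrakk> \<Longrightarrow> edge l (mid_open i j)"
| sub: "\<lbrakk>i \<in> letters l; edge (child l i) E\<rbrakk> \<Longrightarrow> edge l (shrink i ` E)"

text \<open>What remains of the cell outside the copy \<open>i\<close>. The closed edges make it a
  closed set, which touches the copy in corners only (\<open>shrink_rest\<close>).\<close>

definition rest :: "label \<Rightarrow> nat \<Rightarrow> (nat \<Rightarrow> real) set" where
  "rest l i = (\<Union>k\<in>letters l - {i}. shrink k ` cell (child l k)) \<union>
     (\<Union>a\<in>letters l. \<Union>b\<in>letters l - {a}. mid_closed a b)"

lemma closed_shrink_image: "compact S \<Longrightarrow> closed (shrink i ` S)"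
  by (intro compact_imp_closed compact_continuous_image continuous_shrink)

lemma closed_rest:
  assumes "wf_label l" shows "closed (rest l i)"
proof -
  have "closed (shrink k ` cell (child l k))" for k
    using assms by (intro closed_shrink_image compact_cell) simp
  moreover have "closed (\<Union>b\<in>letters l - {a}. mid_closed a b)" for a
    using assms by (intro closed_UN) (simp_all add: mid_closed_closed)
  ultimately show ?thesis unfolding rest_def using assms by (intro closed_Un closed_UN) simp_all
qed

lemma mid_closed_cell: "wf_label l \<Longrightarrow> a \<in> letters l \<Longrightarrow> b \<in> letters l \<Longrightarrow> mid_closed a b \<subseteq> cell l"
  unfolding mid_closed_def using segpt_cell[of l a b] by auto

lemma cell_split:
  assumes "wf_label l" "i \<in> letters l"
  shows "cell l = shrink i ` cell (child l i) \<union> rest l i"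
proof
  show "cell l \<subseteq> shrink i ` cell (child l i) \<union> rest l i"
  proof
    fix y assume "y \<in> cell l"
    then have "in_cell l y" by (simp add: cell_def)
    then show "y \<in> shrink i ` cell (child l i) \<union> rest l i"
    proof cases
      case (mid a b s)
      then have "y \<in> mid_closed a b" by (auto simp: mid_closed_def)
      then have "y \<in> rest l i" unfolding rest_def using mid by blast
      then show ?thesis by blast
    next
      case (sub k z)
      then have "y \<in> shrink k ` cell (child l k)" by (simp add: cell_def)
      then show ?thesis unfolding rest_def using sub(2) by (cases "k = i") auto
    qed
  qed
  have "shrink k ` cell (child l k) \<subseteq> cell l" if "k \<in> letters l" for k
    using shrink_cellI that by blast
  moreover have "mid_closed a b \<subseteq> cell l" if "a \<in> letters l" "b \<in> letters l" for a b
    using mid_closed_cell assms(1) that by blast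
  ultimately show "shrink i ` cell (child l i) \<union> rest l i \<subseteq> cell l"
    unfolding rest_def using assms(2) by fast
qed

lemma shrink_rest:
  assumes "z \<in> region" "shrink i z \<in> rest l i"
  shows "\<exists>j\<in>letters l. z = corner j"
proof -
  consider k y where "k \<noteq> i" "y \<in> cell (child l k)" "shrink i z = shrink k y"
    | a b where "a \<in> letters l" "b \<in> letters l" "a \<noteq> b" "shrink i z \<in> mid_closed a b"
    using assms(2) unfolding rest_def by blast
  then show ?thesis
  proof cases
    case (1 k y)
    then show ?thesis using shrink_eq_shrink[of i z k y] assms(1) cell_region by blast
  next
    case (2 a b)
    then show ?thesis using mid_closed_shrink[of i z a b] assms(1) by blast
  qed
qed

lemma edge_region: "edge l E \<Longrightarrow> E \<subseteq> region"
proof (induction rule: edge.induct)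
  case (mid i l j)
  then show ?case using mid_subset mid_closed_region by blast
next
  case (sub i l E)
  then show ?case using shrink_region by blast
qed

text \<open>Copies and cells are glued at corners; an edge that avoids them stays open after
  gluing.\<close>

lemma edge_corner: "edge l E \<Longrightarrow> corner c \<notin> E"
proof (induction arbitrary: c rule: edge.induct)
  case (mid i l j)
  then show ?case using mid_open_not_shrink[of "corner c" i j "corner c" c] corner_eq_shrink[of c] by auto
next
  case (sub i l E)
  show ?case
  proof
    assume "corner c \<in> shrink i ` E"
    then obtain y where "y \<in> E" "corner c = shrink i y" by blast
    then show False using corner_eq_shrinkD[of c i y] edge_region[OF sub(2)] sub.IH by blast
  qed
qed

lemma edge_subset: "edge l E \<Longrightarrow> wf_label l \<Longrightarrow> E \<subseteq> cell l"
proof (induction rule: edge.induct)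
  case (mid i l j)
  then show ?case using mid_subset mid_closed_cell by blast
next
  case (sub i l E)
  then show ?case using shrink_cellI by fastforce
qed

text \<open>Openness of the edge, phrased by its complement because closed sets can be glued: the
  complement in the larger cell is the shrunken complement together with
  \<open>rest\<close>.\<close>

lemma edge_closed: "edge l E \<Longrightarrow> wf_label l \<Longrightarrow> closed (cell l - E)"
proof (induction rule: edge.induct)
  case (mid i l j)
  \<comment> \<open>Two open coordinate conditions single out the edge, since in a copy every
    coordinate is at most \<open>1/3\<close> or at least \<open>2/3\<close>.\<close>
  have "mid_open i j = cell l \<inter> {y. 1/3 < y i \<and> y i < 2/3 \<and> 1/3 < y j \<and> y j < 2/3}" (is "_ = _ \<inter> ?G")
  proof
    show "mid_open i j \<subseteq> cell l \<inter> ?G"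
      using mid edge_subset[OF edge.mid[OF mid(1,2,3)]] segpt_eval(1,2)[OF mid(3)] by (auto simp: mid_open_def)
    show "cell l \<inter> ?G \<subseteq> mid_open i j"
    proof
      fix y assume y: "y \<in> cell l \<inter> ?G"
      then have "in_cell l y" by (simp add: cell_def)
      then show "y \<in> mid_open i j"
      proof cases
        case (mid a b s)
        have "y i \<noteq> 0" "y j \<noteq> 0" using y by auto
        then have "i \<in> {a, b}" "j \<in> {a, b}" using segpt_eval(3)[of _ a b s] mid by blast+
        then have "(a = i \<and> b = j) \<or> (a = j \<and> b = i)" using \<open>i \<noteq> j\<close> by auto
        then show ?thesis
        proof
          assume "a = i \<and> b = j"
          then show ?thesis using mid by (auto simp: mid_open_def)
        next
          assume ab: "a = j \<and> b = i"
          then have "y = segpt i j (1 - s)" "1 - s \<in> {1/3<..<2/3}" using mid segpt_swap[of j i s] by auto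
          then show ?thesis by (auto simp: mid_open_def)
        qed
      next
        case (sub k z)
        have "2/3 \<le> y k" using shrink_ge sub by blast
        then have "k \<noteq> i" using y by auto
        then have "y i \<le> 1/3" using shrink_le[of z i k] sub by auto
        then show ?thesis using y by auto
      qed
    qed
  qed
  then have "cell l - mid_open i j = cell l - ?G" by blast
  moreover have "open ?G"
    by (intro open_Collect_conj open_Collect_less continuous_intros continuous_coordinate)
  ultimately show ?case using closed_cell[OF mid(4)] by (simp add: closed_Diff)
next
  case (sub i l E)
  have E: "E \<subseteq> cell (child l i)" "E \<subseteq> region" using edge_subset[OF sub(2)] edge_region[OF sub(2)] sub(4) by auto
  have "shrink i ` E \<inter> rest l i = {}"
  proof (rule ccontr)
    assume "shrink i ` E \<inter> rest l i \<noteq> {}"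
    then obtain z where "z \<in> E" "shrink i z \<in> rest l i" by blast
    then show False using shrink_rest[of z i l] E edge_corner[OF sub(2)] by blast
  qed
  then have eq: "cell l - shrink i ` E = shrink i ` (cell (child l i) - E) \<union> rest l i"
    unfolding cell_split[OF sub(4) sub(1)] by auto
  have "compact (cell (child l i) - E)"
  proof -
    have "compact (cell (child l i) \<inter> (cell (child l i) - E))"
      using compact_Int_closed[OF compact_cell[of "child l i"] sub.IH] sub(4) by simp
    moreover have "cell (child l i) \<inter> (cell (child l i) - E) = cell (child l i) - E" by blast
    ultimately show ?thesis by simp
  qed
  then show ?case unfolding eq using closed_rest sub(4) by (intro closed_Un closed_shrink_image)
qed

lemma shrink_homeomorphic: "S homeomorphic shrink i ` S"
proof -
  have "homeomorphism S (shrink i ` S) (shrink i) (\<lambda>y k. 3 * y k - 2 * corner i k)"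
    unfolding homeomorphism_def
  proof (intro conjI ballI)
    show inv: "(\<lambda>k. 3 * shrink i y k - 2 * corner i k) = y" for y by (simp add: shrink_def add_divide_distrib)
    show "continuous_on (shrink i ` S) (\<lambda>y k. 3 * y k - 2 * corner i k)"
      by (intro continuous_on_coordinatewise_then_product continuous_intros continuous_coordinate)
    show "(\<lambda>y k. 3 * y k - 2 * corner i k) ` shrink i ` S = S" using inv by (auto simp: image_iff)
    show "shrink i (\<lambda>k. 3 * y k - 2 * corner i k) = y" for y by (auto simp: shrink_def)
  qed (simp_all add: continuous_shrink)
  then show ?thesis unfolding homeomorphic_def by blast
qed

lemma edge_homeomorphic: "edge l E \<Longrightarrow> E homeomorphic {0<..<1::real}"
proof (induction rule: edge.induct)
  case (mid i l j)
  have "homeomorphism {0<..<1} (mid_open i j) (\<lambda>t. segpt i j ((1 + t) / 3)) (\<lambda>y. 3 * y j - 1)"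
    unfolding homeomorphism_def
  proof (intro conjI ballI)
    show inv: "3 * segpt i j ((1 + t) / 3) j - 1 = t" for t
      using segpt_eval(2)[OF mid(3), of "(1 + t) / 3"] by (simp add: field_simps)
    show im: "(\<lambda>t. segpt i j ((1 + t) / 3)) ` {0<..<1} = mid_open i j"
    proof
      show "(\<lambda>t. segpt i j ((1 + t) / 3)) ` {0<..<1} \<subseteq> mid_open i j"
        by (auto simp: mid_open_def)
      show "mid_open i j \<subseteq> (\<lambda>t. segpt i j ((1 + t) / 3)) ` {0<..<1}"
      proof
        fix y assume "y \<in> mid_open i j"
        then obtain s where "1/3 < s" "s < 2/3" "y = segpt i j s" by (auto simp: mid_open_def)
        then have "y = segpt i j ((1 + (3 * s - 1)) / 3)" "3 * s - 1 \<in> {0<..<1}" by auto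
        then show "y \<in> (\<lambda>t. segpt i j ((1 + t) / 3)) ` {0<..<1}" by blast
      qed
    qed
    show "continuous_on {0<..<1} (\<lambda>t. segpt i j ((1 + t) / 3))"
      by (rule continuous_on_compose2[OF continuous_segpt]) (auto intro!: continuous_intros)
    show "continuous_on (mid_open i j) (\<lambda>y. 3 * y j - 1)"
      by (intro continuous_intros continuous_coordinate)
    show "(\<lambda>y. 3 * y j - 1) ` mid_open i j = {0<..<1}"
      unfolding im[symmetric] image_image inv by simp
    show "segpt i j ((1 + (3 * y j - 1)) / 3) = y" if "y \<in> mid_open i j" for y
      using that segpt_eval(2)[OF mid(3)] by (auto simp: mid_open_def)
  qed
  then show ?case unfolding homeomorphic_def using homeomorphism_symD by blast
next
  case (sub i l E)
  then show ?case using shrink_homeomorphic homeomorphic_sym homeomorphic_trans by blast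
qed

lemma mid_open_swap: "mid_open i j = mid_open j i"
proof -
  have "mid_open i j \<subseteq> mid_open j i" for i j
  proof
    fix y assume "y \<in> mid_open i j"
    then obtain s where "1/3 < s" "s < 2/3" "y = segpt i j s" by (auto simp: mid_open_def)
    then have "y = segpt j i (1 - s)" "1 - s \<in> {1/3<..<2/3}" using segpt_swap[of i j s] by auto
    then show "y \<in> mid_open j i" by (auto simp: mid_open_def)
  qed
  then show ?thesis by blast
qed

lemma edge_disjoint: "edge l E \<Longrightarrow> edge l E' \<Longrightarrow> y \<in> E \<Longrightarrow> y \<in> E' \<Longrightarrow> E = E'"
proof (induction arbitrary: E' y rule: edge.induct)
  case (mid i l j)
  show ?case using mid.prems(1)
  proof cases
    case m: (mid k m)
    have "{i, j} = {k, m}"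
    proof (rule ccontr)
      assume "{i, j} \<noteq> {k, m}"
      then have "mid_closed i j \<inter> mid_closed k m = {}" using mid(3) m by (intro mid_closed_disjoint)
      then show False using mid.prems mid_subset m(1) by blast
    qed
    then show ?thesis using m(1) mid_open_swap by (auto simp: doubleton_eq_iff)
  next
    case (sub k F)
    then obtain z where "z \<in> F" "y = shrink k z" using mid.prems by blast
    then show ?thesis using mid_open_not_shrink[of y i j z k] mid edge_region[OF sub(3)] by blast
  qed
next
  case (sub i l E)
  obtain z where z: "z \<in> E" "y = shrink i z" using sub.prems by blast
  have zr: "z \<in> region" using z edge_region[OF sub(2)] by blast
  show ?case using sub.prems(1)
  proof cases
    case (mid k m)
    then show ?thesis using mid_open_not_shrink[of y k m z i] z zr sub.prems by blast
  next
    case s: (sub k F)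
    have "y \<in> shrink k ` F" using sub.prems(3) unfolding s(1) .
    then obtain w where w: "w \<in> F" "y = shrink k w" by blast
    have "w \<in> region" using w(1) edge_region[OF s(3)] by (rule subsetD[rotated])
    moreover have "shrink i z = shrink k w" using z(2) w(2) by simp
    ultimately have "i = k \<and> z = w" using shrink_eq_shrink zr by simp
    then have "E = F" using sub.IH[of F z] s z w by simp
    then show ?thesis using s \<open>i = k \<and> z = w\<close> by simp
  qed
qed

lemma edge_vert: "edge l E \<Longrightarrow> y \<in> E \<Longrightarrow> y \<notin> vert l"
proof (induction arbitrary: y rule: edge.induct)
  case (mid i l j)
  then show ?case using vert_mid_open by blast
next
  case (sub i l E)
  then obtain z where z: "z \<in> E" "y = shrink i z" by blast
  then show ?case using shrink_vertD[of i z l] edge_region[OF sub(2)] sub.IH by blast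
qed

text \<open>A point on no edge lies in a copy, is on no edge of that copy, and so descends for
  ever.\<close>

lemma cell_vert_edge:
  assumes "wf_label l" shows "cell l - vert l = \<Union>{E. edge l E}"
proof
  have "in_vert l y" if "y \<in> cell l" "\<And>E. edge l E \<Longrightarrow> y \<notin> E" for y
    using that
  proof (coinduction arbitrary: l y)
    case in_vert
    have "in_cell l y" using in_vert by (simp add: cell_def)
    then show ?case
    proof cases
      case (mid i j s)
      then have "y \<in> mid_open i j" by (auto simp: mid_open_def)
      then show ?thesis using in_vert edge.mid[of i l j] mid by blast
    next
      case (sub i z)
      have "z \<notin> E" if "edge (child l i) E" for E
        using in_vert(2) edge.sub[OF sub(2) that] sub(1) by blast
      moreover have "z \<in> cell (child l i)" using sub by (simp add: cell_def)
      ultimately show ?thesis using sub by blast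
    qed
  qed
  then show "cell l - vert l \<subseteq> \<Union>{E. edge l E}" by (auto simp: vert_def)
  show "\<Union>{E. edge l E} \<subseteq> cell l - vert l"
    using edge_subset[OF _ assms] edge_vert by blast
qed

section \<open>Zero-dimensionality of the vertex set\<close>

lemma closed_vert:
  assumes "wf_label l" shows "closed (vert l)"
proof -
  have "vert l = cell l \<inter> (\<Inter>E\<in>{E. edge l E}. cell l - E)"
    using cell_vert_edge[OF assms] vert_subset_cell[of l] by blast
  moreover have "closed \<dots>"
    using edge_closed assms closed_cell by (intro closed_Int closed_INT) auto
  ultimately show ?thesis by simp
qed

text \<open>The coordinates of vertices lie in the ternary Cantor set, and midpoints of triadic
  intervals do not. The expansion that undoes \<open>shrink\<close> takes such a midpoint of level
  \<open>m + 1\<close> to one of level \<open>m\<close>, down to the half-integers.\<close>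

lemma vert_coordinate:
  fixes k :: int
  assumes "y \<in> vert l" shows "y j \<noteq> (2 * of_int k + 1) / (2 * 3^m)"
  using assms
proof (induction m arbitrary: l y k)
  case 0
  have "in_vert l y" using 0 by (simp add: vert_def)
  then show ?case
  proof cases
    case (sub i z)
    have "y \<in> region" using 0 vert_region by blast
    then have b: "0 \<le> y j" "y j \<le> 1" using regionD by blast+
    have "y j \<le> 1/3 \<or> 2/3 \<le> y j" using shrink_ge[of z i] shrink_le[of z j i] sub by (cases "i = j") auto
    then show ?thesis
    proof (rule contrapos_pn)
      assume eq: "y j = (2 * of_int k + 1) / (2 * 3 ^ 0)"
      then have "of_int (2 * k + 1) \<le> (2::real)" "(0::real) \<le> of_int (2 * k + 1)" using b by auto
      then have "k = 0" by linarith
      then show "\<not> (y j \<le> 1/3 \<or> 2/3 \<le> y j)" using eq by simp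
    qed
  qed
next
  case (Suc m)
  have "in_vert l y" using Suc.prems by (simp add: vert_def)
  then show ?case
  proof cases
    case (sub i z)
    define c where "c = (if j = i then 1 else 0 :: int)"
    have yj: "3 * y j = 2 * of_int c + z j" using sub by (simp add: shrink_def c_def)
    have "z j \<noteq> (2 * of_int (k - 2 * c * 3^m) + 1) / (2 * 3^m)"
    proof -
      have "z \<in> vert (child l i)" using sub by (simp add: vert_def)
      then show ?thesis by (rule Suc.IH)
    qed
    moreover have "(2 * of_int (k - 2 * c * 3^m) + 1) / (2 * 3^m) = (2 * of_int k + 1) / (2 * 3^m) - 2 * (of_int c :: real)"
      by (simp add: field_simps)
    ultimately have "3 * y j \<noteq> (2 * of_int k + 1) / (2 * 3^m)" using yj by simp
    then show ?thesis by (simp add: field_simps)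
  qed
qed

lemma between_triadic:
  fixes a b :: real
  assumes "a < b" shows "\<exists>(k::int) m. a < (2 * of_int k + 1) / (2 * 3^m) \<and> (2 * of_int k + 1) / (2 * 3^m) < b"
proof -
  obtain m where m: "(1/3)^m < b - a" using real_arch_pow_inv[of "b - a" "1/3"] assms by auto
  define k where "k = \<lfloor>a * 3^m + 1/2\<rfloor>"
  have k: "of_int k \<le> a * 3^m + 1/2" "a * 3^m + 1/2 < of_int k + 1" unfolding k_def by linarith+
  have "1 < (b - a) * 3^m" using m by (simp add: field_simps)
  then have "a * 3^m < of_int k + 1/2" "of_int k + 1/2 < b * 3^m" using k by (auto simp: algebra_simps)
  then show ?thesis by (intro exI[of _ k] exI[of _ m]) (simp add: field_simps)
qed

text \<open>A box whose sides end in values avoided by \<open>V\<close> cuts out the same part of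
  \<open>V\<close> whether taken open or closed. Those values are dense, and a basic open set
  restricts only finitely many coordinates.\<close>

lemma zero_dimensional_triadic:
  fixes V :: "(nat \<Rightarrow> real) set"
  assumes V: "\<And>y j (k::int) m. y \<in> V \<Longrightarrow> y j \<noteq> (2 * of_int k + 1) / (2 * 3^m)"
  shows "zero_dimensional_space (top_of_set V)"
  unfolding zero_dimensional_space_def
proof (intro allI impI)
  fix U x assume "openin (top_of_set V) U \<and> x \<in> U"
  then obtain T where T: "open T" "U = V \<inter> T" "x \<in> V" "x \<in> T" by (auto simp: openin_open)
  have "openin (product_topology (\<lambda>i::nat. euclidean :: real topology) UNIV) T"
    using T(1) by (simp add: euclidean_product_topology)
  from product_topology_open_contains_basis[OF this T(4)]
  obtain G where G: "x \<in> Pi\<^sub>E UNIV G" "\<And>i. open (G i)" "finite {i. G i \<noteq> UNIV}" "Pi\<^sub>E UNIV G \<subseteq> T"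
    by auto
  have "\<exists>c d. c < x i \<and> x i < d \<and> {c..d} \<subseteq> G i \<and> (\<forall>y\<in>V. y i \<noteq> c \<and> y i \<noteq> d)" for i
  proof -
    have "x i \<in> G i" using G(1) by auto
    then obtain e where e: "e > 0" "\<And>t. \<bar>t - x i\<bar> < e \<Longrightarrow> t \<in> G i"
      using G(2)[of i] unfolding open_dist dist_real_def by blast
    obtain k m where c: "x i - e < (2 * of_int k + 1) / (2 * 3^m)" "(2 * of_int k + 1) / (2 * 3^m) < x i"
      using between_triadic[of "x i - e" "x i"] e by auto
    obtain k' m' where d: "x i < (2 * of_int k' + 1) / (2 * 3^m')" "(2 * of_int k' + 1) / (2 * 3^m') < x i + e"
      using between_triadic[of "x i" "x i + e"] e by auto
    show ?thesis
      by (rule exI[of _ "(2 * of_int k + 1) / (2 * 3^m)"], rule exI[of _ "(2 * of_int k' + 1) / (2 * 3^m')"])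
        (use c d e(2) V in \<open>auto simp: subset_iff abs_if\<close>)
  qed
  then obtain c d where cd: "\<And>i. c i < x i" "\<And>i. x i < d i" "\<And>i. {c i..d i} \<subseteq> G i"
    "\<And>i y. y \<in> V \<Longrightarrow> y i \<noteq> c i \<and> y i \<noteq> d i" by metis
  define J where "J = {i. G i \<noteq> UNIV}"
  define W where "W = V \<inter> (\<Inter>i\<in>J. {y. c i < y i \<and> y i < d i})"
  have W': "W = V \<inter> (\<Inter>i\<in>J. {y. c i \<le> y i \<and> y i \<le> d i})"
  proof -
    have "(c i < y i \<and> y i < d i) \<longleftrightarrow> (c i \<le> y i \<and> y i \<le> d i)" if "y \<in> V" for y i
      using cd(4)[OF that, of i] by auto
    then show ?thesis unfolding W_def by auto
  qed
  have "open (\<Inter>i\<in>J. {y. c i < y i \<and> y i < d i})"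
    using G(3) unfolding J_def
    by (intro open_INT ballI open_Collect_conj open_Collect_less continuous_intros continuous_coordinate) auto
  then have "openin (top_of_set V) W" unfolding W_def by (auto simp: openin_open)
  moreover have "closed (\<Inter>i\<in>J. {y. c i \<le> y i \<and> y i \<le> d i})"
    by (intro closed_INT ballI closed_Collect_conj closed_Collect_le continuous_intros continuous_coordinate)
  then have "closedin (top_of_set V) W" unfolding W' by (auto simp: closedin_closed)
  moreover have "x \<in> W" using T cd by (auto simp: W_def)
  moreover have "W \<subseteq> U"
  proof
    fix y assume y: "y \<in> W"
    have "y i \<in> G i" for i
    proof (cases "i \<in> J")
      case True
      then have "y i \<in> {c i..d i}" using y unfolding W' by auto
      then show ?thesis using cd(3) by blast
    next
      case False
      then show ?thesis by (simp add: J_def)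
    qed
    then have "y \<in> T" using G(4) by auto
    then show "y \<in> U" using y T by (auto simp: W_def)
  qed
  ultimately show "\<exists>W. openin (top_of_set V) W \<and> closedin (top_of_set V) W \<and> x \<in> W \<and> W \<subseteq> U" by blast
qed

text \<open>Each set is indexed by one of its own points, the image \<open>rep E\<close> of
  \<open>1/2\<close>, which gives the index set the type that \<open>graph_like_continuum\<close>
  asks for.\<close>

lemma disjoint_union_homeomorphic:
  fixes \<E> :: "'a::t2_space set set"
  assumes op: "\<And>E. E \<in> \<E> \<Longrightarrow> openin (top_of_set (\<Union>\<E>)) E"
    and hom: "\<And>E. E \<in> \<E> \<Longrightarrow> E homeomorphic {0<..<1::real}"
    and disj: "\<And>E E' y. E \<in> \<E> \<Longrightarrow> E' \<in> \<E> \<Longrightarrow> y \<in> E \<Longrightarrow> y \<in> E' \<Longrightarrow> E = E'"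
  shows "\<exists>I :: 'a set. top_of_set (\<Union>\<E>) homeomorphic_space
           prod_topology (discrete_topology I) (top_of_set {0<..<1::real})"
proof -
  have "\<forall>E\<in>\<E>. \<exists>g f. homeomorphism {0<..<1::real} E g f"
    using hom homeomorphic_sym unfolding homeomorphic_def by blast
  from bchoice[OF this] obtain g where "\<forall>E\<in>\<E>. \<exists>f. homeomorphism {0<..<1::real} E (g E) f" by blast
  from bchoice[OF this] obtain f where gf: "\<And>E. E \<in> \<E> \<Longrightarrow> homeomorphism {0<..<1::real} E (g E) (f E)" by blast
  define rep where "rep = (\<lambda>E. g E (1/2))"
  have rep: "rep E \<in> E" if "E \<in> \<E>" for E
    using gf[OF that] unfolding homeomorphism_def rep_def by auto
  define I where "I = rep ` \<E>"
  define owner where "owner = (\<lambda>a. THE E. E \<in> \<E> \<and> a \<in> E)"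
  have owner_eq: "owner a = E" if "E \<in> \<E>" "a \<in> E" for a E
    unfolding owner_def by (rule the_equality) (use that disj in \<open>simp, metis\<close>)
  have ownerI: "owner a \<in> \<E>" "rep (owner a) = a" if "a \<in> I" for a
    using that owner_eq rep unfolding I_def by auto
  define F where "F = (\<lambda>(a, t). g (owner a) t)"
  let ?P = "prod_topology (discrete_topology I) (top_of_set {0<..<1::real})"
  let ?X = "top_of_set (\<Union>\<E>)"
  have g_mem: "g E t \<in> E" if "E \<in> \<E>" "0 < t" "t < 1" for E t
    using gf[OF that(1)] that unfolding homeomorphism_def by auto
  have top: "topspace ?P = I \<times> {0<..<1}" by simp
  have "continuous_map ?P ?X F"
    unfolding continuous_map_def
  proof (intro conjI allI impI)
    show "F \<in> topspace ?P \<rightarrow> topspace ?X"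
      using g_mem ownerI unfolding F_def by fastforce
    fix U assume U: "openin ?X U"
    have "{x \<in> topspace ?P. F x \<in> U} = (\<Union>a\<in>I. {a} \<times> {t \<in> {0<..<1}. g (owner a) t \<in> U})"
      by (auto simp: F_def)
    moreover have "openin ?P ({a} \<times> {t \<in> {0<..<1}. g (owner a) t \<in> U})" if "a \<in> I" for a
    proof -
      have E: "owner a \<in> \<E>" using ownerI that by blast
      have c: "continuous_on {0<..<1} (g (owner a))" "g (owner a) ` {0<..<1} \<subseteq> \<Union>\<E>"
        using gf[OF E] E unfolding homeomorphism_def by auto
      have "openin (top_of_set {0<..<1}) ({0<..<1} \<inter> g (owner a) -` U)"
        by (rule continuous_openin_preimage[OF c(1) _ U]) (use c(2) in auto)
      moreover have "{0<..<1} \<inter> g (owner a) -` U = {t \<in> {0<..<1}. g (owner a) t \<in> U}" by auto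
      ultimately show ?thesis using that by (simp add: openin_prod_Times_iff)
    qed
    ultimately show "openin ?P {x \<in> topspace ?P. F x \<in> U}" by auto
  qed
  moreover have "open_map ?P ?X F"
    unfolding open_map_def
  proof (intro allI impI)
    fix W assume W: "openin ?P W"
    have "F ` W = (\<Union>a\<in>I. g (owner a) ` {t. (a, t) \<in> W})"
      using openin_subset[OF W] unfolding F_def by (force simp: image_iff)
    moreover have "openin ?X (g (owner a) ` {t. (a, t) \<in> W})" if "a \<in> I" for a
    proof -
      have E: "owner a \<in> \<E>" using ownerI that by blast
      have "openin (top_of_set {0<..<1}) {t \<in> topspace (top_of_set {0<..<1::real}). (a, t) \<in> W}"
        by (rule openin_continuous_map_preimage[OF _ W]) (use that in \<open>simp add: continuous_map_pairedI\<close>)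
      moreover have "{t \<in> topspace (top_of_set {0<..<1::real}). (a, t) \<in> W} = {t. (a, t) \<in> W}"
        using openin_subset[OF W] by auto
      ultimately have "openin (top_of_set {0<..<1}) {t. (a, t) \<in> W}" by simp
      then have "openin (top_of_set (owner a)) (g (owner a) ` {t. (a, t) \<in> W})"
        using homeomorphism_imp_open_map[OF gf[OF E]] by blast
      then show ?thesis using op[OF E] openin_trans by blast
    qed
    ultimately show "openin ?X (F ` W)" by auto
  qed
  moreover have "F ` topspace ?P = topspace ?X"
  proof
    show "F ` topspace ?P \<subseteq> topspace ?X" using g_mem ownerI unfolding F_def by fastforce
    show "topspace ?X \<subseteq> F ` topspace ?P"
    proof
      fix y assume "y \<in> topspace ?X"
      then obtain E where E: "E \<in> \<E>" "y \<in> E" by auto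
      then obtain t where t: "t \<in> {0<..<1}" "g E t = y" using gf[OF E(1)] unfolding homeomorphism_def by (metis imageE)
      have "rep E \<in> I" "owner (rep E) = E" using E owner_eq rep unfolding I_def by auto
      then have "F (rep E, t) = y" "(rep E, t) \<in> topspace ?P" using t by (auto simp: F_def)
      then show "y \<in> F ` topspace ?P" by blast
    qed
  qed
  moreover have "inj_on F (topspace ?P)"
  proof (rule inj_onI)
    fix x y assume xy: "x \<in> topspace ?P" "y \<in> topspace ?P" "F x = F y"
    obtain a t b u where e: "x = (a, t)" "y = (b, u)" by (metis surj_pair)
    have ab: "a \<in> I" "b \<in> I" "t \<in> {0<..<1}" "u \<in> {0<..<1}" using xy e by auto
    have eq: "g (owner a) t = g (owner b) u" using xy e by (simp add: F_def)
    have "g (owner a) t \<in> owner a" "g (owner b) u \<in> owner b" using g_mem ownerI ab by auto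
    then have "owner a = owner b" using disj[OF ownerI(1)[OF ab(1)] ownerI(1)[OF ab(2)]] eq by simp
    then have "a = b" using ownerI(2) ab by metis
    moreover have "t = u"
      using gf[OF ownerI(1)[OF ab(1)]] eq \<open>owner a = owner b\<close> ab(3,4) unfolding homeomorphism_def by metis
    ultimately show "x = y" using e by simp
  qed
  ultimately have "homeomorphic_map ?P ?X F" by (intro bijective_open_imp_homeomorphic_map)
  then show ?thesis using homeomorphic_map_imp_homeomorphic_space homeomorphic_space_sym by blast
qed

text \<open>Different cells share only corners and no edge contains a corner, so the edges of all
  cells stay open and disjoint in the union.\<close>

theorem cells_graph_like:
  assumes fin: "finite Ls" "Ls \<noteq> {}" and wf: "\<And>l. l \<in> Ls \<Longrightarrow> wf_label l \<and> letters l \<noteq> {}"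
    and meet: "\<And>l l'. l \<in> Ls \<Longrightarrow> l' \<in> Ls \<Longrightarrow> l \<noteq> l' \<Longrightarrow> cell l \<inter> cell l' \<subseteq> range corner"
    and con: "connected (\<Union>l\<in>Ls. cell l)"
  shows "graph_like_continuum (top_of_set (\<Union>l\<in>Ls. cell l))"
proof -
  define X where "X = (\<Union>l\<in>Ls. cell l)"
  define V where "V = (\<Union>l\<in>Ls. vert l)"
  define \<E> where "\<E> = {E. \<exists>l\<in>Ls. edge l E}"
  have cX: "compact X" unfolding X_def using fin wf compact_cell by (intro compact_UN) auto
  have Vc: "closed V" unfolding V_def using fin wf closed_vert by (intro closed_UN) auto
  have VX: "V \<subseteq> X" unfolding V_def X_def using vert_subset_cell by blast
  have E_other: "E \<inter> cell l' = {}" if "edge l E" "l \<in> Ls" "l' \<in> Ls" "l \<noteq> l'" for E l l'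
    using meet[OF that(2,3,4)] edge_subset[OF that(1)] wf[OF that(2)] edge_corner[OF that(1)] by blast
  have X_V: "X - V = \<Union>\<E>"
  proof
    show "X - V \<subseteq> \<Union>\<E>"
    proof
      fix y assume y: "y \<in> X - V"
      then obtain l where l: "l \<in> Ls" "y \<in> cell l" unfolding X_def by blast
      then have "y \<in> cell l - vert l" using y unfolding V_def by blast
      then have "y \<in> \<Union>{E. edge l E}" using cell_vert_edge[of l] wf[OF l(1)] by simp
      then show "y \<in> \<Union>\<E>" using l(1) unfolding \<E>_def by auto
    qed
    show "\<Union>\<E> \<subseteq> X - V"
    proof
      fix y assume "y \<in> \<Union>\<E>"
      then obtain l E where E: "l \<in> Ls" "edge l E" "y \<in> E" unfolding \<E>_def by blast
      have "y \<notin> vert l'" if "l' \<in> Ls" for l'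
        using E_other[OF E(2,1) that] edge_vert[OF E(2,3)] E(3) vert_subset_cell by (cases "l = l'") blast+
      moreover have "y \<in> X" unfolding X_def using edge_subset[OF E(2)] wf[OF E(1)] E by blast
      ultimately show "y \<in> X - V" unfolding V_def by blast
    qed
  qed
  have Ecl: "closed (X - E)" "E \<subseteq> X" if EE: "E \<in> \<E>" for E
  proof -
    obtain l where l: "l \<in> Ls" "edge l E" using EE unfolding \<E>_def by blast
    have "X - E = (cell l - E) \<union> (\<Union>l'\<in>Ls - {l}. cell l')"
      using E_other[OF l(2,1)] l(1) unfolding X_def by blast
    moreover have "closed \<dots>"
      using edge_closed[OF l(2)] wf l fin closed_cell by (intro closed_Un closed_UN) auto
    ultimately show "closed (X - E)" by simp
    show "E \<subseteq> X" unfolding X_def using edge_subset[OF l(2)] wf l by blast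
  qed
  have "\<exists>I :: (nat \<Rightarrow> real) set. top_of_set (\<Union>\<E>) homeomorphic_space prod_topology (discrete_topology I) (top_of_set {0<..<1::real})"
  proof (rule disjoint_union_homeomorphic)
    show "openin (top_of_set (\<Union>\<E>)) E" if "E \<in> \<E>" for E
    proof -
      have "E = \<Union>\<E> \<inter> - (X - E)" using that X_V by blast
      moreover have "open (- (X - E))" using Ecl(1)[OF that] by (simp only: closed_def)
      ultimately show ?thesis by (metis openin_open_Int)
    qed
    show "E homeomorphic {0<..<1::real}" if "E \<in> \<E>" for E
      using that edge_homeomorphic unfolding \<E>_def by blast
    show "E = E'" if E: "E \<in> \<E>" "E' \<in> \<E>" "y \<in> E" "y \<in> E'" for E E' y
    proof -
      obtain l l' where l: "l \<in> Ls" "edge l E" "l' \<in> Ls" "edge l' E'" using E unfolding \<E>_def by blast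
      have "l = l'" using E_other[OF l(2,1,3)] edge_subset[OF l(4)] wf[OF l(3)] E by blast
      then show ?thesis using edge_disjoint l E by blast
    qed
  qed
  moreover have "subtopology (top_of_set X) (topspace (top_of_set X) - V) = top_of_set (\<Union>\<E>)"
  proof -
    have "X \<inter> \<Union>\<E> = \<Union>\<E>" using X_V by blast
    then show ?thesis using X_V by (simp add: subtopology_subtopology)
  qed
  moreover have "zero_dimensional_space (subtopology (top_of_set X) V)"
  proof -
    have "subtopology (top_of_set X) V = top_of_set V" using VX by (simp add: subtopology_subtopology Int_absorb1)
    moreover have "zero_dimensional_space (top_of_set V)"
      using vert_coordinate by (intro zero_dimensional_triadic) (auto simp: V_def)
    ultimately show ?thesis by simp
  qed
  moreover have "closedin (top_of_set X) V" using Vc VX by (auto simp: closedin_closed)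
  moreover have "continuum (top_of_set X)"
  proof -
    have "X \<noteq> {}"
    proof -
      obtain l i where "l \<in> Ls" "i \<in> letters l" using fin wf by blast
      then have "corner i \<in> X" using corner_vert vert_subset_cell wf unfolding X_def by blast
      then show ?thesis by blast
    qed
    then show ?thesis unfolding continuum_def
      using cX con metrizable_space_subtopology[OF metrizable_space_euclidean]
      by (simp add: compact_space_subtopology connected_space_subtopology compactin_euclidean_iff connectedin_iff_connected X_def)
  qed
  ultimately show ?thesis unfolding graph_like_continuum_def X_def[symmetric] by metis
qed

section \<open>The order of a point\<close>

text \<open>Connected sets take the place of arcs: rays provide them, continuous injections preserve
  them, and a bottleneck of \<open>k\<close> points bounds their number just as well.\<close>

definition fan :: "'a topology \<Rightarrow> nat \<Rightarrow> 'a \<Rightarrow> bool" where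
  "fan X k x \<longleftrightarrow> (\<exists>A. (\<forall>i<k. connectedin X (A i) \<and> x \<in> A i \<and> A i \<noteq> {x}) \<and>
     (\<forall>i<k. \<forall>j<k. i \<noteq> j \<longrightarrow> A i \<inter> A j = {x}))"

definition order_points :: "'a topology \<Rightarrow> nat \<Rightarrow> 'a set" where
  "order_points X k = {x \<in> topspace X. fan X k x \<and> \<not> fan X (Suc k) x}"

text \<open>
  Arbitrarily small closed neighbourhoods of \<open>x\<close> can be left only through \<open>k\<close> points.
\<close>

definition narrow :: "'a::topological_space set \<Rightarrow> 'a \<Rightarrow> nat \<Rightarrow> bool" where
  "narrow X x k \<longleftrightarrow> (\<forall>Y. finite Y \<longrightarrow> x \<notin> Y \<longrightarrow> (\<exists>C R F. closed C \<and> closed R \<and> X = C \<union> R \<and> x \<in> C \<and>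
     C \<inter> Y = {} \<and> C \<inter> R \<subseteq> F \<and> finite F \<and> card F \<le> k \<and> x \<notin> F))"

lemma fanE:
  assumes "fan X k x"
  obtains A where "\<And>i. i < k \<Longrightarrow> connectedin X (A i)" "\<And>i. i < k \<Longrightarrow> x \<in> A i" "\<And>i. i < k \<Longrightarrow> A i \<noteq> {x}"
    "\<And>i j. i < k \<Longrightarrow> j < k \<Longrightarrow> i \<noteq> j \<Longrightarrow> A i \<inter> A j = {x}"
proof -
  obtain A where A: "\<forall>i<k. connectedin X (A i) \<and> x \<in> A i \<and> A i \<noteq> {x}"
    "\<forall>i<k. \<forall>j<k. i \<noteq> j \<longrightarrow> A i \<inter> A j = {x}"
    using assms unfolding fan_def by (elim exE conjE)
  show thesis by (rule that[of A]) (use A in simp_all)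
qed

lemma narrowE:
  assumes "narrow X x k" "finite Y" "x \<notin> Y"
  obtains C R F where "closed C" "closed R" "X = C \<union> R" "x \<in> C" "C \<inter> Y = {}"
    "C \<inter> R \<subseteq> F" "finite F" "card F \<le> k" "x \<notin> F"
  using assms(1)[unfolded narrow_def, rule_format, OF assms(2,3)] by (elim exE conjE) (rule that)

lemma fan_antimono: "fan X k x \<Longrightarrow> m \<le> k \<Longrightarrow> fan X m x"
  unfolding fan_def by (metis order_less_le_trans)

lemma fan_injective_map:
  assumes f: "continuous_map X Y f" "inj_on f (topspace X)" and "fan X k x"
  shows "fan Y k (f x)"
proof -
  obtain A where A: "\<And>i. i < k \<Longrightarrow> connectedin X (A i)" "\<And>i. i < k \<Longrightarrow> x \<in> A i" "\<And>i. i < k \<Longrightarrow> A i \<noteq> {x}"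
    "\<And>i j. i < k \<Longrightarrow> j < k \<Longrightarrow> i \<noteq> j \<Longrightarrow> A i \<inter> A j = {x}"
    using fanE[OF assms(3)] by metis
  have sub: "A i \<subseteq> topspace X" if "i < k" for i using connectedin_subset_topspace[OF A(1)[OF that]] .
  have "connectedin Y (f ` A i)" if "i < k" for i
    using connectedin_continuous_map_image[OF f(1) A(1)[OF that]] .
  moreover have "f ` A i \<noteq> {f x}" if i: "i < k" for i
  proof
    assume eq: "f ` A i = {f x}"
    have "y = x" if "y \<in> A i" for y
    proof -
      have "f y = f x" using eq that by blast
      then show ?thesis using inj_onD[OF f(2)] sub[OF i] that A(2)[OF i] by blast
    qed
    then show False using A(2,3)[OF i] by blast
  qed
  moreover have "f ` A i \<inter> f ` A j = {f x}" if "i < k" "j < k" "i \<noteq> j" for i j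
    using inj_on_image_Int[OF f(2) sub[OF that(1)] sub[OF that(2)]] A(4)[OF that] by simp
  ultimately show ?thesis
    unfolding fan_def using A(2) by (intro exI[of _ "\<lambda>i. f ` A i"]) simp
qed

lemma fan_subset:
  assumes "S \<subseteq> T" "fan (top_of_set S) k x" shows "fan (top_of_set T) k x"
  using fan_injective_map[of "top_of_set S" "top_of_set T" "\<lambda>x. x" k x] assms by auto

lemma fan_shrink:
  assumes "fan (top_of_set S) k x" "shrink i ` S \<subseteq> T"
  shows "fan (top_of_set T) k (shrink i x)"
  using fan_injective_map[of "top_of_set S" "top_of_set T" "shrink i" k x] assms
  by (auto simp: continuous_shrink inj_on_def)

text \<open>The invariant is whether the points of order \<open>k\<close> are countable. It is
  insensitive to the junctions, whose orders are not determined.\<close>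

lemma countable_order_points:
  assumes "X homeomorphic_space Y" "countable (order_points Y k)"
  shows "countable (order_points X k)"
proof -
  obtain f g where fg: "homeomorphic_maps X Y f g" using assms(1) unfolding homeomorphic_space_def by blast
  then have c: "continuous_map X Y f" "continuous_map Y X g"
    and gf: "\<And>x. x \<in> topspace X \<Longrightarrow> g (f x) = x" and fg': "\<And>y. y \<in> topspace Y \<Longrightarrow> f (g y) = y"
    unfolding homeomorphic_maps_def by blast+
  have inj: "inj_on f (topspace X)" "inj_on g (topspace Y)" using gf fg' by (auto intro: inj_on_inverseI)
  have "f ` order_points X k \<subseteq> order_points Y k"
  proof
    fix y assume "y \<in> f ` order_points X k"
    then obtain x where x: "x \<in> topspace X" "fan X k x" "\<not> fan X (Suc k) x" "y = f x"
      unfolding order_points_def by blast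
    have "f x \<in> topspace Y" using c(1) x(1) continuous_map_image_subset_topspace by blast
    moreover have "fan Y k (f x)" using fan_injective_map[OF c(1) inj(1) x(2)] .
    moreover have "\<not> fan Y (Suc k) (f x)"
      using fan_injective_map[OF c(2) inj(2), of "Suc k" "f x"] gf x by auto
    ultimately show "y \<in> order_points Y k" using x unfolding order_points_def by blast
  qed
  then have "countable (f ` order_points X k)" using assms(2) countable_subset by blast
  moreover have "inj_on f (order_points X k)"
    by (rule inj_on_subset[OF inj(1)]) (auto simp: order_points_def)
  ultimately show ?thesis using countable_image_inj_on by blast
qed

text \<open>Pick a point other than \<open>x\<close> in each of the \<open>k + 1\<close> sets and a
  neighbourhood \<open>C\<close> of \<open>x\<close> that misses these points. By connectedness each
  set contains a point of \<open>F\<close>, and no point other than \<open>x\<close> belongs to two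
  of them.\<close>

lemma narrow_not_fan:
  assumes "narrow X x k" shows "\<not> fan (top_of_set X) (Suc k) x"
proof
  assume fan: "fan (top_of_set X) (Suc k) x"
  obtain A where A: "\<And>i. i < Suc k \<Longrightarrow> connectedin (top_of_set X) (A i)" "\<And>i. i < Suc k \<Longrightarrow> x \<in> A i"
    "\<And>i. i < Suc k \<Longrightarrow> A i \<noteq> {x}" "\<And>i j. i < Suc k \<Longrightarrow> j < Suc k \<Longrightarrow> i \<noteq> j \<Longrightarrow> A i \<inter> A j = {x}"
    using fanE[OF fan] by metis
  have con: "connected (A i)" "A i \<subseteq> X" if "i < Suc k" for i
    using A(1)[OF that] connectedin_subset_topspace[OF A(1)[OF that]] by (auto simp: connectedin_subtopology)
  have "\<exists>y. y \<in> A i \<and> y \<noteq> x" if "i < Suc k" for i using A(2,3)[OF that] by blast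
  then obtain y where y: "\<And>i. i < Suc k \<Longrightarrow> y i \<in> A i \<and> y i \<noteq> x" by metis
  have fin: "finite (y ` {..<Suc k})" "x \<notin> y ` {..<Suc k}" using y by auto
  obtain C R F where C: "closed C" "closed R" "X = C \<union> R" "x \<in> C" "C \<inter> y ` {..<Suc k} = {}"
    "C \<inter> R \<subseteq> F" "finite F" "card F \<le> k" "x \<notin> F"
    using narrowE[OF assms fin] .
  have "\<exists>z. z \<in> A i \<and> z \<in> F" if i: "i < Suc k" for i
  proof (rule ccontr)
    assume n: "\<not> ?thesis"
    have "y i \<in> R" using y[OF i] con(2)[OF i] C(3,5) i by blast
    then have "C \<inter> A i \<noteq> {}" "R \<inter> A i \<noteq> {}" using y[OF i] A(2)[OF i] C(4) by blast+
    moreover have "A i \<subseteq> C \<union> R" using con(2)[OF i] C(3) by blast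
    moreover have "C \<inter> R \<inter> A i = {}" using n C(6) by blast
    ultimately show False using con(1)[OF i] C(1,2) unfolding connected_closed by blast
  qed
  then obtain z where z: "\<And>i. i < Suc k \<Longrightarrow> z i \<in> A i \<and> z i \<in> F" by metis
  have "inj_on z {..<Suc k}"
  proof (rule inj_onI)
    fix i j assume ij: "i \<in> {..<Suc k}" "j \<in> {..<Suc k}" "z i = z j"
    show "i = j"
    proof (rule ccontr)
      assume "i \<noteq> j"
      then have "A i \<inter> A j = {x}" using A(4) ij by blast
      then have "z i = x" using z ij by (metis IntI lessThan_iff singletonD)
      then show False using z ij C(9) by auto
    qed
  qed
  then have "card {..<Suc k} \<le> card F" using z C(7) by (intro card_inj_on_le[of z]) auto
  then show False using C(8) by simp
qed

text \<open>The contact points \<open>Q\<close> are added to the points to be avoided. Then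
  \<open>C\<close> stays away from \<open>R0\<close>, which can be joined to
  \<open>R\<close>.\<close>

lemma narrow_glue:
  assumes "narrow P x k" "X = P \<union> R0" "closed R0" "P \<inter> R0 \<subseteq> Q" "finite Q" "x \<notin> Q"
  shows "narrow X x k"
  unfolding narrow_def
proof (intro allI impI)
  fix Y assume "finite Y" "x \<notin> Y"
  then have fin: "finite (Y \<union> Q)" "x \<notin> Y \<union> Q" using assms by auto
  obtain C R F where C: "closed C" "closed R" "P = C \<union> R" "x \<in> C" "C \<inter> (Y \<union> Q) = {}"
    "C \<inter> R \<subseteq> F" "finite F" "card F \<le> k" "x \<notin> F"
    using narrowE[OF assms(1) fin] .
  have "C \<inter> R0 = {}" using C(3,5) assms(4) by blast
  then have "closed (R \<union> R0)" "X = C \<union> (R \<union> R0)" "C \<inter> Y = {}" "C \<inter> (R \<union> R0) \<subseteq> F"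
    using C assms by auto
  then show "\<exists>C R F. closed C \<and> closed R \<and> X = C \<union> R \<and> x \<in> C \<and> C \<inter> Y = {} \<and> C \<inter> R \<subseteq> F \<and>
      finite F \<and> card F \<le> k \<and> x \<notin> F"
    using C by blast
qed

lemma narrow_shrink:
  assumes "narrow S x k" "compact S"
  shows "narrow (shrink i ` S) (shrink i x) k"
  unfolding narrow_def
proof (intro allI impI)
  fix Y assume Y: "finite Y" "shrink i x \<notin> Y"
  define Y' where "Y' = {y. shrink i y \<in> Y}"
  have fin: "finite Y'"
    by (rule finite_imageD[of "shrink i", OF finite_subset[OF _ Y(1)]]) (auto simp: Y'_def inj_on_def)
  have nin: "x \<notin> Y'" using Y by (simp add: Y'_def)
  obtain C R F where C: "closed C" "closed R" "S = C \<union> R" "x \<in> C" "C \<inter> Y' = {}"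
    "C \<inter> R \<subseteq> F" "finite F" "card F \<le> k" "x \<notin> F"
    using narrowE[OF assms(1) fin nin] .
  have "compact (S \<inter> C)" "compact (S \<inter> R)" using assms(2) C(1,2) by (simp_all add: compact_Int_closed)
  moreover have "S \<inter> C = C" "S \<inter> R = R" using C(3) by auto
  ultimately have "closed (shrink i ` C)" "closed (shrink i ` R)" by (simp_all add: closed_shrink_image)
  moreover have "shrink i ` S = shrink i ` C \<union> shrink i ` R" using C(3) by blast
  moreover have "shrink i ` C \<inter> Y = {}" using C(5) by (auto simp: Y'_def)
  moreover have "shrink i ` C \<inter> shrink i ` R \<subseteq> shrink i ` F" using C(6) by auto
  moreover have "card (shrink i ` F) \<le> k" using card_image_le[OF C(7), of "shrink i"] C(8) by simp
  moreover have "shrink i x \<notin> shrink i ` F" using C(9) by auto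
  ultimately show "\<exists>C R F. closed C \<and> closed R \<and> shrink i ` S = C \<union> R \<and> shrink i x \<in> C \<and> C \<inter> Y = {} \<and> C \<inter> R \<subseteq> F \<and>
      finite F \<and> card F \<le> k \<and> shrink i x \<notin> F"
    using C(4,7) by (intro exI[of _ "shrink i ` C"] exI[of _ "shrink i ` R"] exI[of _ "shrink i ` F"]) simp
qed

lemma narrow_child:
  assumes "wf_label l" "i \<in> letters l" "narrow (cell (child l i)) z k" "z \<notin> corner ` letters l"
  shows "narrow (cell l) (shrink i z) k"
proof (rule narrow_glue)
  show "narrow (shrink i ` cell (child l i)) (shrink i z) k"
    using assms compact_cell by (intro narrow_shrink) simp_all
  show "cell l = shrink i ` cell (child l i) \<union> rest l i" using cell_split assms by blast
  show "closed (rest l i)" using closed_rest assms by blast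
  show "shrink i ` cell (child l i) \<inter> rest l i \<subseteq> (\<lambda>j. shrink i (corner j)) ` letters l"
    using shrink_rest[of _ i l] cell_region by blast
  show "finite ((\<lambda>j. shrink i (corner j)) ` letters l)" using assms by simp
  show "shrink i z \<notin> (\<lambda>j. shrink i (corner j)) ` letters l" using assms(4) by auto
qed

lemma segpt_image_Int:
  assumes "i \<noteq> j" shows "segpt i j ` S \<inter> segpt i j ` T = segpt i j ` (S \<inter> T)"
proof (rule inj_on_image_Int[symmetric, of _ UNIV])
  show "inj (segpt i j)" using segpt_eval(2)[OF assms] by (metis injI)
qed auto

text \<open>A short piece of the edge around \<open>y\<close> can be left only through its two ends;
  it is chosen short enough to stay inside the edge and to avoid \<open>Y\<close>.\<close>

lemma edge_narrow: "edge l E \<Longrightarrow> wf_label l \<Longrightarrow> y \<in> E \<Longrightarrow> narrow (cell l) y 2"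
proof (induction arbitrary: y rule: edge.induct)
  case (mid i l j)
  obtain s where s: "1/3 < s" "s < 2/3" "y = segpt i j s" using mid.prems by (auto simp: mid_open_def)
  have seg_inj: "segpt i j t = segpt i j u \<longleftrightarrow> t = u" for t u using segpt_eval(2)[OF mid(3)] by metis
  show ?case
    unfolding narrow_def
  proof (intro allI impI)
    fix Y assume Y: "finite Y" "y \<notin> Y"
    have "finite {t. segpt i j t \<in> Y}"
      by (rule finite_imageD[of "segpt i j", OF finite_subset[OF _ Y(1)]]) (auto simp: inj_on_def seg_inj)
    then obtain d0 where d0: "d0 > 0" "\<And>t. segpt i j t \<in> Y \<Longrightarrow> t \<noteq> s \<Longrightarrow> d0 \<le> dist s t"
      using finite_set_avoid[of "{t. segpt i j t \<in> Y}" s] by auto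
    define d where "d = min (d0 / 2) (min ((s - 1/3) / 2) ((2/3 - s) / 2))"
    have d: "d > 0" "d < d0" "1/3 < s - d" "s + d < 2/3" using d0 s unfolding d_def by (auto simp: min_def field_simps)
    define C where "C = segpt i j ` {s - d..s + d}"
    define R where "R = (cell l - mid_open i j) \<union> segpt i j ` {1/3..s - d} \<union> segpt i j ` {s + d..2/3}"
    have Cm: "C \<subseteq> mid_open i j" using d by (auto simp: C_def mid_open_def)
    have cl: "closed (segpt i j ` {a..b})" for a b
      by (intro compact_imp_closed compact_continuous_image continuous_segpt) auto
    have "closed C" "closed R"
      unfolding C_def R_def by (intro closed_Un cl edge_closed[OF edge.mid[OF mid(1-3)] mid(4)])+
    moreover have "cell l = C \<union> R"
    proof
      have "mid_open i j \<subseteq> cell l" using edge_subset[OF edge.mid[OF mid(1-3)] mid(4)] .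
      moreover have "segpt i j ` {1/3..2/3} \<subseteq> cell l" using mid_closed_cell[OF mid(4,1,2)] by (simp add: mid_closed_def)
      ultimately show "C \<union> R \<subseteq> cell l" using Cm d unfolding R_def by (fastforce)
      show "cell l \<subseteq> C \<union> R"
      proof
        fix x assume x: "x \<in> cell l"
        show "x \<in> C \<union> R"
        proof (cases "x \<in> mid_open i j")
          case True
          then obtain t where "1/3 < t" "t < 2/3" "x = segpt i j t" by (auto simp: mid_open_def)
          then have "t \<in> {s - d..s + d} \<or> t \<in> {1/3..s - d} \<or> t \<in> {s + d..2/3}" by auto
          then show ?thesis using \<open>x = segpt i j t\<close> unfolding C_def R_def by blast
        next
          case False
          then show ?thesis using x unfolding R_def by blast
        qed
      qed
    qed
    moreover have "y \<in> C" using s d by (auto simp: C_def)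
    moreover have "C \<inter> Y = {}"
    proof (rule ccontr)
      assume "C \<inter> Y \<noteq> {}"
      then obtain t where t: "t \<in> {s - d..s + d}" "segpt i j t \<in> Y" unfolding C_def by blast
      then have "t \<noteq> s" using Y s by auto
      then have "d0 \<le> dist s t" using d0 t by blast
      then show False using t d by (auto simp: dist_real_def)
    qed
    moreover have "C \<inter> R \<subseteq> {segpt i j (s - d), segpt i j (s + d)}"
    proof -
      have "C \<inter> (cell l - mid_open i j) = {}" using Cm by blast
      moreover have "{s - d..s + d} \<inter> {1/3..s - d} \<subseteq> {s - d}" "{s - d..s + d} \<inter> {s + d..2/3} \<subseteq> {s + d}" by auto
      then have "C \<inter> segpt i j ` {1/3..s - d} \<subseteq> {segpt i j (s - d)}" "C \<inter> segpt i j ` {s + d..2/3} \<subseteq> {segpt i j (s + d)}"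
        unfolding C_def segpt_image_Int[OF mid(3)] by auto
      ultimately show ?thesis unfolding R_def by blast
    qed
    moreover have "card {segpt i j (s - d), segpt i j (s + d)} \<le> 2" by (simp add: card_insert_if)
    moreover have "y \<notin> {segpt i j (s - d), segpt i j (s + d)}" using s d by (auto simp: seg_inj)
    ultimately show "\<exists>C R F. closed C \<and> closed R \<and> cell l = C \<union> R \<and> y \<in> C \<and> C \<inter> Y = {} \<and> C \<inter> R \<subseteq> F \<and>
        finite F \<and> card F \<le> 2 \<and> y \<notin> F"
      by (intro exI[of _ C] exI[of _ R] exI[of _ "{segpt i j (s - d), segpt i j (s + d)}"]) simp
  qed
next
  case (sub i l E)
  obtain z where z: "z \<in> E" "y = shrink i z" using sub.prems by blast
  have "narrow (cell (child l i)) z 2" using sub.IH z sub.prems by simp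
  moreover have "z \<notin> corner ` letters l" using edge_corner[OF sub(2)] z by blast
  ultimately show ?case unfolding z(2) using sub.prems(1) sub(1) by (intro narrow_child)
qed

section \<open>Nested copies and the exact order of vertices\<close>

definition shrinks :: "nat list \<Rightarrow> (nat \<Rightarrow> real) \<Rightarrow> nat \<Rightarrow> real" where
  "shrinks w = foldr shrink w"

lemma shrinks_simps [simp]: "shrinks [] y = y" "shrinks (i # w) y = shrink i (shrinks w y)"
  by (simp_all add: shrinks_def)

text \<open>
  Junctions are the ends of the edges and the points where cells are glued.  They form a countable set, so it
  suffices to know the order at the other points.
\<close>

definition junctions :: "(nat \<Rightarrow> real) set" where
  "junctions = (\<lambda>(w, j). shrinks w (corner j)) ` UNIV"

lemma countable_junctions: "countable junctions"
  unfolding junctions_def by (rule countable_image) simp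

lemma corner_junction: "corner j \<in> junctions"
  unfolding junctions_def by (rule image_eqI[of _ _ "([], j)"]) simp_all

lemma shrink_junction: "z \<in> junctions \<Longrightarrow> shrink i z \<in> junctions"
proof -
  assume "z \<in> junctions"
  then obtain w j where "z = shrinks w (corner j)" unfolding junctions_def by auto
  then show ?thesis unfolding junctions_def by (intro image_eqI[of _ _ "(i # w, j)"]) simp_all
qed

lemma shrinks_region: "y \<in> region \<Longrightarrow> shrinks w y \<in> region"
  by (induction w) (simp_all add: shrink_region)

lemma shrinks_corner:
  assumes "corner j = shrinks w z" "z \<in> region" shows "z = corner j"
  using assms
proof (induction w)
  case (Cons i w)
  have "corner j = shrink i (shrinks w z)" "shrinks w z \<in> region"
    using Cons.prems shrinks_region by simp_all
  then have "corner j = shrinks w z" by (metis corner_eq_shrinkD)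
  then show ?case using Cons.IH Cons.prems(2) by simp
qed simp

lemma shrinks_dist:
  assumes "y \<in> region" "z \<in> region"
  shows "\<bar>shrinks w y j - shrinks w z j\<bar> \<le> (1/3) ^ length w"
proof (induction w)
  case Nil
  then show ?case using regionD(1,2)[OF assms(1), of j] regionD(1,2)[OF assms(2), of j] by (simp add: abs_if)
next
  case (Cons i w)
  have eq: "shrinks (i # w) y j - shrinks (i # w) z j = (shrinks w y j - shrinks w z j) / 3"
    by (simp add: shrink_def field_simps)
  show ?case unfolding eq using Cons by simp
qed

text \<open>When the hub is placed as the copy \<open>i\<close> into the next larger hub, new
  contacts arise only at its corners. A corner of the hub that lies in the nested copy is also a
  corner of that copy, by \<open>shrinks_corner\<close>.\<close>

lemma hub_split:
  assumes A: "finite A" and "set w \<subseteq> A"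
  shows "\<exists>R. closed R \<and> cell (Hub A) = shrinks w ` cell (Hub A) \<union> R \<and>
     shrinks w ` cell (Hub A) \<inter> R \<subseteq> shrinks w ` corner ` A"
  using assms(2)
proof (induction w)
  case Nil
  then show ?case by (intro exI[of _ "{}"]) simp
next
  case (Cons i w)
  obtain R where R: "closed R" "cell (Hub A) = shrinks w ` cell (Hub A) \<union> R"
    "shrinks w ` cell (Hub A) \<inter> R \<subseteq> shrinks w ` corner ` A" using Cons by auto
  have i: "i \<in> A" using Cons.prems by simp
  have split: "cell (Hub A) = shrink i ` cell (Hub A) \<union> rest (Hub A) i"
    using cell_split[of "Hub A" i] A i by simp
  have im: "shrinks (i # w) ` S = shrink i ` shrinks w ` S" for S by (auto simp: image_image)
  have "compact (cell (Hub A) \<inter> R)" using compact_cell[of "Hub A"] A R(1) by (simp add: compact_Int_closed)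
  moreover have "cell (Hub A) \<inter> R = R" using R(2) by blast
  ultimately have "closed (shrink i ` R \<union> rest (Hub A) i)"
    using closed_shrink_image closed_rest[of "Hub A" i] A by (simp add: closed_Un)
  moreover have "cell (Hub A) = shrinks (i # w) ` cell (Hub A) \<union> (shrink i ` R \<union> rest (Hub A) i)"
    unfolding im using split R(2) by blast
  moreover have "shrinks (i # w) ` cell (Hub A) \<inter> (shrink i ` R \<union> rest (Hub A) i) \<subseteq> shrinks (i # w) ` corner ` A"
  proof
    fix y assume y: "y \<in> shrinks (i # w) ` cell (Hub A) \<inter> (shrink i ` R \<union> rest (Hub A) i)"
    then obtain z where z: "z \<in> cell (Hub A)" "y = shrink i (shrinks w z)" by auto
    have zr: "z \<in> region" "shrinks w z \<in> region" using z cell_region shrinks_region by blast+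
    from y consider "y \<in> shrink i ` R" | "y \<in> rest (Hub A) i" by blast
    then show "y \<in> shrinks (i # w) ` corner ` A"
    proof cases
      case 1
      then have "shrinks w z \<in> R" using z by auto
      then have "shrinks w z \<in> shrinks w ` corner ` A" using R(3) z by blast
      then show ?thesis unfolding im using z by blast
    next
      case 2
      then obtain j where j: "j \<in> A" "shrinks w z = corner j" using shrink_rest[OF zr(2), of i "Hub A"] z by auto
      have "z = corner j" using shrinks_corner[OF j(2)[symmetric] zr(1)] .
      then have "y = shrinks (i # w) (corner j)" using z by simp
      then show ?thesis using j(1) by blast
    qed
  qed
  ultimately show ?case by (intro exI[of _ "shrink i ` R \<union> rest (Hub A) i"]) blast
qed

lemma hub_vert_word:
  assumes "y \<in> vert (Hub A)"
  shows "\<exists>w. length w = m \<and> set w \<subseteq> A \<and> y \<in> shrinks w ` vert (Hub A)"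
  using assms
proof (induction m arbitrary: y)
  case 0
  then show ?case by (intro exI[of _ "[]"]) simp
next
  case (Suc m)
  have "in_vert (Hub A) y" using Suc.prems by (simp add: vert_def)
  then show ?case
  proof cases
    case (sub i z)
    then have "z \<in> vert (Hub A)" by (simp add: vert_def)
    then obtain w where w: "length w = m" "set w \<subseteq> A" "z \<in> shrinks w ` vert (Hub A)" using Suc.IH by blast
    then show ?thesis using sub by (intro exI[of _ "i # w"]) (auto simp: image_iff)
  qed
qed

text \<open>Distance is measured by single coordinates, in which a nested copy of depth
  \<open>m\<close> has diameter at most \<open>(1/3)^m\<close>.\<close>

lemma finite_separated:
  fixes x :: "nat \<Rightarrow> real"
  assumes "finite Y" "x \<notin> Y"
  shows "\<exists>d>0. \<forall>y\<in>Y. \<exists>j. d < \<bar>y j - x j\<bar>"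
  using assms
proof (induction Y rule: finite_induct)
  case empty
  then show ?case by (intro exI[of _ 1]) simp
next
  case (insert y Y)
  then obtain d where d: "d > 0" "\<forall>y\<in>Y. \<exists>j. d < \<bar>y j - x j\<bar>" by auto
  obtain j where j: "y j \<noteq> x j" using insert.prems by (metis ext insertI1)
  define e where "e = min d (\<bar>y j - x j\<bar> / 2)"
  have "e > 0" "e \<le> d" "e < \<bar>y j - x j\<bar>" using d j by (auto simp: e_def min_def)
  moreover have "\<exists>j. e < \<bar>y' j - x j\<bar>" if "y' \<in> Y" for y'
    using d(2) that \<open>e \<le> d\<close> by (meson order_le_less_trans)
  ultimately show ?case by (intro exI[of _ e]) blast
qed

text \<open>A sufficiently deep nested copy around \<open>y\<close> misses \<open>Y\<close>, and
  only its \<open>card A\<close> corners lead out of it. They are junctions, hence different from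
  \<open>y\<close>.\<close>

lemma narrow_hub:
  assumes A: "finite A" and y: "y \<in> vert (Hub A)" "y \<notin> junctions"
  shows "narrow (cell (Hub A)) y (card A)"
  unfolding narrow_def
proof (intro allI impI)
  fix Y assume "finite Y" "y \<notin> Y"
  then obtain d where d: "d > 0" "\<forall>x\<in>Y. \<exists>j. d < \<bar>x j - y j\<bar>" using finite_separated by blast
  obtain m where m: "(1/3::real)^m < d" using real_arch_pow_inv[OF d(1), of "1/3"] by auto
  obtain w where w: "length w = m" "set w \<subseteq> A" "y \<in> shrinks w ` vert (Hub A)" using hub_vert_word[OF y(1)] by blast
  obtain R where R: "closed R" "cell (Hub A) = shrinks w ` cell (Hub A) \<union> R"
    "shrinks w ` cell (Hub A) \<inter> R \<subseteq> shrinks w ` corner ` A" using hub_split[OF A w(2)] by blast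
  have cont: "continuous_on S (shrinks w)" for S
    by (induction w) (auto simp: shrinks_def comp_def intro: continuous_on_compose2[OF continuous_shrink])
  have "closed (shrinks w ` cell (Hub A))"
    by (intro compact_imp_closed compact_continuous_image cont compact_cell) (simp add: A)
  moreover have "y \<in> shrinks w ` cell (Hub A)" using w(3) vert_subset_cell by blast
  moreover have "shrinks w ` cell (Hub A) \<inter> Y = {}"
  proof (rule ccontr)
    assume "shrinks w ` cell (Hub A) \<inter> Y \<noteq> {}"
    then obtain x where x: "x \<in> cell (Hub A)" "shrinks w x \<in> Y" by blast
    obtain z where z: "z \<in> vert (Hub A)" "y = shrinks w z" using w(3) by blast
    obtain j where "d < \<bar>shrinks w x j - y j\<bar>" using d(2) x(2) by blast
    moreover have "\<bar>shrinks w x j - shrinks w z j\<bar> \<le> (1/3)^m"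
      using shrinks_dist[of x z w j] x z cell_region vert_region w(1) by blast
    ultimately show False using m z by simp
  qed
  moreover have "finite (shrinks w ` corner ` A)" "card (shrinks w ` corner ` A) \<le> card A"
    using A card_image_le[of "corner ` A" "shrinks w"] card_image_le[OF A, of corner] by auto
  moreover have "y \<notin> shrinks w ` corner ` A" using y(2) unfolding junctions_def by auto
  ultimately show "\<exists>C R F. closed C \<and> closed R \<and> cell (Hub A) = C \<union> R \<and> y \<in> C \<and> C \<inter> Y = {} \<and> C \<inter> R \<subseteq> F \<and>
      finite F \<and> card F \<le> card A \<and> y \<notin> F"
    using R by (intro exI[of _ "shrinks w ` cell (Hub A)"] exI[of _ R] exI[of _ "shrinks w ` corner ` A"] conjI)
qed

text \<open>The sets are the rays from \<open>y\<close>. None is a single point, because each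
  contains a corner, which is a junction, and \<open>y\<close> is not.\<close>

lemma fan_vert:
  assumes "wf_label l" "y \<in> vert l" "y \<notin> junctions"
  shows "fan (top_of_set (cell l)) (card (letters l)) y"
proof -
  obtain c where c: "address l c" "\<And>i. y = ray i c 0" using vert_address[OF assms(2)] by blast
  obtain h where h: "bij_betw h {0..<card (letters l)} (letters l)"
    using ex_bij_betw_nat_finite[of "letters l"] assms(1) by auto
  have hl: "h i \<in> letters l" if "i < card (letters l)" for i using bij_betwE[OF h] that by simp
  have "connectedin (top_of_set (cell l)) (ray (h i) c ` {0..1}) \<and> y \<in> ray (h i) c ` {0..1} \<and> ray (h i) c ` {0..1} \<noteq> {y}"
    if i: "i < card (letters l)" for i
  proof (intro conjI)
    have "connected (ray (h i) c ` {0..1})"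
      by (intro connected_continuous_image continuous_ray) auto
    moreover have "ray (h i) c ` {0..1} \<subseteq> cell l" using ray_cell[OF assms(1) c(1) hl[OF i]] by auto
    ultimately show "connectedin (top_of_set (cell l)) (ray (h i) c ` {0..1})" by (simp add: connectedin_subtopology)
    show "y \<in> ray (h i) c ` {0..1}" using c(2)[of "h i"] by auto
    have "corner (h i) \<in> ray (h i) c ` {0..1}" using ray_1[of "h i" c] by (metis atLeastAtMost_iff image_eqI order_refl zero_le_one)
    then show "ray (h i) c ` {0..1} \<noteq> {y}" using assms(3) corner_junction[of "h i"] by auto
  qed
  moreover have "ray (h i) c ` {0..1} \<inter> ray (h j) c ` {0..1} = {y}"
    if "i < card (letters l)" "j < card (letters l)" "i \<noteq> j" for i j
  proof
    have hij: "h i \<noteq> h j" using h that unfolding bij_betw_def inj_on_def by auto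
    show "ray (h i) c ` {0..1} \<inter> ray (h j) c ` {0..1} \<subseteq> {y}"
    proof
      fix x assume "x \<in> ray (h i) c ` {0..1} \<inter> ray (h j) c ` {0..1}"
      then obtain s t where "s \<in> {0..1}" "t \<in> {0..1}" "x = ray (h i) c s" "x = ray (h j) c t" by auto
      then show "x \<in> {y}" using ray_inter[OF hij, of s t c] c(2)[of "h i"] by auto
    qed
    show "{y} \<subseteq> ray (h i) c ` {0..1} \<inter> ray (h j) c ` {0..1}" proof -
      have "y \<in> ray (h k) c ` {0..1}" for k
        unfolding c(2)[of "h k"] by (rule imageI) simp
      then show ?thesis by blast
    qed
  qed
  ultimately show ?thesis unfolding fan_def by (intro exI[of _ "\<lambda>i. ray (h i) c ` {0..1}"]) blast
qed

lemma exact_child: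
  assumes "wf_label l" "i \<in> letters l" "shrink i z \<notin> junctions"
    and "narrow (cell (child l i)) z k" "fan (top_of_set (cell (child l i))) k z"
  shows "narrow (cell l) (shrink i z) k \<and> fan (top_of_set (cell l)) k (shrink i z)"
proof
  have "z \<notin> corner ` letters l" using assms(3) shrink_junction corner_junction by blast
  then show "narrow (cell l) (shrink i z) k" using narrow_child assms by blast
  show "fan (top_of_set (cell l)) k (shrink i z)"
    using fan_shrink[OF assms(5), of i "cell l"] shrink_cellI assms(2) by blast
qed

lemma chain_head:
  assumes "wf_label (Chain B)" "z \<in> vert (Hub (B 0))" "shrink 1 z \<notin> junctions"
  shows "narrow (cell (Chain B)) (shrink 1 z) (card (B 0)) \<and> fan (top_of_set (cell (Chain B))) (card (B 0)) (shrink 1 z)"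
proof -
  have "z \<notin> junctions" using assms(3) shrink_junction by blast
  then show ?thesis
    using exact_child[of "Chain B" 1 z "card (B 0)"] narrow_hub[of "B 0" z] fan_vert[of "Hub (B 0)" z] assms by simp
qed

text \<open>Following the copies 0, a vertex either turns off into a hub after finitely many steps
  and has the order of that hub, or it stays within \<open>(1/3)^m\<close> of corner 0 for all
  \<open>m\<close>. But corner 0 is a junction.\<close>

lemma chain_exact:
  assumes "wf_label (Chain B)" "y \<in> vert (Chain B)" "y \<notin> junctions"
  shows "\<exists>s. narrow (cell (Chain B)) y (card (B s)) \<and> fan (top_of_set (cell (Chain B))) (card (B s)) y"
proof -
  have "(\<exists>s. narrow (cell (Chain B)) y (card (B s)) \<and> fan (top_of_set (cell (Chain B))) (card (B s)) y) \<or>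
      (\<forall>j. \<bar>y j - corner 0 j\<bar> \<le> (1/3)^m)" (is "?P B y \<or> ?Q y m")
    if "wf_label (Chain B)" "y \<in> vert (Chain B)" "y \<notin> junctions" for m B y
    using that
  proof (induction m arbitrary: B y)
    case 0
    have "y \<in> region" using 0 vert_region by blast
    then have "\<bar>y j - corner 0 j\<bar> \<le> 1" for j
      using regionD(1,2)[of y j] by (cases "j = 0") (auto simp: abs_le_iff)
    then show ?case by simp
  next
    case (Suc m)
    have "in_vert (Chain B) y" using Suc.prems by (simp add: vert_def)
    then show ?case
    proof cases
      case (sub i z)
      then have "i = 0 \<or> i = 1" by simp
      then show ?thesis
      proof
        assume i: "i = 1"
        then have "z \<in> vert (Hub (B 0))" using sub by (simp add: vert_def)
        then show ?thesis using chain_head[of B z] Suc.prems sub i by blast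
      next
        assume i: "i = 0"
        have wf: "wf_label (Chain (\<lambda>s. B (Suc s)))" using Suc.prems(1) by simp
        have z: "z \<in> vert (Chain (\<lambda>s. B (Suc s)))" using sub i by (simp add: vert_def)
        have nj: "z \<notin> junctions" using Suc.prems(3) sub shrink_junction by blast
        from Suc.IH[OF wf z nj] show ?thesis
        proof
          assume "?P (\<lambda>s. B (Suc s)) z"
          then obtain s where "narrow (cell (Chain (\<lambda>s. B (Suc s)))) z (card (B (Suc s)))"
            "fan (top_of_set (cell (Chain (\<lambda>s. B (Suc s))))) (card (B (Suc s))) z" by blast
          then have "?P B y"
            using exact_child[of "Chain B" 0 z "card (B (Suc s))"] Suc.prems sub i by auto
          then show ?thesis ..
        next
          assume Q: "?Q z m"
          have "\<bar>y j - corner 0 j\<bar> \<le> (1/3)^Suc m" for j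
          proof -
            have eq: "y j - corner 0 j = (z j - corner 0 j) / 3" using sub i by (simp add: shrink_def field_simps)
            show ?thesis unfolding eq using Q by simp
          qed
          then show ?thesis by blast
        qed
      qed
    qed
  qed
  note this[OF assms]
  moreover have False if Q: "\<And>m. ?Q y m"
  proof -
    have "\<bar>y j - corner 0 j\<bar> \<le> 0" for j
      using Q by (intro LIMSEQ_le_const[OF LIMSEQ_power_zero[of "1/3::real"]]) auto
    then have "y = corner 0" by (auto simp: fun_eq_iff)
    then show False using assms(3) corner_junction by blast
  qed
  ultimately show ?thesis by blast
qed

lemma chain_spot:
  assumes "wf_label (Chain B)" "z \<in> vert (Hub (B s))" "y = (shrink 0 ^^ s) (shrink 1 z)" "y \<notin> junctions"
  shows "y \<in> cell (Chain B) \<and> narrow (cell (Chain B)) y (card (B s)) \<and> fan (top_of_set (cell (Chain B))) (card (B s)) y"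
  using assms
proof (induction s arbitrary: B y)
  case 0
  have "y \<in> vert (Chain B)" using shrink_vertI[of z "Chain B" 1] 0 by simp
  then show ?case using chain_head[of B z] 0 vert_subset_cell by auto
next
  case (Suc s)
  define x where "x = (shrink 0 ^^ s) (shrink 1 z)"
  have y: "y = shrink 0 x" using Suc.prems by (simp add: x_def)
  have "x \<notin> junctions" using Suc.prems(4) y shrink_junction by blast
  then have IH: "x \<in> cell (Chain (\<lambda>s. B (Suc s)))" "narrow (cell (Chain (\<lambda>s. B (Suc s)))) x (card (B (Suc s)))"
    "fan (top_of_set (cell (Chain (\<lambda>s. B (Suc s))))) (card (B (Suc s))) x"
    using Suc.IH[of "\<lambda>s. B (Suc s)" x] Suc.prems(1,2) x_def by auto
  then show ?case
    using exact_child[of "Chain B" 0 x "card (B (Suc s))"] shrink_cellI[of x "Chain B" 0] Suc.prems y by simp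
qed

text \<open>Addresses in two letters encode the sets of naturals, and the address can be read off
  from the vertex because the copies are disjoint.\<close>

lemma uncountable_vert:
  assumes "a \<in> A" "b \<in> A" "a \<noteq> b"
  shows "uncountable (vert (Hub A))"
proof
  assume cnt: "countable (vert (Hub A))"
  define \<phi> where "\<phi> = (\<lambda>S :: nat set. ray 0 (\<lambda>k. if k \<in> S then a else b) 0)"
  have "address (Hub A) (\<lambda>k. if k \<in> S then a else b)" for S
  proof -
    have "lab (Hub A) c k = Hub A" for c k by (induction k) auto
    then show ?thesis using assms by (simp add: address_def)
  qed
  then have sub: "range \<phi> \<subseteq> vert (Hub A)" unfolding \<phi>_def using ray_vert by blast
  have inj: "c k = c' k" if "ray 0 c 0 = ray 0 c' 0" for c c' k
    using that
  proof (induction k arbitrary: c c')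
    case 0
    have "shrink (c 0) (ray 0 (\<lambda>k. c (Suc k)) 0) = shrink (c' 0) (ray 0 (\<lambda>k. c' (Suc k)) 0)"
      using 0 ray_low[of 0 0 c] ray_low[of 0 0 c'] by simp
    then show ?case using shrink_eq_shrink ray_0_region by blast
  next
    case (Suc k)
    have "shrink (c 0) (ray 0 (\<lambda>k. c (Suc k)) 0) = shrink (c' 0) (ray 0 (\<lambda>k. c' (Suc k)) 0)"
      using Suc.prems ray_low[of 0 0 c] ray_low[of 0 0 c'] by simp
    then have "ray 0 (\<lambda>k. c (Suc k)) 0 = ray 0 (\<lambda>k. c' (Suc k)) 0"
      using shrink_eq_shrink ray_0_region by blast
    then show ?case using Suc.IH[of "\<lambda>k. c (Suc k)" "\<lambda>k. c' (Suc k)"] by simp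
  qed
  have "inj \<phi>"
  proof (rule injI)
    fix S T assume "\<phi> S = \<phi> T"
    then have "(if k \<in> S then a else b) = (if k \<in> T then a else b)" for k
      using inj[of "\<lambda>k. if k \<in> S then a else b" "\<lambda>k. if k \<in> T then a else b" k] unfolding \<phi>_def by blast
    then have "k \<in> S \<longleftrightarrow> k \<in> T" for k using assms(3) by (metis (full_types))
    then show "S = T" by blast
  qed
  then have "countable (UNIV :: nat set set)"
    using countable_image_inj_on[OF countable_subset[OF sub cnt]] by blast
  then obtain f :: "nat \<Rightarrow> nat set" where "range f = UNIV"
    using uncountable_def[of "UNIV :: nat set set"] by auto
  moreover have "{k. k \<notin> f k} \<notin> range f" by blast
  ultimately show False by blast
qed

section \<open>Arcs and circles through slots\<close>

definition covers :: "'a::topological_space set \<Rightarrow> 'a \<Rightarrow> 'a \<Rightarrow> nat \<Rightarrow> bool" where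
  "covers T a b N \<longleftrightarrow> (\<forall>S. finite S \<and> card S \<le> N \<and> S \<subseteq> T \<longrightarrow> (\<exists>B. arc_between B a b \<and> B \<subseteq> T \<and> S \<subseteq> B))"

lemma covers_join:
  assumes "covers T a b N" "covers T' b c N" "T \<inter> T' \<subseteq> {b}"
  shows "covers (T \<union> T') a c N"
  unfolding covers_def
proof (intro allI impI)
  fix S assume S: "finite S \<and> card S \<le> N \<and> S \<subseteq> T \<union> T'"
  have "card (S \<inter> T) \<le> N" "card (S \<inter> T') \<le> N"
    using S card_mono[of S "S \<inter> T"] card_mono[of S "S \<inter> T'"] by auto
  then obtain B B' where B: "arc_between B a b" "B \<subseteq> T" "S \<inter> T \<subseteq> B" "arc_between B' b c" "B' \<subseteq> T'" "S \<inter> T' \<subseteq> B'"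
    using assms(1,2) S unfolding covers_def by (metis finite_Int inf_le2)
  then have "arc_between (B \<union> B') a c" using assms(3) by (intro arc_between_join[of B a b]) auto
  moreover have "B \<union> B' \<subseteq> T \<union> T'" "S \<subseteq> B \<union> B'" using B S by auto
  ultimately show "\<exists>B. arc_between B a c \<and> B \<subseteq> T \<union> T' \<and> S \<subseteq> B" by blast
qed

lemma covers_linear:
  assumes "linear N l a b"
  shows "covers (cell l) (corner a) (corner b) N"
  unfolding covers_def
proof (intro allI impI)
  fix S assume S: "finite S \<and> card S \<le> N \<and> S \<subseteq> cell l"
  then have "linked l {(a, b)} S" using linked_linear[OF assms] by blast
  then show "\<exists>B. arc_between B (corner a) (corner b) \<and> B \<subseteq> cell l \<and> S \<subseteq> B"
    unfolding linked_def by auto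
qed

lemma covers_link:
  assumes "a \<noteq> b" shows "covers (cell (Hub {a, b})) (corner a) (corner b) N"
  using assms by (intro covers_linear) (simp add: linear_def)

text \<open>The last clause allows the arc to replace a slot without touching the ends of the other
  slots.\<close>

lemma hub_arc:
  assumes "finite A" "20 * N + 20 \<le> card A" "finite S" "card S \<le> N" "S \<subseteq> cell (Hub A)" "a \<in> A" "b \<in> A" "a \<noteq> b"
  shows "\<exists>B. arc_between B (corner a) (corner b) \<and> B \<subseteq> cell (Hub A) \<and> S \<subseteq> B \<and>
    (\<forall>k. corner k \<in> B \<longrightarrow> k = a \<or> k = b \<or> corner k \<in> S)"
proof -
  have "linked (Hub A) {(a, b)} S"
    using assms by (intro linked_hub[of A N]) (auto simp: matching_def)
  then obtain B where B: "arc_between (B (a, b)) (corner a) (corner b)" "B (a, b) \<subseteq> cell (Hub A)" "S \<subseteq> B (a, b)"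
    "\<And>k. corner k \<in> B (a, b) \<Longrightarrow> k = a \<or> k = b \<or> corner k \<in> S"
    unfolding linked_def by auto
  then show ?thesis by blast
qed

text \<open>
  \<open>y\<close> differs from \<open>z\<close> only at the free ends of the outer slots, which are not on the hub \<open>H\<close>.
\<close>

lemma slot_arcs:
  fixes z :: "nat \<Rightarrow> 'a::t2_space" and T :: "nat \<Rightarrow> 'a set"
  assumes cov: "\<And>i. i \<le> m \<Longrightarrow> covers (T i) (z i) (z (Suc i)) (Suc m)"
    and M: "M \<subseteq> z ` {..Suc m}" and zM: "\<And>i. 1 \<le> i \<Longrightarrow> i \<le> m \<Longrightarrow> z i \<in> M"
    and TT: "\<And>i j. i \<le> m \<Longrightarrow> j \<le> m \<Longrightarrow> i \<noteq> j \<Longrightarrow> T i \<inter> T j \<subseteq> M"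
    and HT: "\<And>i. i \<le> m \<Longrightarrow> H \<inter> T i \<subseteq> {z i, z (Suc i)} \<inter> M"
    and link: "\<And>i S. i \<le> m \<Longrightarrow> finite S \<Longrightarrow> card S \<le> Suc m \<Longrightarrow> S \<subseteq> H - M \<Longrightarrow>
       \<exists>a b B. arc_between B a b \<and> B \<subseteq> H \<and> S \<subseteq> B \<and> (z i \<in> M \<longrightarrow> a = z i) \<and> (z (Suc i) \<in> M \<longrightarrow> b = z (Suc i)) \<and>
         B \<inter> M \<subseteq> {z i, z (Suc i)}"
    and S: "finite S" "card S \<le> Suc m" "S \<subseteq> H \<union> (\<Union>i\<le>m. T i)"
  shows "\<exists>B y. (\<forall>i\<le>m. arc_between (B i) (y i) (y (Suc i)) \<and> B i \<subseteq> H \<union> T i) \<and>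
     (\<forall>i\<le>Suc m. z i \<in> M \<longrightarrow> y i = z i) \<and>
     (\<forall>i\<le>m. \<forall>j\<le>m. i \<noteq> j \<longrightarrow> B i \<inter> B j \<subseteq> (T i \<inter> T j) \<union> ({z i, z (Suc i)} \<inter> {z j, z (Suc j)} \<inter> M)) \<and>
     S \<subseteq> (\<Union>i\<le>m. B i)"
proof -
  have "\<exists>B. arc_between B (z i) (z (Suc i)) \<and> B \<subseteq> T i \<and> S \<inter> T i \<subseteq> B" if "i \<le> m" for i
  proof -
    have "card (S \<inter> T i) \<le> Suc m" using S card_mono[of S "S \<inter> T i"] by auto
    then show ?thesis using cov[OF that] S(1) unfolding covers_def by (metis finite_Int inf_le2)
  qed
  then obtain B0 where B0: "\<And>i. i \<le> m \<Longrightarrow> arc_between (B0 i) (z i) (z (Suc i))" "\<And>i. i \<le> m \<Longrightarrow> B0 i \<subseteq> T i"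
    "\<And>i. i \<le> m \<Longrightarrow> S \<inter> T i \<subseteq> B0 i" by metis
  show ?thesis
  \<comment> \<open>A slot counts as free if its points of \<open>S\<close> all lie in
    \<open>M\<close>: points of \<open>M\<close> are ends of arcs in any case.\<close>
  proof (cases "\<exists>i\<le>m. S \<inter> T i \<subseteq> M")
    case True
    then obtain i0 where i0: "i0 \<le> m" "S \<inter> T i0 \<subseteq> M" by blast
    have "finite (S \<inter> H - M)" "card (S \<inter> H - M) \<le> Suc m" "S \<inter> H - M \<subseteq> H - M"
    proof -
      have "card (S \<inter> H - M) \<le> card S" using S(1) by (intro card_mono) auto
      then show "card (S \<inter> H - M) \<le> Suc m" using S(2) by simp
    qed (use S in auto)
    then obtain a b C where C: "arc_between C a b" "C \<subseteq> H" "S \<inter> H - M \<subseteq> C" "z i0 \<in> M \<Longrightarrow> a = z i0"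
      "z (Suc i0) \<in> M \<Longrightarrow> b = z (Suc i0)" "C \<inter> M \<subseteq> {z i0, z (Suc i0)}"
      using link[OF i0(1)] by metis
    define B where "B = (\<lambda>i. if i = i0 then C else B0 i)"
    define y where "y = (\<lambda>i. if i = i0 then a else if i = Suc i0 then b else z i)"
    have yz: "y i = z i" if "z i \<in> M" for i using that C(4,5) by (auto simp: y_def)
    have arcs: "arc_between (B i) (y i) (y (Suc i)) \<and> B i \<subseteq> H \<union> T i" if i: "i \<le> m" for i
    proof (cases "i = i0")
      case True
      then show ?thesis using C(1,2) by (auto simp: B_def y_def)
    next
      case False
      have "y i = z i"
      proof (cases "i = Suc i0")
        case True
        then show ?thesis using zM[of i] yz i by simp
      qed (use False in \<open>simp add: y_def\<close>)
      moreover have "y (Suc i) = z (Suc i)"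
      proof (cases "Suc i = i0")
        case True
        then show ?thesis using zM[of "Suc i"] yz i0 by simp
      qed (use False in \<open>simp add: y_def\<close>)
      ultimately show ?thesis using B0(1,2)[OF i] False by (auto simp: B_def)
    qed
    have meet0: "C \<inter> B0 j \<subseteq> {z i0, z (Suc i0)} \<inter> {z j, z (Suc j)} \<inter> M" if "j \<le> m" for j
      using HT[OF that] B0(2)[OF that] C(2,6) by blast
    have meet: "B i \<inter> B j \<subseteq> (T i \<inter> T j) \<union> ({z i, z (Suc i)} \<inter> {z j, z (Suc j)} \<inter> M)"
      if ij: "i \<le> m" "j \<le> m" "i \<noteq> j" for i j
    proof -
      consider "i = i0" "j \<noteq> i0" | "j = i0" "i \<noteq> i0" | "i \<noteq> i0" "j \<noteq> i0" using ij(3) by blast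
      then show ?thesis
      proof cases
        case 1
        then show ?thesis using meet0[OF ij(2)] by (auto simp: B_def)
      next
        case 2
        then show ?thesis using meet0[OF ij(1)] by (auto simp: B_def)
      next
        case 3
        then show ?thesis using B0(2)[OF ij(1)] B0(2)[OF ij(2)] by (auto simp: B_def)
      qed
    qed
    have "S \<subseteq> (\<Union>i\<le>m. B i)"
    proof
      fix s assume s: "s \<in> S"
      show "s \<in> (\<Union>i\<le>m. B i)"
      proof (cases "s \<in> M")
        case True
        then obtain k where k: "k \<le> Suc m" "s = z k" using M by blast
        show ?thesis
        proof (cases "k \<le> m")
          case True
          then have "y k \<in> B k" using arcs arc_between_mem by blast
          then show ?thesis using yz[of k] k \<open>s \<in> M\<close> True by auto
        next
          case False
          then have "k = Suc m" using k by simp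
          moreover have "y (Suc m) \<in> B m" using arcs[of m] arc_between_mem by blast
          ultimately show ?thesis using yz[of k] k \<open>s \<in> M\<close> by auto
        qed
      next
        case False
        from S(3) s consider "s \<in> H" | j where "j \<le> m" "s \<in> T j" by blast
        then show ?thesis
        proof cases
          case 1
          then have "s \<in> B i0" using C(3) s False by (auto simp: B_def)
          then show ?thesis using i0 by blast
        next
          case (2 j)
          then have "j \<noteq> i0" using i0(2) s False by blast
          then have "s \<in> B j" using B0(3)[OF 2(1)] s 2 by (auto simp: B_def)
          then show ?thesis using 2 by blast
        qed
      qed
    qed
    then show ?thesis using arcs yz meet by (intro exI[of _ B] exI[of _ y]) simp
  next
    \<comment> \<open>Each of the \<open>m + 1\<close> slots now has its own point of
      \<open>S\<close> outside \<open>M\<close>. As \<open>S\<close> has at most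
      \<open>m + 1\<close> points, these are all, and the arcs in the slots already cover
      \<open>S\<close>.\<close>
    case False
    then have "\<forall>i\<in>{..m}. \<exists>s. s \<in> S \<and> s \<in> T i \<and> s \<notin> M" by auto
    from bchoice[OF this] obtain s where s: "\<And>i. i \<le> m \<Longrightarrow> s i \<in> S \<and> s i \<in> T i \<and> s i \<notin> M" by auto
    have "inj_on s {..m}"
    proof (rule inj_onI)
      fix i j assume ij: "i \<in> {..m}" "j \<in> {..m}" "s i = s j"
      then have "s i \<in> T i \<inter> T j" "s i \<notin> M" using s[of i] s[of j] by auto
      then show "i = j" using TT[of i j] ij by auto
    qed
    then have "card (s ` {..m}) = Suc m" by (simp add: card_image)
    moreover have "s ` {..m} \<subseteq> S" using s by auto
    ultimately have "s ` {..m} = S" using S(1,2) by (metis card_seteq)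
    then have "S \<subseteq> (\<Union>i\<le>m. B0 i)" using s B0(3) by fastforce
    moreover have "B0 i \<inter> B0 j \<subseteq> T i \<inter> T j" if "i \<le> m" "j \<le> m" for i j using B0(2) that by blast
    ultimately show ?thesis using B0 by (intro exI[of _ B0] exI[of _ z]) blast
  qed
qed

section \<open>Counting crossings of arcs and circles with a finite set\<close>

lemma between_points:
  fixes T :: "real set"
  assumes "finite T" "T \<noteq> {}" "\<And>s t. s \<in> T \<Longrightarrow> t \<in> T \<Longrightarrow> s < t \<Longrightarrow> \<exists>u\<in>U. s < u \<and> u < t"
  shows "\<exists>V\<subseteq>U. finite V \<and> card V = card T - 1 \<and> (\<forall>u\<in>V. Min T < u \<and> u < Max T)"
  using assms
proof (induction T rule: finite_linorder_max_induct)
  case (insert b A)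
  show ?case
  proof (cases "A = {}")
    case True
    then show ?thesis by (intro exI[of _ "{}"]) simp
  next
    case False
    then obtain V where V: "V \<subseteq> U" "finite V" "card V = card A - 1" "\<forall>u\<in>V. Min A < u \<and> u < Max A"
      using insert.IH insert.prems(2) by auto
    have "Max A \<in> A" "Max A < b" using False insert.hyps by auto
    then obtain u where u: "u \<in> U" "Max A < u" "u < b" using insert.prems(2)[of "Max A" b] by auto
    have "Max (insert b A) = b" using False insert.hyps \<open>Max A < b\<close> by simp
    moreover have "Min (insert b A) = Min A"
    proof -
      have "Min A \<in> A" using False insert.hyps by simp
      then have "Min A < b" using insert.hyps by blast
      then show ?thesis using False insert.hyps by simp
    qed
    moreover have "Min A \<le> Max A" using False insert.hyps by simp
    moreover have "u \<notin> V" using V(4) u by auto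
    moreover have "card A \<ge> 1" using False insert.hyps by (simp add: Suc_leI card_gt_0_iff)
    moreover have "b \<notin> A" using insert.hyps by blast
    ultimately show ?thesis
      using V u insert.hyps
      by (intro exI[of _ "insert u V"]) auto
  qed
qed simp

text \<open>If the stretch avoided \<open>Z\<close>, then \<open>Q i\<close> and the union of the
  other pieces would split its connected image into two disjoint closed parts.\<close>

lemma crossing:
  fixes g :: "real \<Rightarrow> 'a::t2_space"
  assumes g: "continuous_on {a..b} g" "a < b" and I: "finite I" "\<And>i. i \<in> I \<Longrightarrow> closed (Q i)"
    and sub: "g ` {a..b} \<subseteq> (\<Union>i\<in>I. Q i)"
    and meet: "\<And>i j. i \<in> I \<Longrightarrow> j \<in> I \<Longrightarrow> i \<noteq> j \<Longrightarrow> Q i \<inter> Q j \<subseteq> Z"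
    and ends: "i \<in> I" "j \<in> I" "i \<noteq> j" "g a \<in> Q i - Z" "g b \<in> Q j - Z"
  shows "\<exists>u. a < u \<and> u < b \<and> g u \<in> Z"
proof (rule ccontr)
  assume n: "\<not> ?thesis"
  have nz: "g u \<notin> Z" if "u \<in> {a..b}" for u
    using n ends that by (cases "u = a"; cases "u = b") auto
  define R where "R = (\<Union>k\<in>I - {i}. Q k)"
  have "closed R" unfolding R_def using I by (intro closed_UN) auto
  moreover have "closed (Q i)" using I ends by blast
  moreover have "g ` {a..b} \<subseteq> Q i \<union> R" using sub unfolding R_def by blast
  moreover have "Q i \<inter> R \<inter> g ` {a..b} = {}" using nz meet[OF ends(1)] unfolding R_def by blast
  moreover have "Q i \<inter> g ` {a..b} \<noteq> {}" using ends(4) g(2) by force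
  moreover have "g b \<in> R" using ends unfolding R_def by blast
  then have "R \<inter> g ` {a..b} \<noteq> {}" using g(2) by force
  moreover have "connected (g ` {a..b})" using g(1) by (intro connected_continuous_image) auto
  ultimately show False unfolding connected_closed by blast
qed

lemma parameters:
  assumes I: "finite I" "\<And>i. i \<in> I \<Longrightarrow> q i \<in> Q i - Z"
    and meet: "\<And>i j. i \<in> I \<Longrightarrow> j \<in> I \<Longrightarrow> i \<noteq> j \<Longrightarrow> Q i \<inter> Q j \<subseteq> Z"
    and t: "\<And>i. i \<in> I \<Longrightarrow> g (t i) = q i"
  shows "inj_on t I"
proof (rule inj_onI)
  fix i j assume ij: "i \<in> I" "j \<in> I" "t i = t j"
  then have "q i = q j" using t by metis
  then have "q i \<in> Q i \<inter> Q j" "q i \<notin> Z" using I(2)[OF ij(1)] I(2)[OF ij(2)] by auto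
  then show "i = j" using meet ij by blast
qed

text \<open>The points \<open>q i\<close> have different parameters, and between neighbouring ones
  the arc changes the piece and so crosses \<open>Z\<close>. These \<open>card I - 1\<close>
  crossings are different points because the arc is injective.\<close>

lemma arc_pieces:
  fixes A :: "'a::t2_space set"
  assumes A: "arc_between A a b" "A \<subseteq> (\<Union>i\<in>I. Q i)" and I: "finite I" "\<And>i. i \<in> I \<Longrightarrow> closed (Q i)"
    and meet: "\<And>i j. i \<in> I \<Longrightarrow> j \<in> I \<Longrightarrow> i \<noteq> j \<Longrightarrow> Q i \<inter> Q j \<subseteq> Z"
    and q: "\<And>i. i \<in> I \<Longrightarrow> q i \<in> Q i - Z" "q ` I \<subseteq> A" and Z: "finite Z"
  shows "card I \<le> card Z + 1"
proof (cases "I = {}")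
  case False
  obtain g where g: "arc g" "path_image g = A" using A(1) unfolding arc_between_def by blast
  have "\<exists>t. t \<in> {0..1} \<and> g t = q i" if "i \<in> I" for i
    using q(2) that g(2) unfolding path_image_def by (metis image_iff subsetD)
  then obtain t where t: "\<And>i. i \<in> I \<Longrightarrow> t i \<in> {0..1}" "\<And>i. i \<in> I \<Longrightarrow> g (t i) = q i" by metis
  have inj: "inj_on t I" using parameters[of I q Q Z g t] I q meet t by blast
  define U where "U = {u \<in> {0..1}. g u \<in> Z}"
  have cont: "continuous_on {0..1} g" using g(1) by (simp add: arc_def path_def)
  have im: "g ` {0..1} \<subseteq> (\<Union>i\<in>I. Q i)" using g(2) A(2) unfolding path_image_def by blast
  have "\<exists>V\<subseteq>U. finite V \<and> card V = card (t ` I) - 1 \<and> (\<forall>u\<in>V. Min (t ` I) < u \<and> u < Max (t ` I))"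
  proof (rule between_points)
    fix s s' assume s: "s \<in> t ` I" "s' \<in> t ` I" "s < s'"
    then obtain i j where ij: "i \<in> I" "j \<in> I" "s = t i" "s' = t j" by blast
    have sub: "{s..s'} \<subseteq> {0..1}" using t(1)[OF ij(1)] t(1)[OF ij(2)] ij by auto
    have "\<exists>u. s < u \<and> u < s' \<and> g u \<in> Z"
    proof (rule crossing)
      show "continuous_on {s..s'} g" using cont sub continuous_on_subset by blast
      show "g ` {s..s'} \<subseteq> (\<Union>i\<in>I. Q i)" using im sub by blast
      show "i \<noteq> j" using s ij by auto
      show "g s \<in> Q i - Z" "g s' \<in> Q j - Z" using ij t(2) q(1) by auto
    qed (use s ij I meet in auto)
    then obtain u where u: "s < u" "u < s'" "g u \<in> Z" by blast
    then have "u \<in> {s..s'}" by simp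
    then have "u \<in> U" using sub u(3) unfolding U_def by blast
    then show "\<exists>u\<in>U. s < u \<and> u < s'" using u by blast
  qed (use False I in auto)
  then obtain V where V: "V \<subseteq> U" "card V = card (t ` I) - 1" by blast
  have "card (t ` I) = card I" using inj by (rule card_image)
  moreover have "inj_on g V" using g(1) V(1) unfolding arc_def U_def inj_on_def by blast
  then have "card V \<le> card Z" using V(1) Z by (intro card_inj_on_le[of g]) (auto simp: U_def)
  ultimately show ?thesis using V(2) by simp
qed simp

text \<open>The start is prescribed so that in \<open>loop_pieces\<close> one of the chosen points
  gets parameter 0.\<close>

lemma circle_parametrisation:
  fixes C :: "'a::t2_space set"
  assumes "C homeomorphic sphere (0::complex) 1" "x \<in> C"
  obtains g :: "real \<Rightarrow> 'a" where "continuous_on {0..1} g" "g ` {0..1} = C" "g 0 = x" "g 1 = x" "inj_on g {0..<1}"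
proof -
  obtain h k where hk: "homeomorphism (sphere (0::complex) 1) C h k"
    using assms(1) homeomorphic_sym unfolding homeomorphic_def by blast
  obtain w where w: "cmod w = 1" "h w = x" using hk assms(2) unfolding homeomorphism_def by (auto simp: image_iff)
  define e where "e = (\<lambda>t. w * exp (of_real (2 * pi * t) * \<i>))"
  have e_mem: "e t \<in> sphere 0 1" for t using w by (simp add: e_def norm_mult)
  have cont: "continuous_on S e" for S unfolding e_def by (intro continuous_intros)
  have im: "e ` {0..<1} = sphere 0 1"
  proof
    show "e ` {0..<1} \<subseteq> sphere 0 1" using e_mem by blast
    show "sphere 0 1 \<subseteq> e ` {0..<1}"
    proof
      fix v :: complex assume v: "v \<in> sphere 0 1"
      have "cmod (v / w) = 1" using v w by (simp add: norm_divide)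
      then obtain t where t: "0 \<le> t" "t < 2 * pi" "v / w = exp (\<i> * of_real t)"
        using complex_norm_eq_1_exp[of "v / w"] by (metis Arg2pi_ge_0 Arg2pi_lt_2pi complex_norm_eq_1_exp)
      have "e (t / (2 * pi)) = w * (v / w)" unfolding e_def t(3) by (simp add: mult.commute)
      then have "v = e (t / (2 * pi))" using w by auto
      moreover have "t / (2 * pi) \<in> {0..<1}" using t by auto
      ultimately show "v \<in> e ` {0..<1}" by blast
    qed
  qed
  have "exp (of_real (2 * pi * 1) * \<i>) = (1 :: complex)" using exp_two_pi_i by simp
  then have e01: "e 0 = w" "e 1 = w" unfolding e_def by simp_all
  have im1: "e ` {0..1} = sphere 0 1"
    using im e_mem by (metis atLeastLessThan_subseteq_atLeastAtMost_iff image_mono image_subsetI order_refl subset_antisym)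
  have inj: "inj_on e {0..<1}"
  proof (rule inj_onI)
    fix s t assume st: "s \<in> {0..<1}" "t \<in> {0..<1}" "e s = e t"
    then have "exp (of_real (2 * pi * s) * \<i>) = exp (of_real (2 * pi * t) * \<i>)" using w by (auto simp: e_def)
    then obtain n :: int where "of_real (2 * pi * s) * \<i> = of_real (2 * pi * t) * \<i> + (of_int (2 * n) * pi) * \<i>"
      using exp_eq by blast
    then have "Im (of_real (2 * pi * s) * \<i>) = Im (of_real (2 * pi * t) * \<i> + (of_int (2 * n) * pi) * \<i>)" by simp
    then have "2 * pi * s = 2 * pi * t + 2 * of_int n * pi" by simp
    then have "pi * (s - t - of_int n) = 0" by (simp add: algebra_simps)
    then have "s = t + of_int n" by simp
    then have "of_int n < (1::real)" "(-1::real) < of_int n" using st by auto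
    then have "n = 0" by linarith
    then show "s = t" using \<open>s = t + of_int n\<close> by simp
  qed
  have injh: "inj_on h (sphere 0 1)" using hk unfolding homeomorphism_def by (metis inj_on_inverseI)
  have conth: "continuous_on (sphere 0 1) h" "h ` sphere 0 1 = C" using hk unfolding homeomorphism_def by auto
  show ?thesis
  proof (rule that[of "h \<circ> e"])
    show "continuous_on {0..1} (h \<circ> e)" using cont conth(1) by (intro continuous_on_compose) (simp_all add: im1)
    show "(h \<circ> e) ` {0..1} = C" unfolding image_comp[symmetric] im1 conth(2) ..
    show "(h \<circ> e) 0 = x" "(h \<circ> e) 1 = x" using e01 w by simp_all
    show "inj_on (h \<circ> e) {0..<1}" using inj injh by (intro comp_inj_on) (simp_all add: im)
  qed
qed

text \<open>There is one crossing more than for an arc: after the last parameter the circle has to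
  return to its start \<open>q i0\<close>, which lies in a different piece since there are at least
  two.\<close>

lemma loop_pieces:
  fixes C :: "'a::t2_space set"
  assumes C: "C homeomorphic sphere (0::complex) 1" "C \<subseteq> (\<Union>i\<in>I. Q i)"
    and I: "finite I" "2 \<le> card I" "\<And>i. i \<in> I \<Longrightarrow> closed (Q i)"
    and meet: "\<And>i j. i \<in> I \<Longrightarrow> j \<in> I \<Longrightarrow> i \<noteq> j \<Longrightarrow> Q i \<inter> Q j \<subseteq> Z"
    and q: "\<And>i. i \<in> I \<Longrightarrow> q i \<in> Q i - Z" "q ` I \<subseteq> C" and Z: "finite Z"
  shows "card I \<le> card Z"
proof -
  obtain i0 where i0: "i0 \<in> I" using I(2) by fastforce
  then have "q i0 \<in> C" using q(2) by blast
  then obtain g :: "real \<Rightarrow> 'a" where g: "continuous_on {0..1} g" "g ` {0..1} = C" "g 0 = q i0" "g 1 = q i0" "inj_on g {0..<1}"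
    using circle_parametrisation[OF C(1)] by blast
  have "\<exists>t. t \<in> {0..<1} \<and> g t = q i" if i: "i \<in> I" for i
  proof -
    obtain t where t: "t \<in> {0..1}" "g t = q i" using q(2) i g(2) by (metis image_iff subsetD)
    show ?thesis
    proof (cases "t = 1")
      case True
      then show ?thesis using t g by (intro exI[of _ 0]) simp
    next
      case False
      then show ?thesis using t by (intro exI[of _ t]) auto
    qed
  qed
  then obtain t where t: "\<And>i. i \<in> I \<Longrightarrow> t i \<in> {0..<1}" "\<And>i. i \<in> I \<Longrightarrow> g (t i) = q i" by metis
  have inj: "inj_on t I" using parameters[of I q Q Z g t] I q meet t by blast
  have t0: "t i0 = 0" using g(5) t[OF i0] g(3) unfolding inj_on_def by auto
  define U where "U = {u \<in> {0..<1}. g u \<in> Z}"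
  have cross: "\<exists>u. s < u \<and> u < s' \<and> g u \<in> Z"
    if "i \<in> I" "j \<in> I" "i \<noteq> j" "s = t i" "g s' = q j" "s < s'" "s' \<le> 1" for i j s s'
  proof (rule crossing)
    have sub: "{s..s'} \<subseteq> {0..1}" using t(1)[OF that(1)] that by auto
    show "continuous_on {s..s'} g" using g(1) sub continuous_on_subset by blast
    show "g ` {s..s'} \<subseteq> (\<Union>i\<in>I. Q i)" using g(2) C(2) sub by blast
    show "g s \<in> Q i - Z" "g s' \<in> Q j - Z" using that t(2) q(1) by auto
  qed (use that I meet in auto)
  have "\<exists>V\<subseteq>U. finite V \<and> card V = card (t ` I) - 1 \<and> (\<forall>u\<in>V. Min (t ` I) < u \<and> u < Max (t ` I))"
  proof (rule between_points)
    fix s s' assume s: "s \<in> t ` I" "s' \<in> t ` I" "s < s'"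
    then obtain i j where ij: "i \<in> I" "j \<in> I" "s = t i" "s' = t j" by blast
    have "0 \<le> s" "s' < 1" using t(1)[OF ij(1)] t(1)[OF ij(2)] ij by auto
    moreover obtain u where "s < u" "u < s'" "g u \<in> Z"
      using cross[of i j s s'] ij s t(2) \<open>s' < 1\<close> by auto
    ultimately show "\<exists>u\<in>U. s < u \<and> u < s'" unfolding U_def by (intro bexI[of _ u]) auto
  qed (use I i0 in auto)
  then obtain V where V: "V \<subseteq> U" "finite V" "card V = card (t ` I) - 1" "\<forall>u\<in>V. u < Max (t ` I)" by blast
  have ct: "card (t ` I) = card I" using inj by (rule card_image)
  have "Max (t ` I) \<in> t ` I" using I(1) i0 by (intro Max_in) auto
  then obtain j where j: "j \<in> I" "t j = Max (t ` I)" by auto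
  have "j \<noteq> i0"
  proof
    assume "j = i0"
    then have "t i = 0" if "i \<in> I" for i
    proof -
      have "t i \<le> Max (t ` I)" using I(1) that by (intro Max_ge) auto
      moreover have "Max (t ` I) = 0" using j(2) t0 \<open>j = i0\<close> by simp
      ultimately show ?thesis using t(1)[OF that] by simp
    qed
    then have "t ` I \<subseteq> {0}" by auto
    then have "card (t ` I) \<le> 1" using card_mono[of "{0}" "t ` I"] by simp
    then show False using ct I(2) by simp
  qed
  then obtain u where u: "t j < u" "u < 1" "g u \<in> Z"
    using cross[of j i0 "t j" 1] j i0 g(4) t(1)[OF j(1)] by auto
  have "u \<in> U" using u t(1)[OF j(1)] by (auto simp: U_def)
  moreover have "u \<notin> V" using V(4) u j by auto
  moreover have "inj_on g (insert u V)"
    using inj_on_subset[OF g(5)] V(1) \<open>u \<in> U\<close> unfolding U_def by blast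
  then have "card (insert u V) \<le> card Z" using V(1) Z u by (intro card_inj_on_le[of g]) (auto simp: U_def)
  ultimately show ?thesis using V ct I(2) by simp
qed

text \<open>Any two points lie on a common arc. The connectedness that a continuum requires is
  obtained in this way.\<close>

lemma n_ac_connected:
  assumes "n_ac n (top_of_set X)" "2 \<le> n"
  shows "connected (X :: 'a::t2_space set)"
  unfolding connected_iff_connected_component
proof (intro ballI)
  fix x y assume xy: "x \<in> X" "y \<in> X"
  have "card {x, y} \<le> n" using assms(2) by (simp add: card_insert_if)
  then obtain A where A: "arc_in (top_of_set X) A" "{x, y} \<subseteq> A"
    using assms(1)[unfolded n_ac_def, rule_format, of "{x, y}"] xy by auto
  obtain a b where "arc_between A a b" "A \<subseteq> X" using arc_in_imp_arc_between[OF A(1)] by blast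
  then show "connected_component X x y"
    unfolding connected_component_def using A(2) arc_between_connected by blast
qed

lemma n_cc_connected:
  assumes "n_cc n (top_of_set X)" "2 \<le> n"
  shows "connected (X :: 'a::t2_space set)"
  unfolding connected_iff_connected_component
proof (intro ballI)
  fix x y assume xy: "x \<in> X" "y \<in> X"
  have "card {x, y} \<le> n" using assms(2) by (simp add: card_insert_if)
  then obtain A where A: "simple_closed_curve_in (top_of_set X) A" "{x, y} \<subseteq> A"
    using assms(1)[unfolded n_cc_def, rule_format, of "{x, y}"] xy by auto
  then have AX: "A \<subseteq> X" "A homeomorphic sphere (0::complex) 1"
    unfolding simple_closed_curve_in_def
    by (simp_all add: subtopology_subtopology homeomorphic_space_top_of_set) (metis inf.absorb2)
  have "connected A" using homeomorphic_connectedness[OF AX(2)] connected_sphere[of "0::complex" 1] by simp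
  then show "connected_component X x y"
    unfolding connected_component_def using A(2) \<open>A \<subseteq> X\<close> by blast
qed

lemma arc_between_infinite: "arc_between A a b \<Longrightarrow> infinite A"
proof
  assume "arc_between A a b" "finite A"
  then obtain g :: "real \<Rightarrow> 'a" where "inj_on g {0..1}" "g ` {0..1} = A"
    unfolding arc_between_def arc_def path_image_def by blast
  then have "finite {0..1::real}" using \<open>finite A\<close> finite_imageD by blast
  then show False using infinite_Icc[of 0 "1::real"] by simp
qed

lemma cell_meet:
  assumes "y \<in> cell l" "y \<in> cell l'" "support l \<inter> support l' \<subseteq> C" "finite C" "card C \<le> 1"
  shows "y \<in> corner ` C"
proof (cases "C = {}")
  case True
  then show ?thesis using cell_inter_empty[of l l'] assms by blast
next
  case False
  then obtain c where "C = {c}" using assms(4,5) by (metis card_1_singletonE card_gt_0_iff le_antisym Suc_leI One_nat_def)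
  then show ?thesis using cell_inter[of l l' c] assms by auto
qed

section \<open>The spaces\<close>

definition evens :: "nat \<Rightarrow> nat set" where
  "evens D = (\<lambda>j. 2 * j) ` {..<D}"

text \<open>
  The \<open>s\<close>-th hub of the chain has \<open>D + 1 + s\<close> corners if \<open>s \<in> A\<close>, and \<open>D\<close> corners otherwise.  Using even letters for the
  main hub and odd ones for the chain makes the two meet only in the corner \<open>0\<close>.
\<close>

definition spots :: "nat \<Rightarrow> nat set \<Rightarrow> nat \<Rightarrow> nat set" where
  "spots D A s = insert 0 ((\<lambda>j. 2 * j + 1) ` {..<if s \<in> A then D + s else D - 1})"

definition pieces :: "nat \<Rightarrow> (nat \<times> nat) set \<Rightarrow> nat set \<Rightarrow> label set" where
  "pieces D G A = {Hub (evens D), Chain (spots D A)} \<union> (\<lambda>(i, j). Hub {i, j}) ` G"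

definition hub_space :: "nat \<Rightarrow> (nat \<times> nat) set \<Rightarrow> nat set \<Rightarrow> (nat \<Rightarrow> real) set" where
  "hub_space D G A = (\<Union>l\<in>pieces D G A. cell l)"

text \<open>The links are segments between corners. Sharing at most one letter with the main hub and
  at most one with the chain, they meet either of them in at most one corner, as
  \<open>cell_meet\<close> shows.\<close>

definition admissible :: "nat \<Rightarrow> (nat \<times> nat) set \<Rightarrow> bool" where
  "admissible D G \<longleftrightarrow> 3 \<le> D \<and> finite G \<and>
     (\<forall>(i, j)\<in>G. i \<noteq> j \<and> card ({i, j} \<inter> evens D) \<le> 1 \<and> card ({i, j} \<inter> ({0} \<union> {k. odd k})) \<le> 1)"

lemma finite_evens [simp]: "finite (evens D)" and card_evens [simp]: "card (evens D) = D"
  by (simp_all add: evens_def card_image inj_on_def)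

lemma mem_evens [simp]: "2 * j \<in> evens D \<longleftrightarrow> j < D"
  by (auto simp: evens_def)

lemma odd_evens: "odd k \<Longrightarrow> k \<notin> evens D"
  by (auto simp: evens_def)

lemma finite_spots [simp]: "finite (spots D A s)"
  by (simp add: spots_def)

lemma card_spots: "2 \<le> D \<Longrightarrow> card (spots D A s) = (if s \<in> A then D + 1 + s else D)"
  unfolding spots_def by (subst card_insert_disjoint) (auto simp: card_image inj_on_def)

lemma spots_subset: "spots D A s \<subseteq> {0} \<union> {k. odd k}"
  by (auto simp: spots_def)

lemma spots_mem: "2 \<le> D \<Longrightarrow> 0 \<in> spots D A s \<and> 1 \<in> spots D A s"
  by (auto simp: spots_def image_iff intro!: bexI[of _ 0])

lemma support_chain: "support (Chain (spots D A)) \<subseteq> {0} \<union> {k. odd k}"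
  using spots_subset by auto

lemma wf_chain: "2 \<le> D \<Longrightarrow> wf_label (Chain (spots D A))"
  using spots_mem by simp

lemma pieces_wf:
  assumes "admissible D G" "l \<in> pieces D G A"
  shows "wf_label l \<and> letters l \<noteq> {}"
proof -
  have D: "3 \<le> D" using assms(1) by (simp add: admissible_def)
  consider "l = Hub (evens D)" | "l = Chain (spots D A)" | i j where "l = Hub {i, j}"
    using assms(2) by (auto simp: pieces_def)
  then show ?thesis
  proof cases
    case 1
    have "2 * 0 \<in> evens D" using D by (subst mem_evens) simp
    then show ?thesis using 1 by auto
  next
    case 2
    then show ?thesis using wf_chain[of D A] D by simp
  qed simp
qed

lemma finite_pieces: "admissible D G \<Longrightarrow> finite (pieces D G A)"
  by (simp add: admissible_def pieces_def)

lemma pieces_support: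
  assumes G: "admissible D G" and l: "l \<in> pieces D G A" "l' \<in> pieces D G A" "l \<noteq> l'"
  shows "\<exists>C. support l \<inter> support l' \<subseteq> C \<and> finite C \<and> card C \<le> 1"
proof -
  have main_chain: "support (Hub (evens D)) \<inter> support (Chain (spots D A)) \<subseteq> {0}"
  proof -
    have "evens D \<inter> ({0} \<union> {k. odd k}) \<subseteq> {0}" using odd_evens by blast
    then show ?thesis using support_chain[of D A] by (simp only: support.simps(1)) blast
  qed
  have main_link: "finite ({i, j} \<inter> evens D) \<and> card ({i, j} \<inter> evens D) \<le> 1" if "(i, j) \<in> G" for i j
    using G that by (auto simp: admissible_def)
  have chain_link: "finite ({i, j} \<inter> ({0} \<union> {k. odd k})) \<and> card ({i, j} \<inter> ({0} \<union> {k. odd k})) \<le> 1" if "(i, j) \<in> G" for i j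
    using G that by (auto simp: admissible_def)
  have link_link: "finite ({i, j} \<inter> {i', j'}) \<and> card ({i, j} \<inter> {i', j'}) \<le> 1"
    if "(i, j) \<in> G" "(i', j') \<in> G" "{i, j} \<noteq> {i', j'}" for i j i' j'
  proof -
    have ne: "i \<noteq> j" "i' \<noteq> j'" using G that by (auto simp: admissible_def)
    have "\<not> 2 \<le> card ({i, j} \<inter> {i', j'})"
    proof
      assume "2 \<le> card ({i, j} \<inter> {i', j'})"
      then have "{i, j} \<inter> {i', j'} = {i, j}" "{i, j} \<inter> {i', j'} = {i', j'}"
        using ne by (intro card_seteq; simp)+
      then show False using that(3) by simp
    qed
    then show ?thesis by simp
  qed
  have cases: "k = Hub (evens D) \<or> k = Chain (spots D A) \<or> (\<exists>i j. (i, j) \<in> G \<and> k = Hub {i, j})"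
    if "k \<in> pieces D G A" for k using that by (auto simp: pieces_def)
  have ml: "\<exists>C. support (Hub (evens D)) \<inter> support (Hub {i, j}) \<subseteq> C \<and> finite C \<and> card C \<le> 1" if "(i, j) \<in> G" for i j
    using main_link[OF that] by (intro exI[of _ "{i, j} \<inter> evens D"]) auto
  have cl: "\<exists>C. support (Chain (spots D A)) \<inter> support (Hub {i, j}) \<subseteq> C \<and> finite C \<and> card C \<le> 1" if "(i, j) \<in> G" for i j
    using chain_link[OF that] support_chain[of D A]
    by (intro exI[of _ "{i, j} \<inter> ({0} \<union> {k. odd k})"]) (auto simp del: support.simps(2))
  have ll: "\<exists>C. support (Hub {i, j}) \<inter> support (Hub {i', j'}) \<subseteq> C \<and> finite C \<and> card C \<le> 1"
    if "(i, j) \<in> G" "(i', j') \<in> G" "Hub {i, j} \<noteq> Hub {i', j'}" for i j i' j'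
    using link_link[OF that(1,2)] that(3) by (intro exI[of _ "{i, j} \<inter> {i', j'}"]) auto
  have mc: "\<exists>C. support (Hub (evens D)) \<inter> support (Chain (spots D A)) \<subseteq> C \<and> finite C \<and> card C \<le> 1"
    using main_chain by (intro exI[of _ "{0}"]) simp
  show ?thesis
    using cases[OF l(1)] cases[OF l(2)] l(3)
    by (elim disjE exE conjE; simp only: Int_commute; use mc ml cl ll in \<open>metis Int_commute\<close>)
qed

lemma pieces_meet:
  assumes "admissible D G" "l \<in> pieces D G A" "l' \<in> pieces D G A" "l \<noteq> l'"
  shows "cell l \<inter> cell l' \<subseteq> range corner \<and> finite (cell l \<inter> cell l')"
proof -
  obtain C where C: "support l \<inter> support l' \<subseteq> C" "finite C" "card C \<le> 1"
    using pieces_support[OF assms] by blast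
  then have "cell l \<inter> cell l' \<subseteq> corner ` C" using cell_meet by blast
  then show ?thesis using C(2) by (meson finite_imageI finite_subset image_mono order_trans subset_UNIV)
qed

lemma space_graph_like:
  assumes "admissible D G" "connected (hub_space D G A)"
  shows "graph_like_continuum (top_of_set (hub_space D G A))"
  unfolding hub_space_def
proof (rule cells_graph_like)
  show "finite (pieces D G A)" "pieces D G A \<noteq> {}" using finite_pieces[OF assms(1)] by (auto simp: pieces_def)
  show "wf_label l \<and> letters l \<noteq> {}" if "l \<in> pieces D G A" for l using pieces_wf[OF assms(1) that] .
  show "cell l \<inter> cell l' \<subseteq> range corner" if "l \<in> pieces D G A" "l' \<in> pieces D G A" "l \<noteq> l'" for l l'
    using pieces_meet[OF assms(1) that] by blast
  show "connected (\<Union>l\<in>pieces D G A. cell l)" using assms(2) by (simp add: hub_space_def)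
qed

section \<open>Telling the spaces apart by the order of their points\<close>

lemma narrow_space:
  assumes G: "admissible D G" and l: "l \<in> pieces D G A" "y \<notin> junctions" "narrow (cell l) y k"
  shows "narrow (hub_space D G A) y k"
proof (rule narrow_glue[OF l(3)])
  define R where "R = (\<Union>l'\<in>pieces D G A - {l}. cell l')"
  show "hub_space D G A = cell l \<union> R" using l(1) by (auto simp: hub_space_def R_def)
  show "closed R" unfolding R_def using finite_pieces[OF G] pieces_wf[OF G] closed_cell by (intro closed_UN) auto
  have eq: "cell l \<inter> R = (\<Union>l'\<in>pieces D G A - {l}. cell l \<inter> cell l')" by (auto simp: R_def)
  show "cell l \<inter> R \<subseteq> cell l \<inter> R" ..
  show "finite (cell l \<inter> R)" unfolding eq using finite_pieces[OF G] pieces_meet[OF G l(1)] by (intro finite_UN_I) auto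
  have "cell l \<inter> R \<subseteq> range corner" unfolding eq using pieces_meet[OF G l(1)] by blast
  then show "y \<notin> cell l \<inter> R" using l(2) corner_junction by blast
qed

text \<open>Outside the junctions, the order is at most 2 on edges, at most \<open>D\<close> at
  vertices of the main hub and of links, and \<open>D\<close> or \<open>D + 1 + s'\<close> with
  \<open>s' \<in> A\<close> at vertices of the chain. So the order \<open>D + 1 + s\<close> with
  \<open>s \<notin> A\<close> is left to junctions.\<close>

lemma countable_order_space:
  assumes G: "admissible D G" and s: "s \<notin> A"
  shows "countable (order_points (top_of_set (hub_space D G A)) (D + 1 + s))"
proof -
  have D: "3 \<le> D" using G by (simp add: admissible_def)
  have "x \<in> junctions" if x: "x \<in> order_points (top_of_set (hub_space D G A)) (D + 1 + s)" for x
  proof (rule ccontr)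
    assume nj: "x \<notin> junctions"
    have fx: "x \<in> hub_space D G A" "fan (top_of_set (hub_space D G A)) (D + 1 + s) x" "\<not> fan (top_of_set (hub_space D G A)) (Suc (D + 1 + s)) x"
      using x by (simp_all add: order_points_def)
    obtain l where l: "l \<in> pieces D G A" "x \<in> cell l" using fx(1) by (auto simp: hub_space_def)
    have bound: "D + 1 + s \<le> k" if "narrow (cell l) x k" for k
    proof (rule ccontr)
      assume "\<not> D + 1 + s \<le> k"
      then have "fan (top_of_set (hub_space D G A)) (Suc k) x" using fan_antimono[OF fx(2), of "Suc k"] by simp
      then show False using narrow_not_fan[OF narrow_space[OF G l(1) nj that]] by blast
    qed
    show False
    proof (cases "x \<in> vert l")
      case False
      then have "x \<in> \<Union>{E. edge l E}" using cell_vert_edge[of l] pieces_wf[OF G l(1)] l(2) by blast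
      then obtain E where "edge l E" "x \<in> E" by blast
      then have "narrow (cell l) x 2" using edge_narrow pieces_wf[OF G l(1)] by blast
      then show False using bound D by fastforce
    next
      case True
      consider B where "l = Hub B" "finite B" "card B \<le> D" | "l = Chain (spots D A)"
      proof -
        have "card {i, j} \<le> D" for i j :: nat using D by (simp add: card_insert_if)
        then show ?thesis using l(1) that by (auto simp: pieces_def)
      qed
      then show False
      proof cases
        case (1 B)
        then have "narrow (cell l) x (card B)" using narrow_hub True nj by simp
        then show False using bound 1(3) by fastforce
      next
        case 2
        then obtain s' where s': "narrow (cell l) x (card (spots D A s'))" "fan (top_of_set (cell l)) (card (spots D A s')) x"
          using chain_exact[OF wf_chain[of D A]] True nj D by auto
        have "cell l \<subseteq> hub_space D G A" using l(1) by (auto simp: hub_space_def)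
        then have fan: "fan (top_of_set (hub_space D G A)) (card (spots D A s')) x" by (rule fan_subset[OF _ s'(2)])
        have "\<not> Suc (D + 1 + s) \<le> card (spots D A s')"
        proof
          assume "Suc (D + 1 + s) \<le> card (spots D A s')"
          then show False using fan_antimono[OF fan] fx(3) by simp
        qed
        then have "card (spots D A s') = D + 1 + s" using bound[OF s'(1)] by simp
        then have "s' \<in> A \<and> s' = s" using card_spots[of D A s'] D by (simp split: if_splits)
        then show False using s by blast
      qed
    qed
  qed
  then show ?thesis using countable_subset[OF _ countable_junctions] by blast
qed

text \<open>The \<open>s\<close>-th hub of the chain supplies these points: all its vertices apart
  from countably many junctions.\<close>

lemma uncountable_order_space:
  assumes G: "admissible D G" and s: "s \<in> A"
  shows "uncountable (order_points (top_of_set (hub_space D G A)) (D + 1 + s))"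
proof -
  have D: "2 \<le> D" using G by (simp add: admissible_def)
  define F where "F = (\<lambda>z. (shrink 0 ^^ s) (shrink 1 z))"
  have c: "Chain (spots D A) \<in> pieces D G A" by (simp add: pieces_def)
  have inj0: "inj (shrink 0 ^^ s)"
    by (induction s) (auto simp: inj_on_def)
  have "F = (shrink 0 ^^ s) \<circ> shrink 1" by (auto simp: F_def)
  moreover have "inj (shrink 1)" by (auto simp: inj_on_def)
  ultimately have "inj F" using inj_compose[OF inj0] by simp
  have "uncountable (vert (Hub (spots D A s)))"
    using uncountable_vert[of 0 _ 1] spots_mem[OF D] by simp
  then have "uncountable (F ` vert (Hub (spots D A s)))"
    using countable_image_inj_on[of F "vert (Hub (spots D A s))"] inj_on_subset[OF \<open>inj F\<close>] by blast
  then have "uncountable (F ` vert (Hub (spots D A s)) - junctions)"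
    using countable_junctions by (rule uncountable_minus_countable)
  moreover have "F ` vert (Hub (spots D A s)) - junctions \<subseteq> order_points (top_of_set (hub_space D G A)) (D + 1 + s)"
  proof
    fix y assume y: "y \<in> F ` vert (Hub (spots D A s)) - junctions"
    then obtain z where "z \<in> vert (Hub (spots D A s))" "y = (shrink 0 ^^ s) (shrink 1 z)" unfolding F_def by blast
    then have e: "y \<in> cell (Chain (spots D A))" "narrow (cell (Chain (spots D A))) y (card (spots D A s))"
      "fan (top_of_set (cell (Chain (spots D A)))) (card (spots D A s)) y"
      using chain_spot[OF wf_chain[OF D], of z A s y] y by blast+
    have sub: "cell (Chain (spots D A)) \<subseteq> hub_space D G A" using c by (auto simp: hub_space_def)
    have "card (spots D A s) = D + 1 + s" using card_spots[OF D] s by simp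
    then show "y \<in> order_points (top_of_set (hub_space D G A)) (D + 1 + s)"
      using e sub fan_subset[OF sub e(3)] narrow_not_fan[OF narrow_space[OF G c _ e(2)]] y
      by (auto simp: order_points_def)
  qed
  ultimately show ?thesis using countable_subset by blast
qed

lemma space_not_homeomorphic:
  assumes "admissible D G" "A \<noteq> A'"
  shows "\<not> top_of_set (hub_space D G A) homeomorphic_space top_of_set (hub_space D G A')"
proof -
  have aux: "\<not> top_of_set (hub_space D G A) homeomorphic_space top_of_set (hub_space D G A')"
    if "s \<in> A" "s \<notin> A'" for s A A'
    using countable_order_points[OF _ countable_order_space[OF assms(1) that(2)]]
      uncountable_order_space[OF assms(1) that(1)] by blast
  obtain s where "(s \<in> A \<and> s \<notin> A') \<or> (s \<in> A' \<and> s \<notin> A)" using assms(2) by blast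
  then show ?thesis using aux homeomorphic_space_sym by blast
qed

lemma continuum_many_spaces:
  assumes G: "admissible D G" and P: "\<And>A. P (top_of_set (hub_space D G A))"
  shows "continuum_many_nonhomeomorphic P"
  unfolding continuum_many_nonhomeomorphic_def
proof (intro exI[of _ "range (\<lambda>A. top_of_set (hub_space D G A))"] conjI)
  have "inj (\<lambda>A. top_of_set (hub_space D G A))"
  proof (rule injI, rule ccontr)
    fix A A' assume "top_of_set (hub_space D G A) = top_of_set (hub_space D G A')" "A \<noteq> A'"
    then show False using space_not_homeomorphic[OF G] homeomorphic_space_refl by metis
  qed
  then show "range (\<lambda>A. top_of_set (hub_space D G A)) \<approx> (UNIV :: nat set set)"
    by (rule inj_on_image_eqpoll_self)
  show "\<forall>X\<in>range (\<lambda>A. top_of_set (hub_space D G A)). P X" using P by blast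
  show "pairwise (\<lambda>X Y. \<not> X homeomorphic_space Y) (range (\<lambda>A. top_of_set (hub_space D G A)))"
  proof (rule pairwiseI)
    fix X Y assume "X \<in> range (\<lambda>A. top_of_set (hub_space D G A))" "Y \<in> range (\<lambda>A. top_of_set (hub_space D G A))" "X \<noteq> Y"
    then obtain A A' where "X = top_of_set (hub_space D G A)" "Y = top_of_set (hub_space D G A')" "A \<noteq> A'" by blast
    then show "\<not> X homeomorphic_space Y" using space_not_homeomorphic[OF G] by simp
  qed
qed

text \<open>A slot between neighbouring corners of the main hub. It makes a detour over the corner
  \<open>2 * (D + i)\<close> outside the hub, because the direct segment between the two corners
  lies in the hub.\<close>

definition bridge :: "nat \<Rightarrow> nat \<Rightarrow> (nat \<Rightarrow> real) set" where
  "bridge D i = cell (Hub {2 * i, 2 * (D + i)}) \<union> cell (Hub {2 * (D + i), 2 * Suc i})"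

definition bridge_links :: "nat \<Rightarrow> nat \<Rightarrow> (nat \<times> nat) set" where
  "bridge_links D m = (\<Union>i<m. {(2 * i, 2 * (D + i)), (2 * (D + i), 2 * Suc i)})"

lemma cell_meet_single: "y \<in> cell l \<Longrightarrow> y \<in> cell l' \<Longrightarrow> support l \<inter> support l' \<subseteq> {c} \<Longrightarrow> y = corner c"
  using cell_inter by blast

lemma cell_meet_empty: "y \<in> cell l \<Longrightarrow> y \<in> cell l' \<Longrightarrow> support l \<inter> support l' = {} \<Longrightarrow> False"
  using cell_inter_empty by blast

lemma bridge_covers:
  assumes "1 < D" shows "covers (bridge D i) (corner (2 * i)) (corner (2 * Suc i)) N"
  unfolding bridge_def
proof (rule covers_join)
  show "covers (cell (Hub {2 * i, 2 * (D + i)})) (corner (2 * i)) (corner (2 * (D + i))) N"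
    "covers (cell (Hub {2 * (D + i), 2 * Suc i})) (corner (2 * (D + i))) (corner (2 * Suc i)) N"
    using assms by (intro covers_link; simp)+
  show "cell (Hub {2 * i, 2 * (D + i)}) \<inter> cell (Hub {2 * (D + i), 2 * Suc i}) \<subseteq> {corner (2 * (D + i))}"
    using assms by (intro cell_inter) auto
qed

lemma bridge_bridge:
  assumes "y \<in> bridge D i" "y \<in> bridge D j" "i < j" "Suc j < D"
  shows "j = Suc i \<and> y = corner (2 * j)"
proof -
  obtain a b where ab: "a \<in> {{2 * i, 2 * (D + i)}, {2 * (D + i), 2 * Suc i}}" "b \<in> {{2 * j, 2 * (D + j)}, {2 * (D + j), 2 * Suc j}}"
    "y \<in> cell (Hub a)" "y \<in> cell (Hub b)" using assms(1,2) unfolding bridge_def by blast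
  have sub: "support (Hub a) \<inter> support (Hub b) \<subseteq> (if j = Suc i then {2 * j} else {})"
    using ab(1,2) assms(3,4) by (elim insertE emptyE) auto
  show ?thesis
  proof (cases "j = Suc i")
    case True
    then show ?thesis using cell_meet_single[OF ab(3,4)] sub by simp
  next
    case False
    then show ?thesis using cell_meet_empty[OF ab(3,4)] sub by simp
  qed
qed

lemma bridge_main:
  assumes "y \<in> bridge D i" "y \<in> cell (Hub (evens D))"
  shows "y = corner (2 * i) \<or> y = corner (2 * Suc i)"
proof -
  have no: "2 * (D + i) \<notin> evens D" by (subst mem_evens) simp
  have "{2 * i, 2 * (D + i)} \<inter> evens D \<subseteq> {2 * i}" "{2 * (D + i), 2 * Suc i} \<inter> evens D \<subseteq> {2 * Suc i}"
    using no by blast+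
  then show ?thesis
    using assms cell_meet_single[of y "Hub {2 * i, 2 * (D + i)}" "Hub (evens D)" "2 * i"]
      cell_meet_single[of y "Hub {2 * (D + i), 2 * Suc i}" "Hub (evens D)" "2 * Suc i"]
    unfolding bridge_def by auto
qed

lemma bridge_chain:
  assumes "y \<in> bridge D i" "y \<in> cell (Chain (spots D A))" "0 < D"
  shows "i = 0 \<and> y = corner 0"
proof -
  obtain a where a: "a \<in> {{2 * i, 2 * (D + i)}, {2 * (D + i), 2 * Suc i}}" "y \<in> cell (Hub a)"
    using assms(1) unfolding bridge_def by blast
  have "a \<inter> ({0} \<union> {k. odd k}) \<subseteq> (if i = 0 then {0} else {})"
    using a(1) assms(3) by (elim insertE emptyE) auto
  then have sub: "support (Hub a) \<inter> support (Chain (spots D A)) \<subseteq> (if i = 0 then {0} else {})"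
    using support_chain[of D A] by (auto simp del: support.simps(2))
  show ?thesis
  proof (cases "i = 0")
    case True
    then show ?thesis using cell_meet_single[OF a(2) assms(2)] sub by simp
  next
    case False
    then show ?thesis using cell_meet_empty[OF a(2) assms(2)] sub by simp
  qed
qed

lemma chain_main:
  assumes "y \<in> cell (Chain (spots D A))" "y \<in> cell (Hub (evens D))"
  shows "y = corner 0"
proof (rule cell_meet_single[OF assms])
  show "support (Chain (spots D A)) \<inter> support (Hub (evens D)) \<subseteq> {0}"
    using support_chain[of D A] odd_evens[of _ D] by (auto simp del: support.simps(2))
qed

lemma chain_covers:
  assumes "20 * N + 20 \<le> D"
  shows "covers (cell (Chain (spots D A))) (corner 1) (corner 0) N"
proof (rule covers_linear)
  have "2 \<le> D" using assms by simp
  then show "linear N (Chain (spots D A)) 1 0"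
    using wf_chain[of D A] card_spots[of D A] assms unfolding linear_def by auto
qed

lemma bridge_links_admissible:
  assumes "(i, j) \<in> bridge_links D m" "0 < D"
  shows "i \<noteq> j \<or> D = 1" "card ({i, j} \<inter> evens D) \<le> 1" "card ({i, j} \<inter> ({0} \<union> {k. odd k})) \<le> 1"
proof -
  obtain k where k: "(i = 2 * k \<and> j = 2 * (D + k)) \<or> (i = 2 * (D + k) \<and> j = 2 * Suc k)"
    using assms(1) unfolding bridge_links_def by blast
  have no: "2 * (D + k) \<notin> evens D" by (subst mem_evens) simp
  show "i \<noteq> j \<or> D = 1" using k assms(2) by auto
  have le: "card C \<le> 1" if "C \<subseteq> {c}" for C :: "nat set" and c using card_mono[OF _ that] by simp
  from k show "card ({i, j} \<inter> evens D) \<le> 1"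
  proof
    assume "i = 2 * k \<and> j = 2 * (D + k)"
    then show ?thesis using no by (intro le[of _ "2 * k"]) auto
  next
    assume "i = 2 * (D + k) \<and> j = 2 * Suc k"
    then show ?thesis using no by (intro le[of _ "2 * Suc k"]) auto
  qed
  show "card ({i, j} \<inter> ({0} \<union> {k. odd k})) \<le> 1"
    using k assms(2) by (intro le[of _ 0]) auto
qed

lemma bridges_space:
  "(\<Union>(i, j)\<in>bridge_links D m. cell (Hub {i, j})) = (\<Union>i<m. bridge D i)"
  unfolding bridge_links_def bridge_def by auto

text \<open>The extra link from \<open>2 * m\<close> to 1, followed by the chain from 1 to 0, is the
  slot that closes the row of \<open>m\<close> bridges to a circle.\<close>

definition cc_links :: "nat \<Rightarrow> nat \<Rightarrow> (nat \<times> nat) set" where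
  "cc_links D m = insert (2 * m, 1) (bridge_links D m)"

text \<open>The extra link is the last slot. Its far corner is new, as the bridges use only
  \<open>D + i\<close> with \<open>i < m\<close>; the free end of the first slot is corner 1 of the
  chain.\<close>

definition ac_links :: "nat \<Rightarrow> nat \<Rightarrow> (nat \<times> nat) set" where
  "ac_links D m = insert (2 * m, 2 * (D + Suc m)) (bridge_links D m)"

lemma finite_bridge_links: "finite (bridge_links D m)"
  by (simp add: bridge_links_def)

lemma card_le_1I: "C \<subseteq> {c} \<Longrightarrow> card C \<le> 1"
  using card_mono[of "{c}" C] by simp

lemma admissible_cc:
  assumes "3 \<le> D" "0 < m" shows "admissible D (cc_links D m)"
proof -
  have "card ({2 * m, 1} \<inter> evens D) \<le> 1" using odd_evens[of 1 D] by (intro card_le_1I[of _ "2 * m"]) auto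
  moreover have "card ({2 * m, 1} \<inter> ({0} \<union> {k. odd k})) \<le> 1" using assms by (intro card_le_1I[of _ 1]) auto
  moreover have "2 * m \<noteq> 1" by presburger
  ultimately show ?thesis
    using assms finite_bridge_links bridge_links_admissible[of _ _ D m]
    unfolding admissible_def cc_links_def by fastforce
qed

lemma admissible_ac:
  assumes "3 \<le> D" shows "admissible D (ac_links D m)"
proof -
  have no: "2 * (D + Suc m) \<notin> evens D" by (subst mem_evens) simp
  have "card ({2 * m, 2 * (D + Suc m)} \<inter> evens D) \<le> 1" using no by (intro card_le_1I[of _ "2 * m"]) auto
  moreover have "card ({2 * m, 2 * (D + Suc m)} \<inter> ({0} \<union> {k. odd k})) \<le> 1" using assms by (intro card_le_1I[of _ 0]) auto
  moreover have "2 * m \<noteq> 2 * (D + Suc m)" by simp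
  ultimately show ?thesis
    using assms finite_bridge_links bridge_links_admissible[of _ _ D m]
    unfolding admissible_def ac_links_def by fastforce
qed

lemma slot_infinite:
  assumes "covers T a b N" shows "infinite T"
proof -
  obtain B where "arc_between B a b" "B \<subseteq> T" using assms unfolding covers_def by (metis card.empty empty_subsetI finite.emptyI le0)
  then show ?thesis using arc_between_infinite finite_subset by blast
qed

lemma cc_space:
  assumes n: "n = Suc m" "0 < m" "D = 20 * n + 20"
  shows "n_cc n (top_of_set (hub_space D (cc_links D m) A)) \<and> \<not> n_cc (n + 1) (top_of_set (hub_space D (cc_links D m) A))"
proof -
  define H where "H = cell (Hub (evens D))"
  define Ch where "Ch = cell (Chain (spots D A))"
  define L where "L = cell (Hub {2 * m, 1})"
  \<comment> \<open>\<open>z 0\<close> and \<open>z (Suc m)\<close> coincide, since the slots form a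
    cycle; it begins with the decorated slot.\<close>
  define z where "z = (\<lambda>i. case i of 0 \<Rightarrow> corner (2 * m) | Suc j \<Rightarrow> corner (2 * j))"
  define T where "T = (\<lambda>i. case i of 0 \<Rightarrow> L \<union> Ch | Suc j \<Rightarrow> bridge D j)"
  define M where "M = z ` {..Suc m}"
  define X where "X = hub_space D (cc_links D m) A"
  have z: "z 0 = corner (2 * m)" "z (Suc j) = corner (2 * j)" for j by (simp_all add: z_def)
  have T: "T 0 = L \<union> Ch" "T (Suc j) = bridge D j" for j by (simp_all add: T_def)
  have X: "X = H \<union> (\<Union>i\<le>m. T i)"
  proof -
    have "X = H \<union> Ch \<union> L \<union> (\<Union>(i, j)\<in>bridge_links D m. cell (Hub {i, j}))"
      unfolding X_def hub_space_def pieces_def cc_links_def H_def Ch_def L_def by auto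
    also have "\<dots> = H \<union> (T 0 \<union> (\<Union>i<m. T (Suc i)))" unfolding bridges_space T by blast
    also have "T 0 \<union> (\<Union>i<m. T (Suc i)) = (\<Union>i\<le>m. T i)"
      by (simp add: lessThan_Suc_atMost[symmetric] lessThan_Suc_eq_insert_0 del: lessThan_Suc)
    finally show ?thesis .
  qed
  have D: "1 < D" "m < D" "Suc m < D" using n by simp_all
  have LC: "y = corner 1" if "y \<in> L" "y \<in> Ch" for y
  proof (rule cell_meet_single)
    show "support (Hub {2 * m, 1}) \<inter> support (Chain (spots D A)) \<subseteq> {1}"
      using support_chain[of D A] n by (auto simp del: support.simps(2))
  qed (use that in \<open>simp_all add: L_def Ch_def\<close>)
  have LH: "y = corner (2 * m)" if "y \<in> L" "y \<in> H" for y
  proof (rule cell_meet_single)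
    show "support (Hub {2 * m, 1}) \<inter> support (Hub (evens D)) \<subseteq> {2 * m}" using odd_evens[of 1 D] by auto
  qed (use that in \<open>simp_all add: L_def H_def\<close>)
  have LB: "y = corner (2 * m)" if "y \<in> L" and yB: "y \<in> bridge D j" and "j < m" for y j
  proof -
    obtain a where a: "a \<in> {{2 * j, 2 * (D + j)}, {2 * (D + j), 2 * Suc j}}" "y \<in> cell (Hub a)"
      using yB unfolding bridge_def by blast
    have "Suc 0 \<noteq> 2 * D + 2 * j" "Suc 0 \<noteq> 2 * j" by presburger+
    then have "support (Hub {2 * m, 1}) \<inter> support (Hub a) \<subseteq> {2 * m}" using a(1) by (elim insertE emptyE) auto
    then show ?thesis using cell_meet_single[of y "Hub {2 * m, 1}" "Hub a"] a(2) that(1) by (simp add: L_def)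
  qed
  have T0: "T 0 \<inter> T (Suc j) \<subseteq> {z 0, z 1}" if "j < m" for j
    using LB[OF _ _ that] bridge_chain[of _ D j A] D z(1) z(2)[of 0] unfolding T Ch_def by auto
  have TB: "T (Suc i) \<inter> T (Suc j) \<subseteq> (if j = Suc i then {z (Suc j)} else {})" if "i < j" "j < m" for i j
    using bridge_bridge[of _ D i j] that D unfolding T z by auto
  have zM: "z i \<in> M" if "i \<le> Suc m" for i using that by (simp add: M_def)
  have TT: "T i \<inter> T j \<subseteq> M" if "i < j" "j \<le> m" for i j
  proof (cases i)
    case 0
    then obtain k where "j = Suc k" using \<open>i < j\<close> not0_implies_Suc by blast
    then show ?thesis using T0[of k] 0 that zM[of 0] zM[of 1] by auto
  next
    case (Suc k)
    then obtain k' where "j = Suc k'" using \<open>i < j\<close> not0_implies_Suc by (metis less_nat_zero_code)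
    then show ?thesis using TB[of k k'] Suc that zM[of j] by (auto split: if_splits)
  qed
  have HT: "H \<inter> T i \<subseteq> {z i, z (Suc i)}" if "i \<le> m" for i
  proof (cases i)
    case 0
    have "H \<inter> T 0 \<subseteq> {z 0, z (Suc 0)}" using LH chain_main[of _ D A] unfolding T H_def Ch_def z by auto
    then show ?thesis using 0 by simp
  next
    case (Suc j)
    have "H \<inter> T (Suc j) \<subseteq> {z (Suc j), z (Suc (Suc j))}" using bridge_main[of _ D j] unfolding T H_def z by auto
    then show ?thesis using Suc by simp
  qed
  have cov: "covers (T i) (z i) (z (Suc i)) (Suc m)" if "i \<le> m" for i
  proof (cases i)
    case 0
    have "covers L (corner (2 * m)) (corner 1) (Suc m)" unfolding L_def by (intro covers_link) presburger
    moreover have "covers Ch (corner 1) (corner 0) (Suc m)" unfolding Ch_def using chain_covers n by simp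
    ultimately have "covers (L \<union> Ch) (corner (2 * m)) (corner 0) (Suc m)"
      using LC by (intro covers_join) auto
    then show ?thesis using 0 by (simp add: z T)
  next
    case (Suc j)
    then show ?thesis using bridge_covers[OF D(1), of j "Suc m"] by (simp add: z T)
  qed
  have link: "\<exists>a b B. arc_between B a b \<and> B \<subseteq> H \<and> S \<subseteq> B \<and> (z i \<in> M \<longrightarrow> a = z i) \<and> (z (Suc i) \<in> M \<longrightarrow> b = z (Suc i)) \<and>
         B \<inter> M \<subseteq> {z i, z (Suc i)}"
    if S: "i \<le> m" "finite S" "card S \<le> Suc m" "S \<subseteq> H - M" for i S
  proof -
    obtain a b where ab: "z i = corner (2 * a)" "z (Suc i) = corner (2 * b)" "a < D" "b < D" "a \<noteq> b"
    proof (cases i)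
      case 0
      then show ?thesis using that[of m 0] z D n by simp
    next
      case (Suc j)
      then show ?thesis using that[of j "Suc j"] z D S(1) by simp
    qed
    have "\<exists>B. arc_between B (corner (2 * a)) (corner (2 * b)) \<and> B \<subseteq> cell (Hub (evens D)) \<and> S \<subseteq> B \<and>
        (\<forall>k. corner k \<in> B \<longrightarrow> k = 2 * a \<or> k = 2 * b \<or> corner k \<in> S)"
      by (rule hub_arc[of _ "Suc m"]) (use ab S n in \<open>auto simp: H_def\<close>)
    then obtain B where B: "arc_between B (corner (2 * a)) (corner (2 * b))" "B \<subseteq> H" "S \<subseteq> B"
        "\<And>k. corner k \<in> B \<Longrightarrow> k = 2 * a \<or> k = 2 * b \<or> corner k \<in> S" unfolding H_def by blast
    have "B \<inter> M \<subseteq> {z i, z (Suc i)}"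
    proof
      fix y assume y: "y \<in> B \<inter> M"
      then obtain k where "y = z k" by (auto simp: M_def)
      then obtain c where "y = corner c" by (cases k) (auto simp: z)
      then show "y \<in> {z i, z (Suc i)}" using B(4)[of c] y S(4) ab by auto
    qed
    then show ?thesis using B ab by (intro exI[of _ "corner (2 * a)"] exI[of _ "corner (2 * b)"] exI[of _ B]) simp
  qed
  have "n_cc n (top_of_set X)"
    unfolding n_cc_def
  proof (intro allI impI)
    fix S assume S: "S \<subseteq> topspace (top_of_set X) \<and> finite S \<and> card S \<le> n"
    have "\<exists>B y. (\<forall>i\<le>m. arc_between (B i) (y i) (y (Suc i)) \<and> B i \<subseteq> H \<union> T i) \<and>
     (\<forall>i\<le>Suc m. z i \<in> M \<longrightarrow> y i = z i) \<and>
     (\<forall>i\<le>m. \<forall>j\<le>m. i \<noteq> j \<longrightarrow> B i \<inter> B j \<subseteq> (T i \<inter> T j) \<union> ({z i, z (Suc i)} \<inter> {z j, z (Suc j)} \<inter> M)) \<and>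
     S \<subseteq> (\<Union>i\<le>m. B i)"
    proof (rule slot_arcs)
      show "M \<subseteq> z ` {..Suc m}" by (simp add: M_def)
      show "T i \<inter> T j \<subseteq> M" if "i \<le> m" "j \<le> m" "i \<noteq> j" for i j
        using TT[of i j] TT[of j i] that by (metis Int_commute linorder_neqE_nat)
      show "H \<inter> T i \<subseteq> {z i, z (Suc i)} \<inter> M" if "i \<le> m" for i
        using HT[OF that] zM[of i] zM[of "Suc i"] that by auto
      show "finite S" "card S \<le> Suc m" "S \<subseteq> H \<union> (\<Union>i\<le>m. T i)" using S n X by simp_all
    qed (use cov zM link in auto)
    then obtain B y where B': "\<forall>i\<le>m. arc_between (B i) (y i) (y (Suc i)) \<and> B i \<subseteq> H \<union> T i"
      "\<forall>i\<le>Suc m. z i \<in> M \<longrightarrow> y i = z i"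
      "\<forall>i\<le>m. \<forall>j\<le>m. i \<noteq> j \<longrightarrow> B i \<inter> B j \<subseteq> (T i \<inter> T j) \<union> ({z i, z (Suc i)} \<inter> {z j, z (Suc j)} \<inter> M)"
      "S \<subseteq> (\<Union>i\<le>m. B i)" by (elim exE conjE)
    note B = B'(1)[rule_format, THEN conjunct1] B'(1)[rule_format, THEN conjunct2] B'(2)[rule_format] B'(3)[rule_format] B'(4)
    have arcs: "arc_between (B i) (z i) (z (Suc i))" if "i \<le> m" for i
      using B(1)[OF that] B(3)[of i] B(3)[of "Suc i"] zM[of i] zM[of "Suc i"] that by simp
    \<comment> \<open>The slots from 1 to \<open>m\<close> give an arc from \<open>z 1\<close> to
      \<open>z 0\<close>, which slot 0 closes up.\<close>
    define C where "C = (\<Union>i\<le>m - 1. B (Suc i))"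
    have BB: "B (Suc i) \<inter> B (Suc j) \<subseteq> (if j = Suc i then {z (Suc j)} else {})" if "i < j" "j < m" for i j
    proof -
      have "B (Suc i) \<inter> B (Suc j) \<subseteq> (T (Suc i) \<inter> T (Suc j)) \<union> ({z (Suc i), z (Suc (Suc i))} \<inter> {z (Suc j), z (Suc (Suc j))})"
        using B(4)[of "Suc i" "Suc j"] that by auto
      moreover have "{z (Suc i), z (Suc (Suc i))} \<inter> {z (Suc j), z (Suc (Suc j))} \<subseteq> (if j = Suc i then {z (Suc j)} else {})"
        using that by (auto simp: z)
      ultimately show ?thesis using TB[OF that] by blast
    qed
    have "arc_between C (z (Suc 0)) (z (Suc (Suc (m - 1))))"
      unfolding C_def
    proof (rule arc_between_chain[where z = "\<lambda>i. z (Suc i)"])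
      show "arc_between (B (Suc i)) (z (Suc i)) (z (Suc (Suc i)))" if "i \<le> m - 1" for i using arcs that n by simp
      show "B (Suc i) \<inter> B (Suc (Suc i)) \<subseteq> {z (Suc (Suc i))}" if "i < m - 1" for i using BB[of i "Suc i"] that by simp
      show "B (Suc i) \<inter> B (Suc j) = {}" if "i + 1 < j" "j \<le> m - 1" for i j using BB[of i j] that n by simp
    qed
    moreover have "z (Suc (Suc (m - 1))) = z 0" using n by (simp add: z)
    ultimately have C: "arc_between C (z (Suc 0)) (z 0)" by simp
    have "B 0 \<inter> C \<subseteq> {z 0, z (Suc 0)}"
    proof
      fix x assume "x \<in> B 0 \<inter> C"
      then obtain i where "i \<le> m - 1" and x: "x \<in> B 0" "x \<in> B (Suc i)" unfolding C_def by blast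
      then have i: "i < m" "x \<in> B 0" "x \<in> B (Suc i)" using n by simp_all
      then have "x \<in> (T 0 \<inter> T (Suc i)) \<union> {z 0, z (Suc 0)}" using B(4)[of 0 "Suc i"] by auto
      then show "x \<in> {z 0, z (Suc 0)}" using T0[OF i(1)] by auto
    qed
    moreover have un: "(\<Union>i\<le>m. B i) = B 0 \<union> C"
    proof -
      have "{..m} = insert 0 (Suc ` {..m - 1})" using n by (cases m) (simp_all add: atMost_Suc_eq_insert_0)
      then show ?thesis unfolding C_def by auto
    qed
    moreover have "B 0 \<union> C \<subseteq> X" unfolding un[symmetric] X using B(2) by blast
    ultimately have "simple_closed_curve_in (top_of_set X) (B 0 \<union> C)"
      using simple_closed_curve_inI[OF arcs[of 0] C] by simp
    then show "\<exists>C. simple_closed_curve_in (top_of_set X) C \<and> S \<subseteq> C" using B(5) un by blast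
  qed
  moreover have "\<not> n_cc (n + 1) (top_of_set X)"
  proof
    assume cc: "n_cc (n + 1) (top_of_set X)"
    \<comment> \<open>The pieces are the \<open>m + 1\<close> slots and, at index
      \<open>Suc m\<close>, the hub.\<close>
    define Q where "Q = (\<lambda>i. if i \<le> m then T i else H)"
    have fM: "finite M" by (simp add: M_def)
    have "infinite H"
    proof -
      obtain B where "arc_between B (z 0) (z 1)" "B \<subseteq> H" using link[of 0 "{}"] zM[of 0] zM[of 1] by auto
      then show ?thesis using arc_between_infinite finite_subset by blast
    qed
    then have "infinite (Q i)" for i using cov[of i] slot_infinite unfolding Q_def by auto
    then have "\<exists>q. q \<in> Q i - M" for i using fM by (metis Diff_infinite_finite finite.emptyI ex_in_conv)
    then obtain q where q: "\<And>i. q i \<in> Q i - M" by metis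
    have "q ` {..Suc m} \<subseteq> X" using q X unfolding Q_def by (force split: if_splits)
    moreover have "card (q ` {..Suc m}) \<le> n + 1" using card_image_le[of "{..Suc m}" q] n by simp
    ultimately obtain C where C: "simple_closed_curve_in (top_of_set X) C" "q ` {..Suc m} \<subseteq> C"
      using cc unfolding n_cc_def by (metis finite_atMost finite_imageI topspace_euclidean_subtopology)
    have CX: "C \<subseteq> X" "C homeomorphic sphere (0::complex) 1"
      using C(1) unfolding simple_closed_curve_in_def
      by (simp_all add: subtopology_subtopology homeomorphic_space_top_of_set) (metis inf.absorb2)
    have closedQ: "closed (Q i)" for i
    proof -
      have "closed H" "closed Ch" "closed L" unfolding H_def Ch_def L_def using closed_cell wf_chain[of D A] D by auto
      moreover have "closed (bridge D j)" for j unfolding bridge_def by (intro closed_Un closed_cell) simp_all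
      ultimately show ?thesis unfolding Q_def T_def by (auto split: nat.splits)
    qed
    have QQ: "Q i \<inter> Q j \<subseteq> M" if "i < j" "j \<le> Suc m" for i j
    proof (cases "j \<le> m")
      case True
      then show ?thesis using TT[of i j] that by (simp add: Q_def)
    next
      case False
      then show ?thesis using HT[of i] zM[of i] zM[of "Suc i"] that by (auto simp: Q_def)
    qed
    have "card {..Suc m} \<le> card M"
    proof (rule loop_pieces[OF CX(2), where Q = Q and q = q])
      have "(\<Union>i\<in>{..Suc m}. Q i) = X" unfolding X Q_def by (auto simp: atMost_Suc)
      then show "C \<subseteq> (\<Union>i\<in>{..Suc m}. Q i)" using CX(1) by simp
      show "Q i \<inter> Q j \<subseteq> M" if "i \<in> {..Suc m}" "j \<in> {..Suc m}" "i \<noteq> j" for i j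
        using QQ[of i j] QQ[of j i] that by (metis Int_commute atMost_iff linorder_neqE_nat)
    qed (use q C closedQ fM in auto)
    \<comment> \<open>Since \<open>z 0\<close> and \<open>z (Suc m)\<close> coincide, there are at
      most \<open>m + 1\<close> separating points for \<open>m + 2\<close> pieces.\<close>
    moreover have "M = z ` {..m}"
    proof -
      have "z (Suc m) = z 0" by (simp add: z)
      then show ?thesis unfolding M_def by (auto simp: atMost_Suc)
    qed
    then have "card M \<le> Suc m" using card_image_le[of "{..m}" z] by simp
    ultimately show False by simp
  qed
  ultimately show ?thesis unfolding X_def by blast
qed

lemma ac_space:
  assumes n: "n = Suc (Suc m)" "D = 20 * n + 20"
  shows "n_ac n (top_of_set (hub_space D (ac_links D m) A)) \<and> \<not> n_ac (n + 1) (top_of_set (hub_space D (ac_links D m) A))"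
proof -
  define H where "H = cell (Hub (evens D))"
  define Ch where "Ch = cell (Chain (spots D A))"
  define L where "L = cell (Hub {2 * m, 2 * (D + Suc m)})"
  define z where "z = (\<lambda>i. case i of 0 \<Rightarrow> corner 1 | Suc j \<Rightarrow> if j \<le> m then corner (2 * j) else corner (2 * (D + Suc m)))"
  define T where "T = (\<lambda>i. case i of 0 \<Rightarrow> Ch | Suc j \<Rightarrow> if j < m then bridge D j else L)"
  \<comment> \<open>The free ends of the outer slots are not included, so an arc in the hub that
    replaces an outer slot may end elsewhere.\<close>
  define M where "M = z ` {1..Suc m}"
  define X where "X = hub_space D (ac_links D m) A"
  have z: "z 0 = corner 1" "j \<le> m \<Longrightarrow> z (Suc j) = corner (2 * j)" "z (Suc (Suc m)) = corner (2 * (D + Suc m))" for j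
    by (simp_all add: z_def)
  have T: "T 0 = Ch" "j < m \<Longrightarrow> T (Suc j) = bridge D j" "T (Suc m) = L" for j by (simp_all add: T_def)
  have X: "X = H \<union> (\<Union>i\<le>Suc m. T i)"
  proof -
    have "X = H \<union> Ch \<union> L \<union> (\<Union>(i, j)\<in>bridge_links D m. cell (Hub {i, j}))"
      unfolding X_def hub_space_def pieces_def ac_links_def H_def Ch_def L_def by auto
    also have "\<dots> = H \<union> (T 0 \<union> (\<Union>i<m. T (Suc i)) \<union> T (Suc m))" unfolding bridges_space using T by auto
    also have "T 0 \<union> (\<Union>i<m. T (Suc i)) \<union> T (Suc m) = (\<Union>i\<le>Suc m. T i)"
    proof -
      have "{..Suc m} = insert 0 (insert (Suc m) (Suc ` {..<m}))"
      proof -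
        have "{..m} = insert 0 (Suc ` {..<m})" unfolding lessThan_Suc_atMost[symmetric] by (rule lessThan_Suc_eq_insert_0)
        then show ?thesis unfolding atMost_Suc by blast
      qed
      then show ?thesis by auto
    qed
    finally show ?thesis .
  qed
  have D: "1 < D" "m < D" "Suc m < D" "Suc (Suc m) < D" using n by simp_all
  have zinj: "i = j" if "z i = z j" "i \<le> Suc (Suc m)" "j \<le> Suc (Suc m)" for i j
  proof -
    have odd: "1 \<noteq> 2 * k" "2 * k \<noteq> 1" for k :: nat by presburger+
    have small: "2 * k \<noteq> 2 * (D + Suc m)" "2 * (D + Suc m) \<noteq> 2 * k" if "k \<le> m" for k using that by simp_all
    have code: "z i = corner (case i of 0 \<Rightarrow> 1 | Suc j \<Rightarrow> if j \<le> m then 2 * j else 2 * (D + Suc m))" for i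
      by (simp add: z_def split: nat.splits)
    show ?thesis using that odd small unfolding code corner_inject
      by (cases i; cases j) (auto split: if_splits)
  qed
  have LC: "m = 0 \<and> y = corner 0" if "y \<in> L" "y \<in> Ch" for y
  proof -
    have "{2 * m, 2 * (D + Suc m)} \<inter> ({0} \<union> {k. odd k}) \<subseteq> (if m = 0 then {0} else {})" by auto
    then have sub: "support (Hub {2 * m, 2 * (D + Suc m)}) \<inter> support (Chain (spots D A)) \<subseteq> (if m = 0 then {0} else {})"
      using support_chain[of D A] by (auto simp del: support.simps(2))
    show ?thesis
    proof (cases "m = 0")
      case True
      then show ?thesis using cell_meet_single[of y _ "Chain (spots D A)" 0] sub that unfolding L_def Ch_def by simp
    next
      case False
      have e: "support (Hub {2 * m, 2 * (D + Suc m)}) \<inter> support (Chain (spots D A)) = {}"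
        using sub[unfolded if_not_P[OF False]] by (rule subset_empty[THEN iffD1])
      show ?thesis using cell_meet_empty[OF _ _ e] that unfolding L_def Ch_def by blast
    qed
  qed
  have LH: "y = corner (2 * m)" if "y \<in> L" "y \<in> H" for y
  proof (rule cell_meet_single)
    have "2 * (D + Suc m) \<notin> evens D" by (subst mem_evens) simp
    then show "support (Hub {2 * m, 2 * (D + Suc m)}) \<inter> support (Hub (evens D)) \<subseteq> {2 * m}" by auto
  qed (use that in \<open>simp_all add: L_def H_def\<close>)
  have LB: "m = Suc j \<and> y = corner (2 * m)" if yB: "y \<in> bridge D j" and "y \<in> L" "j < m" for y j
  proof -
    obtain a where a: "a \<in> {{2 * j, 2 * (D + j)}, {2 * (D + j), 2 * Suc j}}" "y \<in> cell (Hub a)"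
      using yB unfolding bridge_def by blast
    have sub: "support (Hub a) \<inter> support (Hub {2 * m, 2 * (D + Suc m)}) \<subseteq> (if m = Suc j then {2 * m} else {})"
      using a(1) that(3) D by (elim insertE emptyE) auto
    show ?thesis
    proof (cases "m = Suc j")
      case True
      then show ?thesis using cell_meet_single[OF a(2), of _ "2 * m"] sub that(2) unfolding L_def by simp
    next
      case False
      have e: "support (Hub a) \<inter> support (Hub {2 * m, 2 * (D + Suc m)}) = {}"
        using sub[unfolded if_not_P[OF False]] by (rule subset_empty[THEN iffD1])
      show ?thesis using cell_meet_empty[OF a(2) _ e] that(2) unfolding L_def by blast
    qed
  qed
  have TT: "T i \<inter> T j \<subseteq> (if j = Suc i then {z j} else {})" if ij: "i < j" "j \<le> Suc m" for i j
  proof -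
    obtain k where k: "j = Suc k" using ij(1) not0_implies_Suc by (metis less_nat_zero_code)
    show ?thesis
    proof (cases i)
      case 0
      show ?thesis
      proof (cases "k < m")
        case True
        then show ?thesis using bridge_chain[of _ D k A] 0 k D z(2)[of k] T unfolding Ch_def by auto
      next
        case False
        then have "k = m" using ij k by simp
        then show ?thesis using LC 0 k z(2)[of k] T by auto
      qed
    next
      case (Suc i')
      then have i': "i' < m" "i' < k" using ij k by simp_all
      show ?thesis
      proof (cases "k < m")
        case True
        then show ?thesis using bridge_bridge[of _ D i' k] i' k Suc D z(2)[of k] T by auto
      next
        case False
        then have "k = m" using ij k by simp
        then show ?thesis using LB[of _ i'] i' k Suc z(2)[of k] T by auto
      qed
    qed
  qed
  have zM: "z i \<in> M" if "1 \<le> i" "i \<le> Suc m" for i using that by (simp add: M_def)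
  have zM': "z 0 \<notin> M" "z (Suc (Suc m)) \<notin> M"
    using zinj[of 0] zinj[of "Suc (Suc m)"] unfolding M_def by fastforce+
  have HT: "H \<inter> T i \<subseteq> {z i, z (Suc i)} \<inter> M" if i: "i \<le> Suc m" for i
  proof (cases i)
    case 0
    have "H \<inter> T 0 \<subseteq> {z (Suc 0)}" using chain_main[of _ D A] z(2)[of 0] unfolding T H_def Ch_def by auto
    then show ?thesis using 0 zM[of 1] by auto
  next
    case (Suc j)
    show ?thesis
    proof (cases "j < m")
      case True
      then show ?thesis using bridge_main[of _ D j] Suc z(2)[of j] z(2)[of "Suc j"] zM[of i] zM[of "Suc i"] T(2)[of j] unfolding H_def by auto
    next
      case False
      then have "j = m" using Suc i by simp
      then show ?thesis using LH Suc z(2)[of j] zM[of i] T(3) i by auto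
    qed
  qed
  have cov: "covers (T i) (z i) (z (Suc i)) (Suc (Suc m))" if i: "i \<le> Suc m" for i
  proof (cases i)
    case 0
    have "covers Ch (corner 1) (corner 0) (Suc (Suc m))" unfolding Ch_def using chain_covers n by simp
    then show ?thesis using 0 z(1) z(2)[of 0] by (simp add: T)
  next
    case (Suc j)
    show ?thesis
    proof (cases "j < m")
      case True
      then show ?thesis using bridge_covers[OF D(1), of j "Suc (Suc m)"] Suc z(2)[of j] z(2)[of "Suc j"] T(2)[of j] by simp
    next
      case False
      then have "j = m" using Suc i by simp
      moreover have "covers L (corner (2 * m)) (corner (2 * (D + Suc m))) (Suc (Suc m))"
        unfolding L_def by (intro covers_link) simp
      ultimately show ?thesis using Suc z(2)[of m] z(3) T(3) by simp
    qed
  qed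
  have link: "\<exists>a b B. arc_between B a b \<and> B \<subseteq> H \<and> S \<subseteq> B \<and> (z i \<in> M \<longrightarrow> a = z i) \<and> (z (Suc i) \<in> M \<longrightarrow> b = z (Suc i)) \<and>
         B \<inter> M \<subseteq> {z i, z (Suc i)}"
    if S: "i \<le> Suc m" "finite S" "card S \<le> Suc (Suc m)" "S \<subseteq> H - M" for i S
  proof -
    have Mc: "\<exists>c\<le>m. y = corner (2 * c)" if y: "y \<in> M" for y
    proof -
      obtain k where "1 \<le> k" "k \<le> Suc m" "y = z k" using y by (auto simp: M_def)
      then show ?thesis using z(2)[of "k - 1"] by (intro exI[of _ "k - 1"]) simp
    qed
    \<comment> \<open>In place of a free end the arc in the hub uses corner
      \<open>2 * Suc m\<close>, which is on the hub because \<open>Suc m < D\<close> but on no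
      slot.\<close>
    obtain a b where ab: "a < D" "b < D" "a \<noteq> b" "z i = corner (2 * a) \<or> z i \<notin> M \<and> m < a"
      "z (Suc i) = corner (2 * b) \<or> z (Suc i) \<notin> M \<and> m < b"
    proof (cases i)
      case 0
      then show ?thesis using that[of "Suc m" 0] z(2)[of 0] zM' D by simp
    next
      case (Suc j)
      show ?thesis
      proof (cases "j < m")
        case True
        then show ?thesis using that[of j "Suc j"] Suc z(2)[of j] z(2)[of "Suc j"] D by simp
      next
        case False
        then have "j = m" using Suc S(1) by simp
        then show ?thesis using that[of m "Suc m"] Suc z(2)[of m] zM' D by simp
      qed
    qed
    have "\<exists>B. arc_between B (corner (2 * a)) (corner (2 * b)) \<and> B \<subseteq> cell (Hub (evens D)) \<and> S \<subseteq> B \<and>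
        (\<forall>k. corner k \<in> B \<longrightarrow> k = 2 * a \<or> k = 2 * b \<or> corner k \<in> S)"
      by (rule hub_arc[of _ "Suc (Suc m)"]) (use ab S n in \<open>auto simp: H_def\<close>)
    then obtain B where B: "arc_between B (corner (2 * a)) (corner (2 * b))" "B \<subseteq> H" "S \<subseteq> B"
        "\<And>k. corner k \<in> B \<Longrightarrow> k = 2 * a \<or> k = 2 * b \<or> corner k \<in> S" unfolding H_def by blast
    have "B \<inter> M \<subseteq> {z i, z (Suc i)}"
    proof
      fix y assume y: "y \<in> B \<inter> M"
      then obtain c where c: "c \<le> m" "y = corner (2 * c)" using Mc by blast
      then have "c = a \<or> c = b" using B(4)[of "2 * c"] y S(4) by auto
      then show "y \<in> {z i, z (Suc i)}" using ab(4,5) c by auto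
    qed
    then show ?thesis using B ab by (intro exI[of _ "corner (2 * a)"] exI[of _ "corner (2 * b)"] exI[of _ B]) auto
  qed
  have "n_ac n (top_of_set X)"
    unfolding n_ac_def
  proof (intro allI impI)
    fix S assume S: "S \<subseteq> topspace (top_of_set X) \<and> finite S \<and> card S \<le> n"
    have "\<exists>B y. (\<forall>i\<le>Suc m. arc_between (B i) (y i) (y (Suc i)) \<and> B i \<subseteq> H \<union> T i) \<and>
     (\<forall>i\<le>Suc (Suc m). z i \<in> M \<longrightarrow> y i = z i) \<and>
     (\<forall>i\<le>Suc m. \<forall>j\<le>Suc m. i \<noteq> j \<longrightarrow> B i \<inter> B j \<subseteq> (T i \<inter> T j) \<union> ({z i, z (Suc i)} \<inter> {z j, z (Suc j)} \<inter> M)) \<and>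
     S \<subseteq> (\<Union>i\<le>Suc m. B i)"
    proof (rule slot_arcs)
      show "M \<subseteq> z ` {..Suc (Suc m)}" by (auto simp: M_def)
      have lt: "T i \<inter> T j \<subseteq> M" if "i < j" "j \<le> Suc m" for i j
        using TT[OF that] zM[of j] that by (auto split: if_splits)
      show "T i \<inter> T j \<subseteq> M" if "i \<le> Suc m" "j \<le> Suc m" "i \<noteq> j" for i j
        using lt[of i j] lt[of j i] that by (metis Int_commute linorder_neqE_nat)
      show "finite S" "card S \<le> Suc (Suc m)" "S \<subseteq> H \<union> (\<Union>i\<le>Suc m. T i)" using S n X by simp_all
    qed (use cov zM link HT in auto)
    then obtain B y where B': "\<forall>i\<le>Suc m. arc_between (B i) (y i) (y (Suc i)) \<and> B i \<subseteq> H \<union> T i"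
      "\<forall>i\<le>Suc (Suc m). z i \<in> M \<longrightarrow> y i = z i"
      "\<forall>i\<le>Suc m. \<forall>j\<le>Suc m. i \<noteq> j \<longrightarrow> B i \<inter> B j \<subseteq> (T i \<inter> T j) \<union> ({z i, z (Suc i)} \<inter> {z j, z (Suc j)} \<inter> M)"
      "S \<subseteq> (\<Union>i\<le>Suc m. B i)" by (elim exE conjE)
    note B = B'(1)[rule_format, THEN conjunct1] B'(1)[rule_format, THEN conjunct2] B'(2)[rule_format] B'(3)[rule_format] B'(4)
    have BB: "B i \<inter> B j \<subseteq> (if j = Suc i then {z j} else {})" if "i < j" "j \<le> Suc m" for i j
    proof -
      have "B i \<inter> B j \<subseteq> (T i \<inter> T j) \<union> ({z i, z (Suc i)} \<inter> {z j, z (Suc j)})"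
        using B(4)[of i j] that by auto
      moreover have "{z i, z (Suc i)} \<inter> {z j, z (Suc j)} \<subseteq> (if j = Suc i then {z j} else {})"
      proof
        fix x assume "x \<in> {z i, z (Suc i)} \<inter> {z j, z (Suc j)}"
        then obtain a b where ab: "a \<in> {i, Suc i}" "b \<in> {j, Suc j}" "x = z a" "x = z b" by blast
        then have "a = b" using zinj[of a b] that by auto
        then have "j = Suc i" "a = j" using ab that by auto
        then show "x \<in> (if j = Suc i then {z j} else {})" using ab by simp
      qed
      ultimately show ?thesis using TT[OF that] by blast
    qed
    have "arc_between (\<Union>i\<le>Suc m. B i) (y 0) (y (Suc (Suc m)))"
    proof (rule arc_between_chain)
      show "arc_between (B i) (y i) (y (Suc i))" if "i \<le> Suc m" for i using B(1) that .
      show "B i \<inter> B (Suc i) \<subseteq> {y (Suc i)}" if "i < Suc m" for i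
        using BB[of i "Suc i"] that B(3)[of "Suc i"] zM[of "Suc i"] by simp
      show "B i \<inter> B j = {}" if "i + 1 < j" "j \<le> Suc m" for i j using BB[of i j] that by simp
    qed
    moreover have "(\<Union>i\<le>Suc m. B i) \<subseteq> X" unfolding X using B(2) by blast
    ultimately have "arc_in (top_of_set X) (\<Union>i\<le>Suc m. B i)" by (rule arc_between_imp_arc_in)
    then show "\<exists>A. arc_in (top_of_set X) A \<and> S \<subseteq> A" using B(5) by blast
  qed
  moreover have "\<not> n_ac (n + 1) (top_of_set X)"
  proof
    assume ac: "n_ac (n + 1) (top_of_set X)"
    \<comment> \<open>There are \<open>m + 3\<close> pieces, while an arc can visit only one more
      piece than there are separating points, of which \<open>M\<close> has at most
      \<open>m + 1\<close>.\<close>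
    define Q where "Q = (\<lambda>i. if i \<le> Suc m then T i else H)"
    have fM: "finite M" by (simp add: M_def)
    have "infinite H"
    proof -
      obtain a b B where "arc_between B a b" "B \<subseteq> H" using link[of 0 "{}"] by auto
      then show ?thesis using arc_between_infinite finite_subset by blast
    qed
    then have "infinite (Q i)" for i using cov[of i] slot_infinite unfolding Q_def by auto
    then have "\<exists>q. q \<in> Q i - M" for i using fM by (metis Diff_infinite_finite finite.emptyI ex_in_conv)
    then obtain q where q: "\<And>i. q i \<in> Q i - M" by metis
    have "q ` {..Suc (Suc m)} \<subseteq> X" using q X unfolding Q_def by (force split: if_splits)
    moreover have "card (q ` {..Suc (Suc m)}) \<le> n + 1" using card_image_le[of "{..Suc (Suc m)}" q] n by simp
    ultimately obtain C where C: "arc_in (top_of_set X) C" "q ` {..Suc (Suc m)} \<subseteq> C"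
      using ac unfolding n_ac_def by (metis finite_atMost finite_imageI topspace_euclidean_subtopology)
    obtain a b where CX: "arc_between C a b" "C \<subseteq> X" using arc_in_imp_arc_between[OF C(1)] by blast
    have closedQ: "closed (Q i)" for i
    proof -
      have "closed H" "closed Ch" "closed L" unfolding H_def Ch_def L_def using closed_cell wf_chain[of D A] D by auto
      moreover have "closed (bridge D j)" for j unfolding bridge_def by (intro closed_Un closed_cell) simp_all
      ultimately show ?thesis unfolding Q_def T_def by (auto split: nat.splits)
    qed
    have QQ: "Q i \<inter> Q j \<subseteq> M" if "i < j" "j \<le> Suc (Suc m)" for i j
    proof (cases "j \<le> Suc m")
      case True
      then show ?thesis using TT[of i j] that zM[of j] by (auto simp: Q_def split: if_splits)
    next
      case False
      then show ?thesis using HT[of i] that by (auto simp: Q_def)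
    qed
    have "card {..Suc (Suc m)} \<le> card M + 1"
    proof (rule arc_pieces[OF CX(1), where Q = Q and q = q])
      have "(\<Union>i\<in>{..Suc (Suc m)}. Q i) = X" unfolding X Q_def by (auto simp: atMost_Suc)
      then show "C \<subseteq> (\<Union>i\<in>{..Suc (Suc m)}. Q i)" using CX(2) by simp
      show "Q i \<inter> Q j \<subseteq> M" if "i \<in> {..Suc (Suc m)}" "j \<in> {..Suc (Suc m)}" "i \<noteq> j" for i j
        using QQ[of i j] QQ[of j i] that by (metis Int_commute atMost_iff linorder_neqE_nat)
    qed (use q C closedQ fM in auto)
    moreover have "card M \<le> Suc m" using card_image_le[of "{1..Suc m}" z] by (simp add: M_def)
    ultimately show False by simp
  qed
  ultimately show ?thesis unfolding X_def by blast
qed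

theorem theorem4p10:
  fixes n :: nat
  assumes "n \<ge> 2"
  shows "continuum_many_nonhomeomorphic
           (\<lambda>X. graph_like_continuum X \<and> n_ac n X \<and> \<not> n_ac (n + 1) X)
       \<and> continuum_many_nonhomeomorphic
           (\<lambda>X. graph_like_continuum X \<and> n_cc n X \<and> \<not> n_cc (n + 1) X)"
proof
  define D where "D = 20 * n + 20"
  have D: "3 \<le> D" by (simp add: D_def)
  \<comment> \<open>The arc version has \<open>n\<close> slots made of the chain,
    \<open>n - 2\<close> bridges and the last link; in the circle version the closing slot leaves
    \<open>n - 1\<close> bridges.\<close>
  have G: "admissible D (ac_links D (n - 2))" using admissible_ac[OF D] .
  show "continuum_many_nonhomeomorphic (\<lambda>X. graph_like_continuum X \<and> n_ac n X \<and> \<not> n_ac (n + 1) X)"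
  proof (rule continuum_many_spaces[OF G])
    fix A
    have "n_ac n (top_of_set (hub_space D (ac_links D (n - 2)) A)) \<and> \<not> n_ac (n + 1) (top_of_set (hub_space D (ac_links D (n - 2)) A))"
      using ac_space[of n "n - 2" D A] assms D_def by simp
    then show "graph_like_continuum (top_of_set (hub_space D (ac_links D (n - 2)) A)) \<and>
        n_ac n (top_of_set (hub_space D (ac_links D (n - 2)) A)) \<and> \<not> n_ac (n + 1) (top_of_set (hub_space D (ac_links D (n - 2)) A))"
      using space_graph_like[OF G] n_ac_connected assms by blast
  qed
  have G': "admissible D (cc_links D (n - 1))" using admissible_cc[OF D] assms by simp
  show "continuum_many_nonhomeomorphic (\<lambda>X. graph_like_continuum X \<and> n_cc n X \<and> \<not> n_cc (n + 1) X)"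
  proof (rule continuum_many_spaces[OF G'])
    fix A
    have "n_cc n (top_of_set (hub_space D (cc_links D (n - 1)) A)) \<and> \<not> n_cc (n + 1) (top_of_set (hub_space D (cc_links D (n - 1)) A))"
      using cc_space[of n "n - 1" D A] assms D_def by simp
    then show "graph_like_continuum (top_of_set (hub_space D (cc_links D (n - 1)) A)) \<and>
        n_cc n (top_of_set (hub_space D (cc_links D (n - 1)) A)) \<and> \<not> n_cc (n + 1) (top_of_set (hub_space D (cc_links D (n - 1)) A))"
      using space_graph_like[OF G'] n_cc_connected assms by blast
  qed
qed

end
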